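(* Let $\alpha\in(0,1)$, let $d\in\{2,3,4\}$, let $\Omega\subset\mathbb{R}^d$ be a bounded domain with sufficiently smooth boundary, let $\eta\in\mathbb{R}^d$ be a constant vector, and let $H(u)=(\eta\cdot\nabla)u+\nabla\cdot F(u)$ with $F(u)=(u^2,u^2,\dots,u^2)\in\mathbb{R}^d$. If $u_0\in D^1(\Omega)$, then the problem $$\partial_t^\alpha u-\partial_t^\alpha\Delta u-\Delta u=H(u)\ \text{ in }\Omega\times(0,\infty),\qquad u=0\ \text{ on }\partial\Omega\times(0,\infty),\qquad u(\cdot,0)=u_0\ \text{ in }\Omega,$$ possesses a locally unique mild solution; that is, there is $\mathscr{T}>0$ such that the problem has a unique mild solution in $C([0,\mathscr{T}]\to D^1(\Omega))$.
   Context: $\partial_t^\alpha$ is the Caputo time derivative of order $\alpha$. Let $0<\theta_1\le\theta_2\le\dots$ be the eigenvalues of $-\Delta$ on $\Omega$ with homogeneous Dirichlet condition, and $\{\phi_k\}_{k\in\mathbb{N}}$ corresponding eigenfunctions forming a complete orthonormal system of $L^2(\Omega)$. For $\nu\ge 0$, $D^\nu(\Omega)=\{w\in L^2(\Omega): \|w\|_{D^\nu(\Omega)}^2=\sum_{k}\theta_k^\nu\langle w,\phi_k\rangle^2<\infty\}$, and $D^{-\nu}(\Omega)$ is its dual space with norm $\big(\sum_k\theta_k^{-\nu}\langle w,\phi_k\rangle^2\big)^{1/2}$, where the duality pairing $\langle w,v\rangle$ equals $\int_\Omega wv\,dz$ when $w\in L^2(\Omega)$. For $u\in D^1(\Omega)$,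 $H(u)$ is regarded as an element of $D^{-1}(\Omega)$. For a Banach space $X$ and a compact interval $I$, $C(I\to X)$ is the space of continuous functions $w:I\to X$ with the sup norm. The Mittag-Leffler functions are $E_{\alpha,\zeta}(z)=\sum_{k=0}^\infty z^k/\Gamma(\alpha k+\zeta)$ and $E_\alpha=E_{\alpha,1}$. Define $$\mathscr{S}(t)w=\sum_{k=1}^\infty E_\alpha\Big(\frac{-\theta_kt^\alpha}{1+\theta_k}\Big)\langle w,\phi_k\rangle\phi_k,\qquad \mathscr{R}(t)w=\sum_{k=1}^\infty\frac{t^{\alpha-1}}{1+\theta_k}E_{\alpha,\alpha}\Big(\frac{-\theta_kt^\alpha}{1+\theta_k}\Big)\langle w,\phi_k\rangle\phi_k .$$ A mild solution on $[0,\mathscr{T}]$ is a function $u$ satisfying, for $t\in[0,\mathscr{T}]$, $$u(t)=\mathscr{S}(t)u_0+\int_0^t\mathscr{R}(t-\tau)H(u(\tau))\,d\tau .$$ *)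

theory Defs
  imports "HOL-Analysis.Analysis"
begin

section \<open>Smooth functions and domains\<close>

definition partial_deriv :: "'n::finite \<Rightarrow> (real^'n \<Rightarrow> real) \<Rightarrow> real^'n \<Rightarrow> real" where
  "partial_deriv i f x = frechet_derivative f (at x) (axis i 1)"

text \<open>Intended for open \<open>S\<close> only.\<close>
primrec Ck_on :: "nat \<Rightarrow> (real^'n::finite) set \<Rightarrow> (real^'n \<Rightarrow> real) \<Rightarrow> bool" where
  "Ck_on 0 S f \<longleftrightarrow> continuous_on S f"
| "Ck_on (Suc k) S f \<longleftrightarrow>
     f differentiable_on S \<and> (\<forall>i. Ck_on k S (partial_deriv i f))"

text \<open>Near each boundary point the domain is, after relabelling and reorienting the coordinate
  axes, the region above the graph of a \<open>C\<^sup>k\<close> function of the remaining coordinates.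
  Here \<open>i\<close> is the distinguished coordinate and \<open>\<sigma>\<close> its orientation; \<open>\<gamma>\<close> is evaluated at the
  point of the hyperplane \<open>x\<^sub>i = 0\<close> below \<open>x\<close>, i.e. it is a function of \<open>d - 1\<close> variables.\<close>
definition Ck_boundary :: "nat \<Rightarrow> (real^'n::finite) set \<Rightarrow> bool" where
  "Ck_boundary k \<Omega> \<longleftrightarrow>
     (\<forall>p\<in>frontier \<Omega>. \<exists>r>0. \<exists>i. \<exists>\<sigma>\<in>{-1, 1}. \<exists>\<gamma>. Ck_on k UNIV \<gamma> \<and>
        \<Omega> \<inter> ball p r =
          {x \<in> ball p r. \<gamma> (\<chi> j. if j = i then 0 else x $ j) < \<sigma> * (x $ i)})"

definition test_functions :: "(real^'n::finite) set \<Rightarrow> (real^'n \<Rightarrow> real) set" where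
  "test_functions \<Omega> =
     {\<psi>. (\<forall>k. Ck_on k UNIV \<psi>) \<and> compact (closure {x. \<psi> x \<noteq> 0}) \<and> closure {x. \<psi> x \<noteq> 0} \<subseteq> \<Omega>}"

section \<open>Square integrable functions and Sobolev spaces\<close>

text \<open>Elements of all function spaces below are represented by functions on the whole space whose
  values outside \<open>\<Omega>\<close> are irrelevant, and which are identified when they agree almost
  everywhere in \<open>\<Omega>\<close>; the corresponding norms are therefore seminorms on representatives.\<close>

definition L2 :: "(real^'n::finite) set \<Rightarrow> (real^'n \<Rightarrow> real) set" where
  "L2 \<Omega> = {w \<in> borel_measurable (lebesgue_on \<Omega>). integrable (lebesgue_on \<Omega>) (\<lambda>x. (w x)\<^sup>2)}"

definition L2_inner ::
  "(real^'n::finite) set \<Rightarrow> (real^'n \<Rightarrow> real) \<Rightarrow> (real^'n \<Rightarrow> real) \<Rightarrow> real" where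
  "L2_inner \<Omega> w v = (LINT x|lebesgue_on \<Omega>. w x * v x)"

definition L2_norm :: "(real^'n::finite) set \<Rightarrow> (real^'n \<Rightarrow> real) \<Rightarrow> real" where
  "L2_norm \<Omega> w = sqrt (L2_inner \<Omega> w w)"

definition has_weak_grad ::
  "(real^'n::finite) set \<Rightarrow> (real^'n \<Rightarrow> real) \<Rightarrow> (real^'n \<Rightarrow> real^'n) \<Rightarrow> bool" where
  "has_weak_grad \<Omega> w G \<longleftrightarrow>
     (\<forall>i. (\<lambda>x. G x $ i) \<in> L2 \<Omega> \<and>
        (\<forall>\<psi>\<in>test_functions \<Omega>. L2_inner \<Omega> w (partial_deriv i \<psi>) = - L2_inner \<Omega> (\<lambda>x. G x $ i) \<psi>))"

text \<open>The weak gradient is determined only almost everywhere; a representative is chosen.\<close>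
definition weak_grad :: "(real^'n::finite) set \<Rightarrow> (real^'n \<Rightarrow> real) \<Rightarrow> real^'n \<Rightarrow> real^'n" where
  "weak_grad \<Omega> w = (SOME G. has_weak_grad \<Omega> w G)"

definition H1 :: "(real^'n::finite) set \<Rightarrow> (real^'n \<Rightarrow> real) set" where
  "H1 \<Omega> = {w \<in> L2 \<Omega>. \<exists>G. has_weak_grad \<Omega> w G}"

definition H1_0 :: "(real^'n::finite) set \<Rightarrow> (real^'n \<Rightarrow> real) set" where
  "H1_0 \<Omega> = {w \<in> H1 \<Omega>. \<exists>\<psi>. (\<forall>n::nat. \<psi> n \<in> test_functions \<Omega>) \<and>
      (\<lambda>n. L2_norm \<Omega> (\<lambda>x. \<psi> n x - w x)) \<longlonglongrightarrow> 0 \<and>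
      (\<forall>i. (\<lambda>n. L2_norm \<Omega> (\<lambda>x. partial_deriv i (\<psi> n) x - weak_grad \<Omega> w x $ i)) \<longlonglongrightarrow> 0)}"

section \<open>The Dirichlet Laplacian and its scale of spaces\<close>

text \<open>\<open>-\<Delta> f = \<mu> f\<close> with homogeneous Dirichlet condition, in the weak sense.\<close>
definition dirichlet_eigenfunction ::
  "(real^'n::finite) set \<Rightarrow> real \<Rightarrow> (real^'n \<Rightarrow> real) \<Rightarrow> bool" where
  "dirichlet_eigenfunction \<Omega> \<mu> f \<longleftrightarrow>
     f \<in> H1_0 \<Omega> \<and> \<not> (AE x in lebesgue_on \<Omega>. f x = 0) \<and>
     (\<forall>v\<in>H1_0 \<Omega>. (LINT x|lebesgue_on \<Omega>. weak_grad \<Omega> f x \<bullet> weak_grad \<Omega> v x) = \<mu> * L2_inner \<Omega> f v)"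

definition complete_orthonormal ::
  "(real^'n::finite) set \<Rightarrow> (nat \<Rightarrow> real^'n \<Rightarrow> real) \<Rightarrow> bool" where
  "complete_orthonormal \<Omega> \<phi> \<longleftrightarrow>
     (\<forall>k. \<phi> k \<in> L2 \<Omega>) \<and>
     (\<forall>j k. L2_inner \<Omega> (\<phi> j) (\<phi> k) = (if j = k then 1 else 0)) \<and>
     (\<forall>w\<in>L2 \<Omega>. (\<forall>k. L2_inner \<Omega> w (\<phi> k) = 0) \<longrightarrow> (AE x in lebesgue_on \<Omega>. w x = 0))"

text \<open>By completeness of \<open>\<phi>\<close>, every Dirichlet eigenvalue occurs in \<open>\<theta>\<close>, as often as its
  multiplicity. The numbering starts at \<open>0\<close>.\<close>
definition dirichlet_eigensystem ::
  "(real^'n::finite) set \<Rightarrow> (nat \<Rightarrow> real) \<Rightarrow> (nat \<Rightarrow> real^'n \<Rightarrow> real) \<Rightarrow> bool" where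
  "dirichlet_eigensystem \<Omega> \<theta> \<phi> \<longleftrightarrow>
     0 < \<theta> 0 \<and> incseq \<theta> \<and>
     (\<forall>k. dirichlet_eigenfunction \<Omega> (\<theta> k) (\<phi> k)) \<and>
     complete_orthonormal \<Omega> \<phi>"

definition D_space ::
  "(real^'n::finite) set \<Rightarrow> (nat \<Rightarrow> real) \<Rightarrow> (nat \<Rightarrow> real^'n \<Rightarrow> real) \<Rightarrow> real \<Rightarrow>
     (real^'n \<Rightarrow> real) set" where
  "D_space \<Omega> \<theta> \<phi> \<nu> = {w \<in> L2 \<Omega>. summable (\<lambda>k. \<theta> k powr \<nu> * (L2_inner \<Omega> w (\<phi> k))\<^sup>2)}"

definition D_norm ::
  "(real^'n::finite) set \<Rightarrow> (nat \<Rightarrow> real) \<Rightarrow> (nat \<Rightarrow> real^'n \<Rightarrow> real) \<Rightarrow> real \<Rightarrow>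
     (real^'n \<Rightarrow> real) \<Rightarrow> real" where
  "D_norm \<Omega> \<theta> \<phi> \<nu> w = sqrt (\<Sum>k. \<theta> k powr \<nu> * (L2_inner \<Omega> w (\<phi> k))\<^sup>2)"

text \<open>\<open>D\<^sup>-\<^sup>\<nu>(\<Omega>)\<close>: an element is a bounded linear functional \<open>l\<close> on \<open>D\<^sup>\<nu>(\<Omega>)\<close>, and the
  duality pairing of \<open>l\<close> and \<open>v\<close> is the value \<open>l v\<close>.\<close>
definition D_dual ::
  "(real^'n::finite) set \<Rightarrow> (nat \<Rightarrow> real) \<Rightarrow> (nat \<Rightarrow> real^'n \<Rightarrow> real) \<Rightarrow> real \<Rightarrow>
     ((real^'n \<Rightarrow> real) \<Rightarrow> real) set" where
  "D_dual \<Omega> \<theta> \<phi> \<nu> =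
     {l. (\<forall>v\<in>D_space \<Omega> \<theta> \<phi> \<nu>. \<forall>w\<in>D_space \<Omega> \<theta> \<phi> \<nu>. \<forall>a b.
            l (\<lambda>x. a * v x + b * w x) = a * l v + b * l w) \<and>
         (\<exists>C. \<forall>v\<in>D_space \<Omega> \<theta> \<phi> \<nu>. \<bar>l v\<bar> \<le> C * D_norm \<Omega> \<theta> \<phi> \<nu> v)}"

section \<open>The nonlinearity\<close>

definition flux :: "(real^'n::finite \<Rightarrow> real) \<Rightarrow> real^'n \<Rightarrow> real^'n" where
  "flux u x = (\<chi> i. (u x)\<^sup>2)"

text \<open>\<open>H(u) = (\<eta> \<cdot> \<nabla>)u + \<nabla> \<cdot> F(u)\<close> as a functional: the first term lies in \<open>L\<^sup>2\<close> and acts by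
  integration, the second is a divergence in the sense of distributions.\<close>
definition H_op ::
  "(real^'n::finite) set \<Rightarrow> real^'n \<Rightarrow> (real^'n \<Rightarrow> real) \<Rightarrow> (real^'n \<Rightarrow> real) \<Rightarrow> real" where
  "H_op \<Omega> \<eta> u v =
     (LINT x|lebesgue_on \<Omega>. (\<eta> \<bullet> weak_grad \<Omega> u x) * v x)
     - (LINT x|lebesgue_on \<Omega>. flux u x \<bullet> weak_grad \<Omega> v x)"

section \<open>Solution operators\<close>

definition mittag_leffler :: "real \<Rightarrow> real \<Rightarrow> real \<Rightarrow> real" where
  "mittag_leffler \<alpha> \<zeta> z = (\<Sum>k. z ^ k / Gamma (\<alpha> * real k + \<zeta>))"

text \<open>A representative of the sum, in \<open>L\<^sup>2(\<Omega>)\<close>, of the series of the \<open>c k * \<phi> k\<close>.\<close>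
definition L2_series ::
  "(real^'n::finite) set \<Rightarrow> (nat \<Rightarrow> real^'n \<Rightarrow> real) \<Rightarrow> (nat \<Rightarrow> real) \<Rightarrow> real^'n \<Rightarrow> real" where
  "L2_series \<Omega> \<phi> c =
     (SOME f. f \<in> L2 \<Omega> \<and> (\<lambda>n. L2_norm \<Omega> (\<lambda>x. f x - (\<Sum>k<n. c k * \<phi> k x))) \<longlonglongrightarrow> 0)"

definition S_op ::
  "(real^'n::finite) set \<Rightarrow> (nat \<Rightarrow> real) \<Rightarrow> (nat \<Rightarrow> real^'n \<Rightarrow> real) \<Rightarrow> real \<Rightarrow> real \<Rightarrow>
     (real^'n \<Rightarrow> real) \<Rightarrow> real^'n \<Rightarrow> real" where
  "S_op \<Omega> \<theta> \<phi> \<alpha> t w =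
     L2_series \<Omega> \<phi> (\<lambda>k. mittag_leffler \<alpha> 1 (- \<theta> k * t powr \<alpha> / (1 + \<theta> k)) * L2_inner \<Omega> w (\<phi> k))"

text \<open>The argument \<open>l\<close> is an element of \<open>D\<^sup>-\<^sup>1(\<Omega>)\<close>, i.e. a functional.\<close>
definition R_op ::
  "(real^'n::finite) set \<Rightarrow> (nat \<Rightarrow> real) \<Rightarrow> (nat \<Rightarrow> real^'n \<Rightarrow> real) \<Rightarrow> real \<Rightarrow> real \<Rightarrow>
     ((real^'n \<Rightarrow> real) \<Rightarrow> real) \<Rightarrow> real^'n \<Rightarrow> real" where
  "R_op \<Omega> \<theta> \<phi> \<alpha> t l =
     L2_series \<Omega> \<phi> (\<lambda>k. t powr (\<alpha> - 1) / (1 + \<theta> k)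
        * mittag_leffler \<alpha> \<alpha> (- \<theta> k * t powr \<alpha> / (1 + \<theta> k)) * l (\<phi> k))"

section \<open>Integration and continuity in a space of functions\<close>

text \<open>The library's Bochner integral lives on normed vector space types. The following is the same
  notion for a (semi)normed space given by a set \<open>X\<close> of functions and a seminorm \<open>N\<close> on \<open>X\<close>.
  The almost everywhere convergence of the simple functions expresses strong measurability
  of \<open>f\<close>.\<close>

definition simple_integral_fun :: "'t measure \<Rightarrow> ('t \<Rightarrow> 'b \<Rightarrow> real) \<Rightarrow> 'b \<Rightarrow> real" where
  "simple_integral_fun M s x = (\<Sum>w\<in>s ` space M. measure M (s -` {w} \<inter> space M) * w x)"

definition has_bochner_integral_in ::
  "('b \<Rightarrow> real) set \<Rightarrow> (('b \<Rightarrow> real) \<Rightarrow> real) \<Rightarrow> 't measure \<Rightarrow> ('t \<Rightarrow> 'b \<Rightarrow> real) \<Rightarrow>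
     ('b \<Rightarrow> real) \<Rightarrow> bool" where
  "has_bochner_integral_in X N M f I \<longleftrightarrow>
     I \<in> X \<and> (AE \<tau> in M. f \<tau> \<in> X) \<and>
     (\<exists>s. (\<forall>i::nat. simple_function M (s i) \<and> s i ` space M \<subseteq> X \<and>
             emeasure M {\<tau> \<in> space M. s i \<tau> \<noteq> (\<lambda>_. 0)} \<noteq> \<infinity>) \<and>
          (AE \<tau> in M. (\<lambda>i. N (\<lambda>x. f \<tau> x - s i \<tau> x)) \<longlonglongrightarrow> 0) \<and>
          (\<lambda>i. \<integral>\<^sup>+\<tau>. ennreal (N (\<lambda>x. f \<tau> x - s i \<tau> x)) \<partial>M) \<longlonglongrightarrow> 0 \<and>
          (\<lambda>i. N (\<lambda>x. simple_integral_fun M (s i) x - I x)) \<longlonglongrightarrow> 0)"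

definition C_in ::
  "('b \<Rightarrow> real) set \<Rightarrow> (('b \<Rightarrow> real) \<Rightarrow> real) \<Rightarrow> real set \<Rightarrow> (real \<Rightarrow> 'b \<Rightarrow> real) set" where
  "C_in X N J =
     {u. \<forall>t\<in>J. u t \<in> X \<and> ((\<lambda>s. N (\<lambda>x. u s x - u t x)) \<longlongrightarrow> 0) (at t within J)}"

section \<open>Mild solutions\<close>

text \<open>The integral is a Bochner integral in \<open>D\<^sup>1(\<Omega>)\<close>.\<close>
definition mild_solution ::
  "(real^'n::finite) set \<Rightarrow> (nat \<Rightarrow> real) \<Rightarrow> (nat \<Rightarrow> real^'n \<Rightarrow> real) \<Rightarrow> real \<Rightarrow> real^'n \<Rightarrow>
     (real^'n \<Rightarrow> real) \<Rightarrow> real \<Rightarrow> (real \<Rightarrow> real^'n \<Rightarrow> real) \<Rightarrow> bool" where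
  "mild_solution \<Omega> \<theta> \<phi> \<alpha> \<eta> u0 T u \<longleftrightarrow>
     (\<forall>t\<in>{0..T}. H_op \<Omega> \<eta> (u t) \<in> D_dual \<Omega> \<theta> \<phi> 1 \<and>
        (\<exists>I. has_bochner_integral_in (D_space \<Omega> \<theta> \<phi> 1) (D_norm \<Omega> \<theta> \<phi> 1) (lebesgue_on {0..t})
               (\<lambda>\<tau>. R_op \<Omega> \<theta> \<phi> \<alpha> (t - \<tau>) (H_op \<Omega> \<eta> (u \<tau>))) I \<and>
             (AE x in lebesgue_on \<Omega>. u t x = S_op \<Omega> \<theta> \<phi> \<alpha> t u0 x + I x)))"

end

theory Submission
  imports Defs
begin

text \<open>In the coordinates \<open>\<theta>\<^sub>k\<^sup>1\<^sup>/\<^sup>2 \<langle>w, \<phi>\<^sub>k\<rangle>\<close> the space \<open>D\<^sup>1(\<Omega>)\<close> becomes \<open>l\<^sup>2\<close>, and the mild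
  formulation becomes a Volterra equation with the weakly singular kernel \<open>s\<^sup>\<alpha>\<^sup>-\<^sup>1 K(s)\<close>, where
  \<open>K(s)\<close> is a bounded diagonal operator: for \<open>s\<^sup>\<alpha> \<le> 1/2\<close> the Mittag-Leffler series is dominated by a
  geometric series. Because \<open>H\<^sup>1\<^sub>0(\<Omega>)\<close> embeds into \<open>L\<^sup>4(\<Omega>)\<close> in dimension at most four (the
  Gagliardo-Nirenberg argument, via a Loomis-Whitney inequality), \<open>H\<close> is Lipschitz on bounded sets
  from \<open>D\<^sup>1(\<Omega>)\<close> to \<open>D\<^sup>-\<^sup>1(\<Omega>)\<close>. Existence follows by contraction on a short time interval. For
  uniqueness, two solutions that agree up to some time agree on a further interval whose length
  is bounded below.\<close>

section \<open>The space of square summable sequences\<close>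

text \<open>The flux term costs one derivative, so \<open>H\<close> takes values only in the dual of
  the energy space, and the factor \<open>1 / (1 + \<theta> k)\<close> of the solution operator
  repays exactly this: pairing with \<open>\<phi> k\<close> and returning to the energy norm each
  cost \<open>sqrt (\<theta> k)\<close>, and \<open>\<theta> k / (1 + \<theta> k)\<close> is at most
  one. Only the scalar singularity \<open>s powr (\<alpha> - 1)\<close> remains, integrable because
  \<alpha> is positive. The main obstacle is that energy is defined by eigenfunction coefficients
  while \<open>H\<close> uses a chosen weak gradient. The bridge is the closure of the graph of the
  gradient over test functions: it contains the eigenfunctions by the definition of
  \<open>H1_0\<close>, hence the whole energy space, and a bound for test functions survives the
  closure. A concrete sequence type carries the argument because functions that agree almost
  everywhere are distinct elements of \<open>D_space\<close>, whereas contraction and integration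
  want a genuine Banach space.\<close>

lemma summable_square_add:
  fixes a b :: "nat \<Rightarrow> real"
  assumes "summable (\<lambda>n. (a n)\<^sup>2)" "summable (\<lambda>n. (b n)\<^sup>2)"
  shows "summable (\<lambda>n. (a n + b n)\<^sup>2)"
proof (rule summable_comparison_test')
  show "summable (\<lambda>n. 2 * (a n)\<^sup>2 + 2 * (b n)\<^sup>2)"
    using assms by (intro summable_add summable_mult)
  show "norm ((a n + b n)\<^sup>2) \<le> 2 * (a n)\<^sup>2 + 2 * (b n)\<^sup>2" if "n \<ge> 0" for n
    using zero_le_power2[of "a n - b n"] zero_le_power2[of "a n + b n"]
    by (simp add: power2_eq_square algebra_simps)
qed

lemma summable_square_mult:
  fixes a b :: "nat \<Rightarrow> real"
  assumes "summable (\<lambda>n. (a n)\<^sup>2)" "summable (\<lambda>n. (b n)\<^sup>2)"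
  shows "summable (\<lambda>n. a n * b n)"
proof (rule summable_comparison_test')
  show "summable (\<lambda>n. (a n)\<^sup>2 + (b n)\<^sup>2)"
    using assms by (intro summable_add)
  show "norm (a n * b n) \<le> (a n)\<^sup>2 + (b n)\<^sup>2" if "n \<ge> 0" for n
    using sum_squares_bound[of "\<bar>a n\<bar>" "\<bar>b n\<bar>"] zero_le_power2[of "a n"] zero_le_power2[of "b n"]
    unfolding real_norm_def abs_mult power2_abs by linarith
qed

lemma summable_square_scale:
  fixes a :: "nat \<Rightarrow> real"
  assumes "summable (\<lambda>n. (a n)\<^sup>2)"
  shows "summable (\<lambda>n. (c * a n)\<^sup>2)"
  using summable_mult[OF assms, of "c\<^sup>2"] by (simp add: power_mult_distrib)

lemma summable_square_diff:
  fixes a b :: "nat \<Rightarrow> real"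
  assumes "summable (\<lambda>n. (a n)\<^sup>2)" "summable (\<lambda>n. (b n)\<^sup>2)"
  shows "summable (\<lambda>n. (a n - b n)\<^sup>2)"
  using summable_square_add[OF assms(1) summable_square_scale[OF assms(2), of "-1"]] by simp

typedef l2 = "{a :: nat \<Rightarrow> real. summable (\<lambda>n. (a n)\<^sup>2)}"
  morphisms nth_l2 Abs_l2
  by (rule exI[of _ "\<lambda>_. 0"]) simp

setup_lifting type_definition_l2

instantiation l2 :: real_inner
begin

lift_definition zero_l2 :: l2 is "\<lambda>_. 0" by simp
lift_definition plus_l2 :: "l2 \<Rightarrow> l2 \<Rightarrow> l2" is "\<lambda>a b n. a n + b n" by (rule summable_square_add)
lift_definition minus_l2 :: "l2 \<Rightarrow> l2 \<Rightarrow> l2" is "\<lambda>a b n. a n - b n" by (rule summable_square_diff)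
lift_definition uminus_l2 :: "l2 \<Rightarrow> l2" is "\<lambda>a n. - a n" by simp
lift_definition scaleR_l2 :: "real \<Rightarrow> l2 \<Rightarrow> l2" is "\<lambda>c a n. c * a n" by (rule summable_square_scale)
lift_definition inner_l2 :: "l2 \<Rightarrow> l2 \<Rightarrow> real" is "\<lambda>a b. \<Sum>n. a n * b n" .

definition norm_l2 :: "l2 \<Rightarrow> real" where "norm_l2 a = sqrt (inner a a)"
definition dist_l2 :: "l2 \<Rightarrow> l2 \<Rightarrow> real" where "dist_l2 a b = norm (a - b)"
definition sgn_l2 :: "l2 \<Rightarrow> l2" where "sgn_l2 a = inverse (norm a) *\<^sub>R a"
definition uniformity_l2 :: "(l2 \<times> l2) filter" where
  "uniformity_l2 = (INF e\<in>{0<..}. principal {(x, y). dist x y < e})"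
definition open_l2 :: "l2 set \<Rightarrow> bool" where
  "open_l2 U = (\<forall>x\<in>U. eventually (\<lambda>(x', y). x' = x \<longrightarrow> y \<in> U) uniformity)"

instance
proof
  fix a b c :: l2 and r s :: real
  show "a + b + c = a + (b + c)" "a + b = b + a" "0 + a = a" "- a + a = 0" "a - b = a + - b"
    by (transfer, simp add: fun_eq_iff)+
  show "r *\<^sub>R (a + b) = r *\<^sub>R a + r *\<^sub>R b" "(r + s) *\<^sub>R a = r *\<^sub>R a + s *\<^sub>R a"
    "r *\<^sub>R s *\<^sub>R a = (r * s) *\<^sub>R a" "1 *\<^sub>R a = a"
    by (transfer, simp add: fun_eq_iff algebra_simps)+
  show "dist a b = norm (a - b)" by (rule dist_l2_def)
  show "sgn a = inverse (norm a) *\<^sub>R a" by (simp add: sgn_l2_def)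
  show "(uniformity :: (l2 \<times> l2) filter) = (INF e\<in>{0<..}. principal {(x, y). dist x y < e})"
    by (rule uniformity_l2_def)
  show "open U = (\<forall>x\<in>U. eventually (\<lambda>(x', y). x' = x \<longrightarrow> y \<in> U) uniformity)" for U :: "l2 set"
    by (rule open_l2_def)
  show "inner a b = inner b a" by transfer (simp add: mult.commute)
  show "inner (a + b) c = inner a c + inner b c"
    by transfer (simp add: distrib_right suminf_add[symmetric] summable_square_mult)
  show "inner (r *\<^sub>R a) b = r * inner a b"
    by transfer (simp add: mult.assoc suminf_mult summable_square_mult)
  show "0 \<le> inner a a"
    by transfer (auto intro!: suminf_nonneg simp: power2_eq_square[symmetric])
  show "(inner a a = 0) = (a = 0)"
  proof transfer
    fix a :: "nat \<Rightarrow> real" assume "summable (\<lambda>n. (a n)\<^sup>2)"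
    then show "((\<Sum>n. a n * a n) = 0) = (a = (\<lambda>_. 0))"
      using suminf_eq_zero_iff[of "\<lambda>n. (a n)\<^sup>2"] by (auto simp: power2_eq_square fun_eq_iff)
  qed
  show "norm a = sqrt (inner a a)" by (rule norm_l2_def)
qed

end

lemma summable_nth_l2: "summable (\<lambda>n. (nth_l2 a n)\<^sup>2)"
  using nth_l2[of a] by simp

lemma nth_l2_Abs: "summable (\<lambda>n. (a n)\<^sup>2) \<Longrightarrow> nth_l2 (Abs_l2 a) = a"
  by (rule Abs_l2_inverse) simp

lemma nth_l2_simps [simp]:
  "nth_l2 0 n = 0" "nth_l2 (a + b) n = nth_l2 a n + nth_l2 b n"
  "nth_l2 (a - b) n = nth_l2 a n - nth_l2 b n" "nth_l2 (- a) n = - nth_l2 a n"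
  "nth_l2 (c *\<^sub>R a) n = c * nth_l2 a n"
  by (transfer, simp)+

lemma nth_l2_sum [simp]: "nth_l2 (\<Sum>i\<in>S. f i) n = (\<Sum>i\<in>S. nth_l2 (f i) n)"
  by (induction S rule: infinite_finite_induct) auto

lemma l2_eqI: "(\<And>n. nth_l2 a n = nth_l2 b n) \<Longrightarrow> a = b"
  by transfer auto

lemma inner_l2_eq: "inner a b = (\<Sum>n. nth_l2 a n * nth_l2 b n)"
  by transfer simp

lemma norm_l2_eq: "norm a = sqrt (\<Sum>n. (nth_l2 a n)\<^sup>2)"
  by (simp add: norm_eq_sqrt_inner inner_l2_eq power2_eq_square)

lemma norm_l2_square: "(norm a)\<^sup>2 = (\<Sum>n. (nth_l2 a n)\<^sup>2)" for a :: l2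
  by (simp add: norm_l2_eq suminf_nonneg summable_nth_l2)

lemma sum_nth_l2_le: "finite S \<Longrightarrow> (\<Sum>n\<in>S. (nth_l2 a n)\<^sup>2) \<le> (norm a)\<^sup>2"
  unfolding norm_l2_square by (rule sum_le_suminf[OF summable_nth_l2]) auto

lemma abs_nth_l2_le: "\<bar>nth_l2 a n\<bar> \<le> norm a"
  using sum_nth_l2_le[of "{n}" a] by (simp add: abs_le_square_iff[symmetric])

lemma bounded_linear_nth_l2: "bounded_linear (\<lambda>a. nth_l2 a n)"
  by (rule bounded_linear_intro[of _ 1]) (auto intro: abs_nth_l2_le)

lemma norm_l2_leI:
  assumes "\<And>n. (\<Sum>k<n. (a k)\<^sup>2) \<le> B\<^sup>2" "B \<ge> 0"
  shows "summable (\<lambda>n. (a n)\<^sup>2)" "norm (Abs_l2 a) \<le> B"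
proof -
  show s: "summable (\<lambda>n. (a n)\<^sup>2)"
    by (rule summableI_nonneg_bounded[of _ "B\<^sup>2"]) (use assms in auto)
  have "(\<Sum>n. (a n)\<^sup>2) \<le> B\<^sup>2"
    by (rule suminf_le_const[OF s]) (use assms in auto)
  then show "norm (Abs_l2 a) \<le> B"
    using real_sqrt_le_mono[of _ "B\<^sup>2"] assms(2) by (simp add: norm_l2_eq nth_l2_Abs[OF s])
qed

text \<open>The coordinatewise limit is the only candidate. The Cauchy estimate passes to it on
  finite sums, and the bound, uniform in their length, yields summability and the norm estimate at
  once.\<close>

instance l2 :: banach
proof
  fix X :: "nat \<Rightarrow> l2" assume X: "Cauchy X"
  have "convergent (\<lambda>i. nth_l2 (X i) n)" for n
    using bounded_linear.Cauchy[OF bounded_linear_nth_l2 X] by (simp add: Cauchy_convergent_iff)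
  then obtain a where a: "\<And>n. (\<lambda>i. nth_l2 (X i) n) \<longlonglongrightarrow> a n"
    unfolding convergent_def by metis
  have close: "(\<Sum>n<N. (nth_l2 (X i) n - a n)\<^sup>2) \<le> e\<^sup>2"
    if "\<And>j. j \<ge> M \<Longrightarrow> norm (X i - X j) < e" for M i e N
  proof (rule LIMSEQ_le_const2)
    show "(\<lambda>j. \<Sum>n<N. (nth_l2 (X i) n - nth_l2 (X j) n)\<^sup>2) \<longlonglongrightarrow> (\<Sum>n<N. (nth_l2 (X i) n - a n)\<^sup>2)"
      by (intro tendsto_intros a)
    show "\<exists>M. \<forall>j\<ge>M. (\<Sum>n<N. (nth_l2 (X i) n - nth_l2 (X j) n)\<^sup>2) \<le> e\<^sup>2"
    proof (intro exI allI impI)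
      fix j assume "j \<ge> M"
      have "(\<Sum>n<N. (nth_l2 (X i) n - nth_l2 (X j) n)\<^sup>2) \<le> (norm (X i - X j))\<^sup>2"
        using sum_nth_l2_le[of "{..<N}" "X i - X j"] by simp
      also have "\<dots> \<le> e\<^sup>2"
        using that[OF \<open>j \<ge> M\<close>] by (intro power_mono) auto
      finally show "(\<Sum>n<N. (nth_l2 (X i) n - nth_l2 (X j) n)\<^sup>2) \<le> e\<^sup>2" .
    qed
  qed
  have bound: "\<exists>M. \<forall>i\<ge>M. summable (\<lambda>n. (nth_l2 (X i) n - a n)\<^sup>2) \<and>
      norm (Abs_l2 (\<lambda>n. nth_l2 (X i) n - a n)) \<le> e" if "e > 0" for e
  proof -
    from X \<open>e > 0\<close> obtain M where M: "\<And>i j. i \<ge> M \<Longrightarrow> j \<ge> M \<Longrightarrow> norm (X i - X j) < e"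
      unfolding Cauchy_def dist_norm by blast
    show ?thesis
      by (intro exI[of _ M] allI impI conjI norm_l2_leI close[of M]) (use M \<open>e > 0\<close> in auto)
  qed
  from bound[of 1] obtain M where M: "summable (\<lambda>n. (nth_l2 (X M) n - a n)\<^sup>2)" by auto
  have sa: "summable (\<lambda>n. (a n)\<^sup>2)"
    using summable_square_diff[OF summable_nth_l2[of "X M"] M] by simp
  have eq: "Abs_l2 (\<lambda>n. nth_l2 (X i) n - a n) = X i - Abs_l2 a" for i
    by (rule l2_eqI) (simp add: nth_l2_Abs[OF sa] nth_l2_Abs summable_square_diff sa summable_nth_l2)
  have "X \<longlonglongrightarrow> Abs_l2 a"
  proof (rule LIMSEQ_I)
    fix r :: real assume "r > 0"
    with bound[of "r/2"] eq have "\<exists>M. \<forall>i\<ge>M. norm (X i - Abs_l2 a) \<le> r/2" by (metis half_gt_zero)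
    then obtain M where "\<forall>i\<ge>M. norm (X i - Abs_l2 a) \<le> r/2" ..
    moreover have "r / 2 < r" using \<open>r > 0\<close> by simp
    ultimately show "\<exists>M. \<forall>i\<ge>M. norm (X i - Abs_l2 a) < r" by (meson le_less_trans)
  qed
  then show "convergent X" by (rule convergentI)
qed

lift_definition unit_l2 :: "nat \<Rightarrow> l2" is "\<lambda>k n. if n = k then 1 else 0"
  by (rule summable_finite[of "{_}"]) auto

lemma nth_unit_l2 [simp]: "nth_l2 (unit_l2 k) n = (if n = k then 1 else 0)"
  by transfer simp

text \<open>By Pythagoras the squared distance of a truncation from \<open>a\<close> is the tail of
  the norm series. Later density and extension arguments reduce to unit vectors through this
  expansion.\<close>

lemma sums_unit_l2: "(\<lambda>k. nth_l2 a k *\<^sub>R unit_l2 k) sums a"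
proof -
  have "(norm ((\<Sum>k<n. nth_l2 a k *\<^sub>R unit_l2 k) - a))\<^sup>2 = (norm a)\<^sup>2 - (\<Sum>k<n. (nth_l2 a k)\<^sup>2)" for n
  proof -
    have "(nth_l2 ((\<Sum>k<n. nth_l2 a k *\<^sub>R unit_l2 k) - a) m)\<^sup>2
        = (nth_l2 a m)\<^sup>2 - (if m \<in> {..<n} then (nth_l2 a m)\<^sup>2 else 0)" for m
      by (auto simp: if_distrib sum.delta cong: if_cong)
    moreover have "(\<lambda>m. if m \<in> {..<n} then (nth_l2 a m)\<^sup>2 else 0) sums (\<Sum>k<n. (nth_l2 a k)\<^sup>2)"
      using sums_If_finite_set[of "{..<n}"] by simp
    ultimately show ?thesis
      unfolding norm_l2_square
      using sums_diff[OF summable_sums[OF summable_nth_l2[of a]]] by (simp add: sums_unique[symmetric])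
  qed
  moreover have "(\<lambda>n. (norm a)\<^sup>2 - (\<Sum>k<n. (nth_l2 a k)\<^sup>2)) \<longlonglongrightarrow> (norm a)\<^sup>2 - (norm a)\<^sup>2"
    unfolding norm_l2_square using summable_LIMSEQ[OF summable_nth_l2] by (intro tendsto_intros)
  ultimately have "(\<lambda>n. (norm ((\<Sum>k<n. nth_l2 a k *\<^sub>R unit_l2 k) - a))\<^sup>2) \<longlonglongrightarrow> 0" by simp
  from tendsto_real_sqrt[OF this]
  have "(\<lambda>n. norm ((\<Sum>k<n. nth_l2 a k *\<^sub>R unit_l2 k) - a)) \<longlonglongrightarrow> 0" by simp
  then show ?thesis
    unfolding sums_def by (rule LIM_zero_cancel[OF tendsto_norm_zero_cancel])
qed

section \<open>Separability of the sequence space\<close>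

definition rational_l2 :: "l2 set" where
  "rational_l2 = (\<lambda>q. \<Sum>k<length q. (of_rat (q ! k) :: real) *\<^sub>R unit_l2 k) ` (UNIV :: rat list set)"

lemma countable_rational_l2: "countable rational_l2"
  unfolding rational_l2_def by simp

lemma rational_l2_dense:
  assumes "e > 0"
  shows "\<exists>b\<in>rational_l2. dist a b < e"
proof -
  have "(\<lambda>n. \<Sum>k<n. nth_l2 a k *\<^sub>R unit_l2 k) \<longlonglongrightarrow> a"
    using sums_unit_l2 by (simp add: sums_def)
  then obtain n where n: "dist (\<Sum>k<n. nth_l2 a k *\<^sub>R unit_l2 k) a < e/2"
    using \<open>e > 0\<close> by (meson half_gt_zero LIMSEQ_def order_refl)
  \<comment> \<open>The remaining half of \<open>e\<close> is shared among \<open>n\<close>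
    coordinates; \<open>n + 1\<close> in the denominator also covers the empty truncation.\<close>
  have "\<exists>q. \<bar>of_rat q - nth_l2 a k\<bar> < e / (2 * (real n + 1))" for k
  proof -
    have "e / (2 * (real n + 1)) > 0" using \<open>e > 0\<close> by simp
    then obtain r where r: "nth_l2 a k < of_rat r" "of_rat r < nth_l2 a k + e / (2 * (real n + 1))"
      using of_rat_dense[of "nth_l2 a k" "nth_l2 a k + e / (2 * (real n + 1))"] by auto
    then have "\<bar>of_rat r - nth_l2 a k\<bar> < e / (2 * (real n + 1))" by linarith
    then show ?thesis ..
  qed
  then obtain q where q: "\<And>k. \<bar>of_rat (q k) - nth_l2 a k\<bar> < e / (2 * (real n + 1))" by metis
  let ?b = "\<Sum>k<length (map q [0..<n]). (of_rat (map q [0..<n] ! k) :: real) *\<^sub>R unit_l2 k"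
  have "norm ((\<Sum>k<n. nth_l2 a k *\<^sub>R unit_l2 k) - ?b)
      = norm (\<Sum>k<n. (nth_l2 a k - of_rat (q k)) *\<^sub>R unit_l2 k)"
    by (simp add: sum_subtractf scaleR_left_diff_distrib)
  also have "\<dots> \<le> (\<Sum>k<n. norm ((nth_l2 a k - of_rat (q k)) *\<^sub>R unit_l2 k))" by (rule norm_sum)
  also have "\<dots> \<le> (\<Sum>k<n. e / (2 * (real n + 1)))"
  proof (rule sum_mono)
    fix k
    have "(\<Sum>m. (nth_l2 (unit_l2 k) m)\<^sup>2) = 1"
      using suminf_finite[of "{k}" "\<lambda>m. (nth_l2 (unit_l2 k) m)\<^sup>2"] by auto
    then have "norm (unit_l2 k) = 1" by (simp add: norm_l2_eq)
    then show "norm ((nth_l2 a k - of_rat (q k)) *\<^sub>R unit_l2 k) \<le> e / (2 * (real n + 1))"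
      using q[of k] by (simp add: abs_minus_commute less_imp_le)
  qed
  also have "\<dots> = real n / (real n + 1) * (e/2)" by simp
  also have "\<dots> \<le> 1 * (e/2)" using \<open>e > 0\<close> by (intro mult_right_mono) auto
  finally have "dist (\<Sum>k<n. nth_l2 a k *\<^sub>R unit_l2 k) ?b \<le> e/2" by (simp add: dist_norm)
  moreover have "dist a ?b \<le> dist (\<Sum>k<n. nth_l2 a k *\<^sub>R unit_l2 k) a + dist (\<Sum>k<n. nth_l2 a k *\<^sub>R unit_l2 k) ?b"
    by (rule dist_triangle3)
  ultimately have "dist a ?b < e" using n by simp
  then show ?thesis unfolding rational_l2_def by blast
qed

text \<open>Bochner integration asks for this class: with values in a separable space, Borel
  measurability already gives approximation by simple functions.\<close>

instance l2 :: second_countable_topology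
proof
  let ?B = "(\<lambda>(a, n). ball a (1 / (real n + 1))) ` (rational_l2 \<times> (UNIV :: nat set))"
  have "topological_basis ?B"
  proof (rule topological_basisI)
    show "open U" if "U \<in> ?B" for U using that by auto
    fix U and a :: l2 assume "open U" "a \<in> U"
    then obtain e where e: "e > 0" "ball a e \<subseteq> U" by (meson open_contains_ball)
    obtain n where n: "1 / (real n + 1) < e/2"
      using reals_Archimedean[of "e/2"] e(1) by (auto simp: inverse_eq_divide add.commute)
    obtain b where b: "b \<in> rational_l2" "dist a b < 1 / (real n + 1)"
      using rational_l2_dense[of "1 / (real n + 1)" a] by auto
    have "ball b (1 / (real n + 1)) \<subseteq> ball a e"
    proof
      fix x assume "x \<in> ball b (1 / (real n + 1))"
      then show "x \<in> ball a e"
        using b(2) n dist_triangle[of a x b] by simp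
    qed
    then show "\<exists>B'\<in>?B. a \<in> B' \<and> B' \<subseteq> U"
      using b e(2) by (intro bexI[of _ "ball b (1 / (real n + 1))"]) (auto simp: dist_commute)
  qed
  moreover have "countable ?B" using countable_rational_l2 by auto
  ultimately show "\<exists>B :: l2 set set. countable B \<and> open = generate_topology B"
    by (metis topological_basis_imp_subbasis)
qed

section \<open>Diagonal operators, functionals and orthonormal series\<close>

definition mult_l2 :: "(nat \<Rightarrow> real) \<Rightarrow> l2 \<Rightarrow> l2" where
  "mult_l2 m a = Abs_l2 (\<lambda>k. m k * nth_l2 a k)"

lemma mult_l2:
  assumes m: "\<And>k. \<bar>m k\<bar> \<le> C"
  shows "nth_l2 (mult_l2 m a) k = m k * nth_l2 a k" "norm (mult_l2 m a) \<le> C * norm a"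
    "bounded_linear (mult_l2 m)"
proof -
  have C: "0 \<le> C" using m[of 0] by linarith
  have b: "(\<Sum>k<n. (m k * nth_l2 a k)\<^sup>2) \<le> (C * norm a)\<^sup>2" for n a
  proof -
    have "(\<Sum>k<n. (m k * nth_l2 a k)\<^sup>2) \<le> (\<Sum>k<n. C\<^sup>2 * (nth_l2 a k)\<^sup>2)"
      unfolding power_mult_distrib using m C
      by (intro sum_mono mult_right_mono) (auto simp: abs_le_square_iff[symmetric])
    also have "\<dots> \<le> C\<^sup>2 * (norm a)\<^sup>2"
      unfolding sum_distrib_left[symmetric] by (intro mult_left_mono sum_nth_l2_le) auto
    finally show ?thesis by (simp add: power_mult_distrib)
  qed
  note n = norm_l2_leI[OF b mult_nonneg_nonneg[OF C norm_ge_zero]]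
  show nth: "nth_l2 (mult_l2 m a) k = m k * nth_l2 a k" for a k
    unfolding mult_l2_def using n(1) by (simp add: nth_l2_Abs)
  show bound: "norm (mult_l2 m a) \<le> C * norm a" for a
    unfolding mult_l2_def by (rule n(2))
  show "bounded_linear (mult_l2 m)"
    by (rule bounded_linear_intro[of _ C])
      (auto intro!: l2_eqI simp: nth distrib_left bound mult.commute)
qed

text \<open>The Riesz representation in coordinates. Testing \<open>F\<close> on the truncation
  \<open>b\<close> of its own coefficient sequence gives \<open>F b = (norm b)^2\<close>, so
  \<open>norm b\<close> is at most \<open>C\<close> for every truncation.\<close>

lemma functional_l2:
  assumes F: "bounded_linear F" "\<And>b. \<bar>F b\<bar> \<le> C * norm b" "0 \<le> C"
  shows "summable (\<lambda>k. (F (unit_l2 k))\<^sup>2)" "norm (Abs_l2 (\<lambda>k. F (unit_l2 k))) \<le> C"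
proof -
  have "(\<Sum>k<n. (F (unit_l2 k))\<^sup>2) \<le> C\<^sup>2" for n
  proof -
    define b where "b = (\<Sum>k<n. F (unit_l2 k) *\<^sub>R unit_l2 k)"
    have Fb: "F b = (\<Sum>k<n. (F (unit_l2 k))\<^sup>2)"
      using F(1) by (simp add: b_def bounded_linear.linear linear_sum linear_cmul power2_eq_square)
    have "(nth_l2 b m)\<^sup>2 = (if m \<in> {..<n} then (F (unit_l2 m))\<^sup>2 else 0)" for m
      by (simp add: b_def if_distrib cong: if_cong)
    then have "(norm b)\<^sup>2 = (\<Sum>k<n. (F (unit_l2 k))\<^sup>2)"
      unfolding norm_l2_square using sums_If_finite_set[of "{..<n}" "\<lambda>m. (F (unit_l2 m))\<^sup>2"]
      by (simp add: sums_unique[symmetric])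
    then have "norm b * norm b \<le> C * norm b"
      using F(2)[of b] Fb by (simp add: power2_eq_square)
    then have "norm b \<le> C" using F(3) by (cases "norm b = 0") auto
    then have "(norm b)\<^sup>2 \<le> C\<^sup>2" by (intro power_mono) auto
    then show ?thesis using \<open>(norm b)\<^sup>2 = _\<close> by simp
  qed
  from norm_l2_leI[OF this F(3)]
  show "summable (\<lambda>k. (F (unit_l2 k))\<^sup>2)" "norm (Abs_l2 (\<lambda>k. F (unit_l2 k))) \<le> C" .
qed

text \<open>Pythagoras turns blocks of the series into blocks of the convergent series of squares.
  The intended \<open>f\<close> is the family of normalised gradients of the eigenfunctions, which
  lives in \<open>l2^'n\<close>.\<close>

lemma orthonormal_series:
  fixes f :: "nat \<Rightarrow> 'a::{real_inner, banach}"
  assumes f: "\<And>j k. inner (f j) (f k) = (if j = k then 1 else 0)"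
  shows "summable (\<lambda>k. nth_l2 a k *\<^sub>R f k)" "norm (\<Sum>k. nth_l2 a k *\<^sub>R f k) \<le> norm a"
proof -
  have n: "(norm (\<Sum>k\<in>I. nth_l2 a k *\<^sub>R f k))\<^sup>2 = (\<Sum>k\<in>I. (nth_l2 a k)\<^sup>2)" if "finite I" for I
    using that unfolding power2_norm_eq_inner
    by (simp add: inner_sum_left inner_sum_right f if_distrib power2_eq_square cong: if_cong)
  show s: "summable (\<lambda>k. nth_l2 a k *\<^sub>R f k)"
    unfolding summable_Cauchy
  proof (intro allI impI)
    fix e :: real assume "e > 0"
    then obtain N where N: "\<And>m n. m \<ge> N \<Longrightarrow> norm (\<Sum>k\<in>{m..<n}. (nth_l2 a k)\<^sup>2) < e\<^sup>2"
      using summable_nth_l2[of a] unfolding summable_Cauchy by (metis zero_less_power)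
    have "norm (\<Sum>k\<in>{m..<n}. nth_l2 a k *\<^sub>R f k) < e" if "m \<ge> N" for m n
    proof -
      have "(norm (\<Sum>k\<in>{m..<n}. nth_l2 a k *\<^sub>R f k))\<^sup>2 < e\<^sup>2"
        using N[OF that, of n] unfolding n[OF finite_atLeastLessThan] by simp
      then show ?thesis using \<open>e > 0\<close> by (meson less_imp_le power2_less_imp_less)
    qed
    then show "\<exists>N. \<forall>m\<ge>N. \<forall>n. norm (\<Sum>k\<in>{m..<n}. nth_l2 a k *\<^sub>R f k) < e" by blast
  qed
  have "norm (\<Sum>k<n. nth_l2 a k *\<^sub>R f k) \<le> norm a" for n
    by (rule power2_le_imp_le) (simp_all add: n sum_nth_l2_le)
  then show "norm (\<Sum>k. nth_l2 a k *\<^sub>R f k) \<le> norm a"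
    by (intro LIMSEQ_le_const2[OF tendsto_norm[OF summable_LIMSEQ[OF s]]]) auto
qed

section \<open>Square integrable functions in coordinates\<close>

lemma L2_measurable: "f \<in> L2 \<Omega> \<Longrightarrow> f \<in> borel_measurable (lebesgue_on \<Omega>)"
  by (simp add: L2_def)

lemma L2_square_integrable: "f \<in> L2 \<Omega> \<Longrightarrow> integrable (lebesgue_on \<Omega>) (\<lambda>x. (f x)\<^sup>2)"
  by (simp add: L2_def)

lemma L2_mult_integrable:
  assumes "f \<in> L2 \<Omega>" "g \<in> L2 \<Omega>"
  shows "integrable (lebesgue_on \<Omega>) (\<lambda>x. f x * g x)"
proof (rule Bochner_Integration.integrable_bound)
  show "integrable (lebesgue_on \<Omega>) (\<lambda>x. (f x)\<^sup>2 + (g x)\<^sup>2)"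
    by (intro Bochner_Integration.integrable_add L2_square_integrable assms)
  show "(\<lambda>x. f x * g x) \<in> borel_measurable (lebesgue_on \<Omega>)"
    using assms[THEN L2_measurable] by simp
  show "AE x in lebesgue_on \<Omega>. norm (f x * g x) \<le> norm ((f x)\<^sup>2 + (g x)\<^sup>2)"
  proof (intro AE_I2)
    fix x show "norm (f x * g x) \<le> norm ((f x)\<^sup>2 + (g x)\<^sup>2)"
      using sum_squares_bound[of "\<bar>f x\<bar>" "\<bar>g x\<bar>"] zero_le_power2[of "f x"] zero_le_power2[of "g x"]
      unfolding real_norm_def abs_mult power2_abs by linarith
  qed
qed

lemma L2_zero: "(\<lambda>_. 0) \<in> L2 \<Omega>"
  by (simp add: L2_def)

lemma L2_scale: "f \<in> L2 \<Omega> \<Longrightarrow> (\<lambda>x. c * f x) \<in> L2 \<Omega>"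
  by (auto simp: L2_def power_mult_distrib)

lemma L2_add:
  assumes "f \<in> L2 \<Omega>" "g \<in> L2 \<Omega>"
  shows "(\<lambda>x. f x + g x) \<in> L2 \<Omega>"
proof -
  have "integrable (lebesgue_on \<Omega>) (\<lambda>x. (f x)\<^sup>2 + (g x)\<^sup>2 + 2 * (f x * g x))"
    by (intro Bochner_Integration.integrable_add L2_square_integrable assms integrable_mult_right
        L2_mult_integrable)
  then show ?thesis
    using assms[THEN L2_measurable] by (simp add: L2_def power2_sum algebra_simps)
qed

lemma L2_diff: "f \<in> L2 \<Omega> \<Longrightarrow> g \<in> L2 \<Omega> \<Longrightarrow> (\<lambda>x. f x - g x) \<in> L2 \<Omega>"
  using L2_add[of f \<Omega> "\<lambda>x. -1 * g x"] L2_scale[of g \<Omega> "-1"] by simp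

lemma L2_lincomb: "f \<in> L2 \<Omega> \<Longrightarrow> g \<in> L2 \<Omega> \<Longrightarrow> (\<lambda>x. a * f x + b * g x) \<in> L2 \<Omega>"
  by (intro L2_add L2_scale)

lemma L2_sum: "(\<And>i. i \<in> I \<Longrightarrow> f i \<in> L2 \<Omega>) \<Longrightarrow> (\<lambda>x. \<Sum>i\<in>I. f i x) \<in> L2 \<Omega>"
  by (induction I rule: infinite_finite_induct) (auto intro: L2_zero L2_add)

lemma L2_inner_commute: "L2_inner \<Omega> f g = L2_inner \<Omega> g f"
  by (simp add: L2_inner_def mult.commute)

lemma L2_inner_lincomb_left:
  assumes "f \<in> L2 \<Omega>" "g \<in> L2 \<Omega>" "h \<in> L2 \<Omega>"
  shows "L2_inner \<Omega> (\<lambda>x. a * f x + b * g x) h = a * L2_inner \<Omega> f h + b * L2_inner \<Omega> g h"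
  using L2_mult_integrable[OF assms(1,3)] L2_mult_integrable[OF assms(2,3)]
  by (simp add: L2_inner_def distrib_right mult.assoc)

lemma L2_inner_scale_left:
  "f \<in> L2 \<Omega> \<Longrightarrow> h \<in> L2 \<Omega> \<Longrightarrow> L2_inner \<Omega> (\<lambda>x. a * f x) h = a * L2_inner \<Omega> f h"
  using L2_inner_lincomb_left[of f \<Omega> f h a 0] by simp

lemma L2_inner_add_left:
  "f \<in> L2 \<Omega> \<Longrightarrow> g \<in> L2 \<Omega> \<Longrightarrow> h \<in> L2 \<Omega> \<Longrightarrow>
    L2_inner \<Omega> (\<lambda>x. f x + g x) h = L2_inner \<Omega> f h + L2_inner \<Omega> g h"
  using L2_inner_lincomb_left[of f \<Omega> g h 1 1] by simp

lemma L2_inner_diff_left: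
  "f \<in> L2 \<Omega> \<Longrightarrow> g \<in> L2 \<Omega> \<Longrightarrow> h \<in> L2 \<Omega> \<Longrightarrow>
    L2_inner \<Omega> (\<lambda>x. f x - g x) h = L2_inner \<Omega> f h - L2_inner \<Omega> g h"
  using L2_inner_lincomb_left[of f \<Omega> g h 1 "-1"] by simp

lemma L2_inner_sum_left:
  "(\<And>i. i \<in> I \<Longrightarrow> f i \<in> L2 \<Omega>) \<Longrightarrow> h \<in> L2 \<Omega> \<Longrightarrow>
    L2_inner \<Omega> (\<lambda>x. \<Sum>i\<in>I. f i x) h = (\<Sum>i\<in>I. L2_inner \<Omega> (f i) h)"
  by (induction I rule: infinite_finite_induct)
    (auto simp: L2_inner_add_left L2_sum L2_inner_def[of _ "\<lambda>_. 0"])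

lemma L2_inner_cong_AE:
  assumes "f \<in> L2 \<Omega>" "f' \<in> L2 \<Omega>" "g \<in> L2 \<Omega>" "AE x in lebesgue_on \<Omega>. f x = f' x"
  shows "L2_inner \<Omega> f g = L2_inner \<Omega> f' g"
  unfolding L2_inner_def
proof (rule integral_cong_AE)
  show "AE x in lebesgue_on \<Omega>. f x * g x = f' x * g x" using assms(4) by eventually_elim simp
qed (use assms(1-3)[THEN L2_measurable] in auto)

lemma L2_norm_cong_AE:
  assumes "f \<in> L2 \<Omega>" "g \<in> L2 \<Omega>" "AE x in lebesgue_on \<Omega>. f x = g x"
  shows "L2_norm \<Omega> f = L2_norm \<Omega> g"
  using L2_inner_cong_AE[OF assms(1,2,1,3)] L2_inner_cong_AE[OF assms(1,2,2,3)]
  by (simp add: L2_norm_def L2_inner_commute)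

lemma L2_inner_self_nonneg: "0 \<le> L2_inner \<Omega> f f"
  by (simp add: L2_inner_def)

lemma L2_norm_nonneg: "0 \<le> L2_norm \<Omega> f"
  by (simp add: L2_norm_def L2_inner_self_nonneg)

lemma L2_norm_square: "(L2_norm \<Omega> f)\<^sup>2 = L2_inner \<Omega> f f"
  by (simp add: L2_norm_def L2_inner_self_nonneg)

lemma L2_norm_square_integral: "(L2_norm \<Omega> f)\<^sup>2 = (LINT x|lebesgue_on \<Omega>. (f x)\<^sup>2)"
  unfolding L2_norm_square L2_inner_def by (simp add: power2_eq_square)

lemma nn_integral_L2_square:
  "f \<in> L2 \<Omega> \<Longrightarrow> (\<integral>\<^sup>+x. ennreal ((f x)\<^sup>2) \<partial>lebesgue_on \<Omega>) = ennreal ((L2_norm \<Omega> f)\<^sup>2)"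
  unfolding L2_norm_square_integral by (rule nn_integral_eq_integral[OF L2_square_integrable]) auto

lemma L2_norm_eq_0_iff:
  assumes "f \<in> L2 \<Omega>"
  shows "L2_norm \<Omega> f = 0 \<longleftrightarrow> (AE x in lebesgue_on \<Omega>. f x = 0)"
proof -
  have "L2_norm \<Omega> f = 0 \<longleftrightarrow> (LINT x|lebesgue_on \<Omega>. (f x)\<^sup>2) = 0"
    by (simp flip: L2_norm_square_integral)
  also have "\<dots> \<longleftrightarrow> (AE x in lebesgue_on \<Omega>. (f x)\<^sup>2 = 0)"
    by (rule integral_nonneg_eq_0_iff_AE[OF L2_square_integrable[OF assms]]) auto
  finally show ?thesis by simp
qed

lemma L2_inner_diff_self:
  assumes "f \<in> L2 \<Omega>" "g \<in> L2 \<Omega>"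
  shows "L2_inner \<Omega> (\<lambda>x. f x - t * g x) (\<lambda>x. f x - t * g x)
    = L2_inner \<Omega> f f - 2 * t * L2_inner \<Omega> f g + t\<^sup>2 * L2_inner \<Omega> g g"
proof -
  let ?d = "\<lambda>x. f x - t * g x"
  have tg: "(\<lambda>x. t * g x) \<in> L2 \<Omega>" by (rule L2_scale[OF assms(2)])
  have d: "?d \<in> L2 \<Omega>" by (rule L2_diff[OF assms(1) tg])
  have "L2_inner \<Omega> ?d ?d = L2_inner \<Omega> f ?d - t * L2_inner \<Omega> g ?d"
    by (simp only: L2_inner_diff_left[OF assms(1) tg d] L2_inner_scale_left[OF assms(2) d])
  also have "L2_inner \<Omega> f ?d = L2_inner \<Omega> f f - t * L2_inner \<Omega> f g"
    unfolding L2_inner_commute[of _ f ?d]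
    by (simp only: L2_inner_diff_left[OF assms(1) tg assms(1)] L2_inner_scale_left[OF assms(2,1)]
        L2_inner_commute[of _ g f])
  also have "L2_inner \<Omega> g ?d = L2_inner \<Omega> f g - t * L2_inner \<Omega> g g"
    unfolding L2_inner_commute[of _ g ?d]
    by (simp only: L2_inner_diff_left[OF assms(1) tg assms(2)] L2_inner_scale_left[OF assms(2,2)])
  finally show ?thesis by (simp add: algebra_simps power2_eq_square)
qed

lemma L2_Cauchy_Schwarz:
  assumes "f \<in> L2 \<Omega>" "g \<in> L2 \<Omega>"
  shows "\<bar>L2_inner \<Omega> f g\<bar> \<le> L2_norm \<Omega> f * L2_norm \<Omega> g"
proof (cases "L2_norm \<Omega> g = 0")
  case True
  then have "AE x in lebesgue_on \<Omega>. g x = 0" using L2_norm_eq_0_iff[OF assms(2)] by simp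
  then have "L2_inner \<Omega> g f = L2_inner \<Omega> (\<lambda>_. 0) f"
    by (intro L2_inner_cong_AE assms L2_zero)
  then have "L2_inner \<Omega> f g = 0" by (simp add: L2_inner_commute L2_inner_def)
  then show ?thesis using True by simp
next
  case False
  define B where "B = L2_inner \<Omega> g g"
  have B: "B > 0" using False L2_inner_self_nonneg[of \<Omega> g] by (simp add: L2_norm_def B_def)
  \<comment> \<open>The minimiser of the quadratic polynomial in \<open>t\<close> given by the
    squared distance of \<open>f\<close> from \<open>t g\<close>.\<close>
  define t where "t = L2_inner \<Omega> f g / B"
  have "0 \<le> L2_inner \<Omega> (\<lambda>x. f x - t * g x) (\<lambda>x. f x - t * g x)" by (rule L2_inner_self_nonneg)
  also have "\<dots> = L2_inner \<Omega> f f - 2 * t * L2_inner \<Omega> f g + t\<^sup>2 * B"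
    unfolding B_def by (rule L2_inner_diff_self[OF assms])
  also have "\<dots> = L2_inner \<Omega> f f - (L2_inner \<Omega> f g)\<^sup>2 / B"
    using B by (simp add: t_def power2_eq_square field_simps)
  finally have "(L2_inner \<Omega> f g)\<^sup>2 \<le> L2_inner \<Omega> f f * B"
    using B by (simp add: field_simps)
  then have "(L2_inner \<Omega> f g)\<^sup>2 \<le> (L2_norm \<Omega> f * L2_norm \<Omega> g)\<^sup>2"
    by (simp add: power_mult_distrib L2_norm_square B_def)
  then show ?thesis
    using L2_norm_nonneg by (metis abs_le_square_iff abs_of_nonneg mult_nonneg_nonneg)
qed

text \<open>Integrability of the limit is a conclusion here, and the bounds may vary with the index
  as long as they converge. This serves twice: for the completeness of L^2, and for carrying an L^4
  bound from test functions to their limits.\<close>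

lemma Fatou_real:
  fixes q :: "'a \<Rightarrow> real"
  assumes q: "\<And>i. integrable M (q' i)" "\<And>i x. 0 \<le> q' i x" "AE x in M. (\<lambda>i. q' i x) \<longlonglongrightarrow> q x"
    and m[measurable]: "q \<in> borel_measurable M" and B: "\<And>i. integral\<^sup>L M (q' i) \<le> B' i" "B' \<longlonglongrightarrow> B"
  shows "integrable M q" "integral\<^sup>L M q \<le> B"
proof -
  have [measurable]: "q' i \<in> borel_measurable M" for i using q(1) by auto
  have "0 \<le> B' i" for i
    using B(1)[of i] q(2) by (meson Bochner_Integration.integral_nonneg order_trans)
  with B(2) have B0: "0 \<le> B" by (auto intro: LIMSEQ_le_const)
  have nn: "AE x in M. 0 \<le> q x"
    using q(3) by eventually_elim (auto intro: LIMSEQ_le_const q(2))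
  have "(\<integral>\<^sup>+x. ennreal (q x) \<partial>M) = (\<integral>\<^sup>+x. liminf (\<lambda>i. ennreal (q' i x)) \<partial>M)"
    using q(3) by (intro nn_integral_cong_AE, eventually_elim)
      (metis lim_imp_Liminf tendsto_ennrealI trivial_limit_sequentially)
  also have "\<dots> \<le> liminf (\<lambda>i. \<integral>\<^sup>+x. ennreal (q' i x) \<partial>M)"
    by (rule nn_integral_liminf) measurable
  also have "\<dots> \<le> ennreal B"
  proof -
    have "(\<integral>\<^sup>+x. ennreal (q' i x) \<partial>M) \<le> ennreal (B' i)" for i
      using nn_integral_eq_integral[OF q(1)[of i]] q(2) B(1)[of i] by (simp add: ennreal_leI)
    then have "liminf (\<lambda>i. \<integral>\<^sup>+x. ennreal (q' i x) \<partial>M) \<le> liminf (\<lambda>i. ennreal (B' i))"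
      by (intro Liminf_mono always_eventually allI)
    also have "\<dots> = ennreal B"
      by (intro lim_imp_Liminf tendsto_ennrealI B(2) trivial_limit_sequentially)
    finally show ?thesis .
  qed
  finally have le: "(\<integral>\<^sup>+x. ennreal (q x) \<partial>M) \<le> ennreal B" .
  have fin: "(\<integral>\<^sup>+x. ennreal (norm (q x)) \<partial>M) = (\<integral>\<^sup>+x. ennreal (q x) \<partial>M)"
    using nn by (intro nn_integral_cong_AE, eventually_elim) simp
  show i: "integrable M q"
    using le fin by (intro integrableI_bounded) (auto intro: le_less_trans)
  show "integral\<^sup>L M q \<le> B"
    using le nn_integral_eq_integral[OF i nn] B0 by simp
qed

section \<open>Fourier coefficients with respect to the eigenfunctions\<close>

locale dirichlet_domain =
  fixes \<Omega> :: "(real^'n::finite) set" and \<theta> :: "nat \<Rightarrow> real" and \<phi> :: "nat \<Rightarrow> real^'n \<Rightarrow> real"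
  assumes dim: "CARD('n) \<le> 4" and open_dom: "open \<Omega>" and bounded_dom: "bounded \<Omega>"
    and eigensystem: "dirichlet_eigensystem \<Omega> \<theta> \<phi>"
begin

abbreviation "M \<equiv> lebesgue_on \<Omega>"

lemma eigenvalue_mono: "\<theta> 0 \<le> \<theta> k"
  and eigenvalue_pos: "0 < \<theta> k"
  using eigensystem by (auto simp: dirichlet_eigensystem_def incseq_def intro: less_le_trans)

lemma eigenfunction: "dirichlet_eigenfunction \<Omega> (\<theta> k) (\<phi> k)"
  using eigensystem by (simp add: dirichlet_eigensystem_def)

lemma eigenfunction_L2: "\<phi> k \<in> L2 \<Omega>"
  and orthonormal: "L2_inner \<Omega> (\<phi> j) (\<phi> k) = (if j = k then 1 else 0)"
  and complete: "w \<in> L2 \<Omega> \<Longrightarrow> (\<And>k. L2_inner \<Omega> w (\<phi> k) = 0) \<Longrightarrow> AE x in M. w x = 0"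
  using eigensystem by (auto simp: dirichlet_eigensystem_def complete_orthonormal_def)

lemma finite_measure_dom: "finite_measure M"
  by (intro finite_measure_lebesgue_on bounded_set_imp_lmeasurable bounded_dom) (simp add: open_dom)

text \<open>A bounded domain has finite measure, so L^2 convergence implies L^1 convergence; this is
  the source of the almost everywhere convergent subsequences below.\<close>

lemma L2_integrable:
  assumes "f \<in> L2 \<Omega>"
  shows "integrable M f" "(LINT x|M. \<bar>f x\<bar>) \<le> L2_norm \<Omega> f * sqrt (measure M \<Omega>)"
proof -
  interpret finite_measure M by (rule finite_measure_dom)
  have one: "(\<lambda>_. 1) \<in> L2 \<Omega>" by (simp add: L2_def)
  show "integrable M f" using L2_mult_integrable[OF assms one] by simp
  have "(\<lambda>x. \<bar>f x\<bar>) \<in> L2 \<Omega>" using assms by (auto simp: L2_def intro: borel_measurable_abs)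
  from L2_Cauchy_Schwarz[OF this one]
  show "(LINT x|M. \<bar>f x\<bar>) \<le> L2_norm \<Omega> f * sqrt (measure M \<Omega>)"
    by (simp add: L2_inner_def L2_norm_def)
qed

lemma partial_sum_L2: "(\<lambda>x. \<Sum>k\<in>I. c k * \<phi> k x) \<in> L2 \<Omega>"
  by (intro L2_sum L2_scale eigenfunction_L2)

lemma partial_sum_inner:
  "f \<in> L2 \<Omega> \<Longrightarrow> L2_inner \<Omega> (\<lambda>x. \<Sum>k\<in>I. c k * \<phi> k x) f = (\<Sum>k\<in>I. c k * L2_inner \<Omega> f (\<phi> k))"
  by (subst L2_inner_sum_left)
    (auto intro!: L2_scale eigenfunction_L2 simp: L2_inner_scale_left eigenfunction_L2 L2_inner_commute[of \<Omega> f])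

lemma partial_sum_coeff:
  "finite I \<Longrightarrow> L2_inner \<Omega> (\<lambda>x. \<Sum>k\<in>I. c k * \<phi> k x) (\<phi> j) = (if j \<in> I then c j else 0)"
  by (simp add: partial_sum_inner eigenfunction_L2 orthonormal if_distrib cong: if_cong)

lemma partial_sum_norm:
  "finite I \<Longrightarrow> (L2_norm \<Omega> (\<lambda>x. \<Sum>k\<in>I. c k * \<phi> k x))\<^sup>2 = (\<Sum>k\<in>I. (c k)\<^sup>2)"
  unfolding L2_norm_square by (simp add: partial_sum_inner partial_sum_L2 partial_sum_coeff power2_eq_square)

lemma partial_sum_diff:
  "m \<le> n \<Longrightarrow> (\<lambda>x. (\<Sum>k<n. c k * \<phi> k x) - (\<Sum>k<m. c k * \<phi> k x)) = (\<lambda>x. \<Sum>k\<in>{m..<n}. c k * \<phi> k x)"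
  by (auto simp: fun_eq_iff sum_diff[symmetric] intro!: sum.cong)

text \<open>The partial sums are Cauchy in L^2, hence in L^1, and a subsequence converges almost
  everywhere. Fatou along this subsequence bounds the distance of the limit from every late partial
  sum, which upgrades pointwise to L^2 convergence of the full sequence.\<close>

lemma Riesz_Fischer:
  assumes c: "summable (\<lambda>k. (c k)\<^sup>2)"
  shows "\<exists>f\<in>L2 \<Omega>. (\<lambda>n. L2_norm \<Omega> (\<lambda>x. f x - (\<Sum>k<n. c k * \<phi> k x))) \<longlonglongrightarrow> 0"
proof -
  define S where "S n x = (\<Sum>k<n. c k * \<phi> k x)" for n :: nat and x
  have S: "S n \<in> L2 \<Omega>" for n unfolding S_def by (rule partial_sum_L2)
  have D: "(\<lambda>x. S j x - S i x) \<in> L2 \<Omega>" for i j by (intro L2_diff S)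
  have cauchy: "\<exists>N. \<forall>i\<ge>N. \<forall>j\<ge>N. L2_norm \<Omega> (\<lambda>x. S j x - S i x) < e" if "e > 0" for e
  proof -
    have "e\<^sup>2 > 0" using that by simp
    then obtain N where N: "\<And>m n. m \<ge> N \<Longrightarrow> norm (\<Sum>k\<in>{m..<n}. (c k)\<^sup>2) < e\<^sup>2"
      using c unfolding summable_Cauchy by metis
    have *: "L2_norm \<Omega> (\<lambda>x. S j x - S i x) < e" if "i \<ge> N" "i \<le> j" for i j
    proof -
      have "(L2_norm \<Omega> (\<lambda>x. S j x - S i x))\<^sup>2 = (\<Sum>k\<in>{i..<j}. (c k)\<^sup>2)"
        unfolding S_def partial_sum_diff[OF that(2)] by (simp add: partial_sum_norm)
      also have "\<dots> < e\<^sup>2" using N[OF that(1), of j] by simp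
      finally show ?thesis using \<open>e > 0\<close> by (meson less_imp_le power2_less_imp_less)
    qed
    have sym: "L2_norm \<Omega> (\<lambda>x. S j x - S i x) = L2_norm \<Omega> (\<lambda>x. S i x - S j x)" for i j
      by (simp add: L2_norm_def L2_inner_def algebra_simps)
    show ?thesis
    proof (intro exI[of _ N] allI impI)
      fix i j assume "N \<le> i" "N \<le> j"
      then show "L2_norm \<Omega> (\<lambda>x. S j x - S i x) < e"
        using *[of i j] *[of j i] sym[of i j] by (cases "i \<le> j") auto
    qed
  qed
  have "\<exists>N. \<forall>i\<ge>N. \<forall>j\<ge>N. (LINT x|M. norm (S i x - S j x)) < e" if "e > 0" for e
  proof -
    \<comment> \<open>One is added so that \<open>e / K\<close> is positive even when the domain is
      a null set.\<close>
    define K where "K = sqrt (measure M \<Omega>) + 1"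
    have K: "K > 0" "sqrt (measure M \<Omega>) \<le> K" by (auto simp: K_def intro: add_nonneg_pos)
    obtain N where N: "\<And>i j. i \<ge> N \<Longrightarrow> j \<ge> N \<Longrightarrow> L2_norm \<Omega> (\<lambda>x. S j x - S i x) < e / K"
      using cauchy[of "e / K"] \<open>e > 0\<close> K by (meson divide_pos_pos)
    show ?thesis
    proof (intro exI[of _ N] allI impI)
      fix i j assume ij: "N \<le> i" "N \<le> j"
      have "(LINT x|M. \<bar>S i x - S j x\<bar>) \<le> L2_norm \<Omega> (\<lambda>x. S i x - S j x) * sqrt (measure M \<Omega>)"
        by (rule L2_integrable(2)[OF D])
      also have "\<dots> \<le> L2_norm \<Omega> (\<lambda>x. S i x - S j x) * K"
        by (intro mult_left_mono K L2_norm_nonneg)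
      also have "\<dots> < e" using N[OF ij(2,1)] K(1) by (simp add: pos_less_divide_eq)
      finally show "(LINT x|M. norm (S i x - S j x)) < e" by simp
    qed
  qed
  from cauchy_L1_AE_cauchy_subseq[OF L2_integrable(1)[OF S] this]
  obtain r where r: "strict_mono r" "AE x in M. Cauchy (\<lambda>i. S (r i) x)" by blast
  define f where "f x = lim (\<lambda>i. S (r i) x)" for x
  have fm: "f \<in> borel_measurable M"
    unfolding f_def by (rule borel_measurable_lim_metric) (rule L2_measurable[OF S])
  have flim: "AE x in M. (\<lambda>i. S (r i) x) \<longlonglongrightarrow> f x"
    using r(2) by eventually_elim (simp add: f_def Cauchy_convergent_iff convergent_LIMSEQ_iff)
  have est: "\<exists>N. \<forall>n\<ge>N. (\<lambda>x. f x - S n x) \<in> L2 \<Omega> \<and> L2_norm \<Omega> (\<lambda>x. f x - S n x) \<le> e" if e: "e > 0" for e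
  proof -
    from cauchy[OF e] obtain N where
      N: "\<And>i j. i \<ge> N \<Longrightarrow> j \<ge> N \<Longrightarrow> L2_norm \<Omega> (\<lambda>x. S j x - S i x) < e" by blast
    show ?thesis
    proof (intro exI[of _ N] allI impI)
      fix n assume n: "n \<ge> N"
      have m: "(\<lambda>x. f x - S n x) \<in> borel_measurable M"
        using fm L2_measurable[OF S[of n]] by simp
      have q: "integrable M (\<lambda>x. (S (r (i + N)) x - S n x)\<^sup>2)" for i
        by (rule L2_square_integrable[OF D])
      have b: "(LINT x|M. (S (r (i + N)) x - S n x)\<^sup>2) \<le> e\<^sup>2" for i
      proof -
        \<comment> \<open>\<open>r\<close> is strictly increasing, so shifting its index by
          \<open>N\<close> puts the whole subsequence beyond \<open>N\<close>.\<close>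
        have "N \<le> r (i + N)" using seq_suble[OF r(1), of "i + N"] by simp
        then show ?thesis
          unfolding L2_norm_square_integral[symmetric]
          using N[OF n] by (intro power_mono L2_norm_nonneg less_imp_le)
      qed
      have l: "AE x in M. (\<lambda>i. (S (r (i + N)) x - S n x)\<^sup>2) \<longlonglongrightarrow> (f x - S n x)\<^sup>2"
        using flim by eventually_elim (intro tendsto_intros LIMSEQ_ignore_initial_segment)
      have m2: "(\<lambda>x. (f x - S n x)\<^sup>2) \<in> borel_measurable M" using m by simp
      note F = Fatou_real[where q'="\<lambda>i x. (S (r (i + N)) x - S n x)\<^sup>2", OF q _ l m2 b tendsto_const]
      have "(L2_norm \<Omega> (\<lambda>x. f x - S n x))\<^sup>2 \<le> e\<^sup>2" unfolding L2_norm_square_integral using F(2) by simp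
      then show "(\<lambda>x. f x - S n x) \<in> L2 \<Omega> \<and> L2_norm \<Omega> (\<lambda>x. f x - S n x) \<le> e"
        using F(1) m e by (auto simp: L2_def intro: power2_le_imp_le)
    qed
  qed
  obtain n where "(\<lambda>x. f x - S n x) \<in> L2 \<Omega>" using est[of 1] by auto
  from L2_add[OF this S[of n]] have "f \<in> L2 \<Omega>" by simp
  moreover have "(\<lambda>n. L2_norm \<Omega> (\<lambda>x. f x - S n x)) \<longlonglongrightarrow> 0"
  proof (rule LIMSEQ_I)
    fix e :: real assume "e > 0"
    then obtain N where N: "\<forall>n\<ge>N. L2_norm \<Omega> (\<lambda>x. f x - S n x) \<le> e/2" using est[of "e/2"] by auto
    moreover have "e / 2 < e" using \<open>e > 0\<close> by simp
    ultimately have "L2_norm \<Omega> (\<lambda>x. f x - S n x) < e" if "n \<ge> N" for n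
      using that by (meson le_less_trans)
    then show "\<exists>N. \<forall>n\<ge>N. norm (L2_norm \<Omega> (\<lambda>x. f x - S n x) - 0) < e"
      by (intro exI[of _ N]) (simp add: abs_of_nonneg L2_norm_nonneg)
  qed
  ultimately show ?thesis unfolding S_def by blast
qed

lemma limit_coeff:
  assumes f: "f \<in> L2 \<Omega>" and g: "g \<in> L2 \<Omega>" and S: "\<And>n. S n \<in> L2 \<Omega>"
    and lim: "(\<lambda>n. L2_norm \<Omega> (\<lambda>x. f x - S n x)) \<longlonglongrightarrow> 0"
  shows "(\<lambda>n. L2_inner \<Omega> (S n) g) \<longlonglongrightarrow> L2_inner \<Omega> f g"
proof -
  have "(\<lambda>n. L2_inner \<Omega> f g - L2_inner \<Omega> (S n) g) \<longlonglongrightarrow> 0"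
  proof (rule Lim_null_comparison)
    show "\<forall>\<^sub>F n in sequentially. norm (L2_inner \<Omega> f g - L2_inner \<Omega> (S n) g)
        \<le> L2_norm \<Omega> (\<lambda>x. f x - S n x) * L2_norm \<Omega> g"
      using L2_Cauchy_Schwarz[OF L2_diff[OF f S] g] L2_inner_diff_left[OF f S g]
      by (intro always_eventually) simp
    show "(\<lambda>n. L2_norm \<Omega> (\<lambda>x. f x - S n x) * L2_norm \<Omega> g) \<longlonglongrightarrow> 0"
      using tendsto_mult_left_zero[OF lim] by simp
  qed
  from tendsto_diff[OF tendsto_const[of "L2_inner \<Omega> f g"] this] show ?thesis by simp
qed

lemma series_coeff:
  assumes "f \<in> L2 \<Omega>" "(\<lambda>n. L2_norm \<Omega> (\<lambda>x. f x - (\<Sum>k<n. c k * \<phi> k x))) \<longlonglongrightarrow> 0"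
  shows "L2_inner \<Omega> f (\<phi> j) = c j"
proof -
  have "(\<lambda>n. if j \<in> {..<n} then c j else 0) \<longlonglongrightarrow> L2_inner \<Omega> f (\<phi> j)"
    using limit_coeff[OF assms(1) eigenfunction_L2 partial_sum_L2 assms(2), of j]
    by (simp add: partial_sum_coeff)
  moreover have "(\<lambda>n. if j \<in> {..<n} then c j else 0) \<longlonglongrightarrow> c j"
    by (rule tendsto_eventually, rule eventually_mono[OF eventually_gt_at_top[of j]]) simp
  ultimately show ?thesis by (rule LIMSEQ_unique)
qed

lemma Bessel:
  assumes w: "w \<in> L2 \<Omega>"
  shows "summable (\<lambda>k. (L2_inner \<Omega> w (\<phi> k))\<^sup>2)"
proof -
  define c where "c k = L2_inner \<Omega> w (\<phi> k)" for k
  have "(\<Sum>k<n. (c k)\<^sup>2) \<le> (L2_norm \<Omega> w)\<^sup>2" for n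
  proof -
    let ?S = "\<lambda>x. \<Sum>k<n. c k * \<phi> k x"
    have S: "?S \<in> L2 \<Omega>" by (rule partial_sum_L2)
    have i: "L2_inner \<Omega> ?S w = (\<Sum>k<n. (c k)\<^sup>2)"
      using partial_sum_inner[OF w, of c "{..<n}"] by (simp add: c_def power2_eq_square)
    have "0 \<le> L2_inner \<Omega> (\<lambda>x. w x - ?S x) (\<lambda>x. w x - ?S x)" by (rule L2_inner_self_nonneg)
    also have "\<dots> = L2_inner \<Omega> w w - 2 * L2_inner \<Omega> ?S w + L2_inner \<Omega> ?S ?S"
      using L2_inner_diff_self[OF w S, of 1] by (simp add: L2_inner_commute[of _ w ?S])
    also have "\<dots> = (L2_norm \<Omega> w)\<^sup>2 - (\<Sum>k<n. (c k)\<^sup>2)"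
      using partial_sum_norm[of "{..<n}" c] i by (simp add: L2_norm_square)
    finally show ?thesis by simp
  qed
  then show ?thesis
    unfolding c_def by (intro summableI_nonneg_bounded[of _ "(L2_norm \<Omega> w)\<^sup>2"]) auto
qed

text \<open>Riesz-Fischer produces some function with the coefficients of \<open>w\<close>;
  completeness of the system identifies it with \<open>w\<close> almost everywhere.\<close>

lemma coeff_series_tendsto:
  assumes w: "w \<in> L2 \<Omega>"
  shows "(\<lambda>n. L2_norm \<Omega> (\<lambda>x. w x - (\<Sum>k<n. L2_inner \<Omega> w (\<phi> k) * \<phi> k x))) \<longlonglongrightarrow> 0"
proof -
  obtain f where f: "f \<in> L2 \<Omega>"
    "(\<lambda>n. L2_norm \<Omega> (\<lambda>x. f x - (\<Sum>k<n. L2_inner \<Omega> w (\<phi> k) * \<phi> k x))) \<longlonglongrightarrow> 0"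
    using Riesz_Fischer[OF Bessel[OF w]] by blast
  have "L2_inner \<Omega> (\<lambda>x. w x - f x) (\<phi> k) = 0" for k
    using series_coeff[OF f] by (simp add: L2_inner_diff_left w f(1) eigenfunction_L2)
  then have ae: "AE x in M. w x - f x = 0"
    by (intro complete L2_diff w f(1))
  have "L2_norm \<Omega> (\<lambda>x. w x - (\<Sum>k<n. L2_inner \<Omega> w (\<phi> k) * \<phi> k x))
      = L2_norm \<Omega> (\<lambda>x. f x - (\<Sum>k<n. L2_inner \<Omega> w (\<phi> k) * \<phi> k x))" for n
    using ae by (intro L2_norm_cong_AE L2_diff w f(1) partial_sum_L2) (auto elim: eventually_mono)
  with f(2) show ?thesis by simp
qed

definition coef :: "(real^'n \<Rightarrow> real) \<Rightarrow> l2" where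
  "coef w = Abs_l2 (\<lambda>k. L2_inner \<Omega> w (\<phi> k))"

lemma nth_coef: "w \<in> L2 \<Omega> \<Longrightarrow> nth_l2 (coef w) k = L2_inner \<Omega> w (\<phi> k)"
  by (simp add: coef_def nth_l2_Abs[OF Bessel])

lemma coef_lincomb:
  "v \<in> L2 \<Omega> \<Longrightarrow> w \<in> L2 \<Omega> \<Longrightarrow> coef (\<lambda>x. a * v x + b * w x) = a *\<^sub>R coef v + b *\<^sub>R coef w"
  by (rule l2_eqI) (simp add: nth_coef L2_lincomb L2_inner_lincomb_left eigenfunction_L2)

lemma coef_add: "v \<in> L2 \<Omega> \<Longrightarrow> w \<in> L2 \<Omega> \<Longrightarrow> coef (\<lambda>x. v x + w x) = coef v + coef w"
  using coef_lincomb[of v w 1 1] by simp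

lemma coef_diff: "v \<in> L2 \<Omega> \<Longrightarrow> w \<in> L2 \<Omega> \<Longrightarrow> coef (\<lambda>x. v x - w x) = coef v - coef w"
  using coef_lincomb[of v w 1 "-1"] by simp

text \<open>Parseval: the pairings of the partial sums with \<open>w\<close> are the partial sums of
  the squared coefficients, and they converge to the pairing of \<open>w\<close> with
  itself.\<close>

lemma norm_coef:
  assumes w: "w \<in> L2 \<Omega>"
  shows "norm (coef w) = L2_norm \<Omega> w"
proof -
  let ?c = "\<lambda>k. L2_inner \<Omega> w (\<phi> k)"
  have "(\<lambda>n. L2_inner \<Omega> (\<lambda>x. \<Sum>k<n. ?c k * \<phi> k x) w) \<longlonglongrightarrow> L2_inner \<Omega> w w"
    by (rule limit_coeff[OF w w partial_sum_L2 coeff_series_tendsto[OF w]])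
  then have "(\<lambda>k. (?c k)\<^sup>2) sums (L2_norm \<Omega> w)\<^sup>2"
    by (simp add: sums_def partial_sum_inner[OF w] power2_eq_square[symmetric] L2_norm_square)
  from sums_unique[OF this] have "(norm (coef w))\<^sup>2 = (L2_norm \<Omega> w)\<^sup>2"
    by (simp add: norm_l2_square nth_coef[OF w])
  then show ?thesis using L2_norm_nonneg[of \<Omega> w] by (simp add: power2_eq_iff_nonneg)
qed

text \<open>Polarisation of the norm identity. From here on, L^2 pairings can be moved to
  \<open>l2\<close> and back.\<close>

lemma inner_coef:
  assumes "v \<in> L2 \<Omega>" "w \<in> L2 \<Omega>"
  shows "inner (coef v) (coef w) = L2_inner \<Omega> v w"
proof -
  have "L2_inner \<Omega> (\<lambda>x. v x + w x) (\<lambda>x. v x + w x) = L2_inner \<Omega> v v + 2 * L2_inner \<Omega> v w + L2_inner \<Omega> w w"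
    using L2_inner_diff_self[OF assms, of "-1"] by simp
  moreover have "(norm (coef v + coef w))\<^sup>2 = (norm (coef v))\<^sup>2 + 2 * inner (coef v) (coef w) + (norm (coef w))\<^sup>2"
    by (simp add: power2_norm_eq_inner inner_add inner_commute)
  ultimately show ?thesis
    unfolding coef_add[OF assms, symmetric] norm_coef[OF L2_add[OF assms]]
      norm_coef[OF assms(1)] norm_coef[OF assms(2)] L2_norm_square by simp
qed

lemma coef_eq_iff:
  assumes "v \<in> L2 \<Omega>" "w \<in> L2 \<Omega>"
  shows "coef v = coef w \<longleftrightarrow> (AE x in M. v x = w x)"
proof -
  have "coef v = coef w \<longleftrightarrow> norm (coef (\<lambda>x. v x - w x)) = 0"
    by (simp add: coef_diff assms)
  also have "\<dots> \<longleftrightarrow> (AE x in M. v x - w x = 0)"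
    unfolding norm_coef[OF L2_diff[OF assms]] by (rule L2_norm_eq_0_iff[OF L2_diff[OF assms]])
  finally show ?thesis by simp
qed

lemma L2_series:
  assumes "summable (\<lambda>k. (c k)\<^sup>2)"
  shows "L2_series \<Omega> \<phi> c \<in> L2 \<Omega>" "coef (L2_series \<Omega> \<phi> c) = Abs_l2 c"
proof -
  have *: "L2_series \<Omega> \<phi> c \<in> L2 \<Omega> \<and>
      (\<lambda>n. L2_norm \<Omega> (\<lambda>x. L2_series \<Omega> \<phi> c x - (\<Sum>k<n. c k * \<phi> k x))) \<longlonglongrightarrow> 0"
    using someI_ex[of "\<lambda>f. f \<in> L2 \<Omega> \<and> (\<lambda>n. L2_norm \<Omega> (\<lambda>x. f x - (\<Sum>k<n. c k * \<phi> k x))) \<longlonglongrightarrow> 0"]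
      Riesz_Fischer[OF assms] unfolding L2_series_def by blast
  then show "L2_series \<Omega> \<phi> c \<in> L2 \<Omega>" by blast
  show "coef (L2_series \<Omega> \<phi> c) = Abs_l2 c"
    by (rule l2_eqI) (use * series_coeff in \<open>simp add: nth_coef nth_l2_Abs assms\<close>)
qed

definition synth :: "l2 \<Rightarrow> real^'n \<Rightarrow> real" where
  "synth a = L2_series \<Omega> \<phi> (nth_l2 a)"

lemma synth_L2: "synth a \<in> L2 \<Omega>" and coef_synth: "coef (synth a) = a"
  using L2_series[OF summable_nth_l2[of a]] by (auto simp: synth_def nth_l2_inverse)

end

section \<open>The Loomis-Whitney inequality for four factors\<close>

lemma arith_geo_mean_3:
  fixes x y z :: real
  assumes "0 \<le> x" "0 \<le> y" "0 \<le> z"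
  shows "x * y * z \<le> ((x + y + z) / 3) ^ 3"
proof -
  \<comment> \<open>The cubes satisfy
    \<open>x^3 + y^3 + z^3 - 3 x y z = (x + y + z) * S / 2\<close>, with \<open>S\<close> the sum of
    the squared differences. The second line is three times the excess of the six mixed terms
    \<open>x^2 y\<close> over \<open>6 x y z\<close>.\<close>
  have "0 \<le> (x + y + z) * ((x - y)\<^sup>2 + (y - z)\<^sup>2 + (z - x)\<^sup>2) / 2
      + 3 * (x * (y - z)\<^sup>2 + y * (z - x)\<^sup>2 + z * (x - y)\<^sup>2)"
    using assms by (intro add_nonneg_nonneg mult_nonneg_nonneg divide_nonneg_nonneg) auto
  also have "\<dots> = (x + y + z) ^ 3 - 27 * (x * y * z)"
    by (simp add: power2_eq_square power3_eq_cube field_simps)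
  finally show ?thesis by (simp add: power_divide)
qed

text \<open>Hoelder with three exponents equal to 3, written with cubes so that no roots of extended
  reals occur. In the nondegenerate case each factor is normalised by its integral and the
  arithmetic-geometric mean inequality is applied pointwise.\<close>

lemma nn_integral_Holder_3:
  fixes h a b c :: "'a \<Rightarrow> ennreal"
  assumes [measurable]: "h \<in> borel_measurable M" "a \<in> borel_measurable M"
      "b \<in> borel_measurable M" "c \<in> borel_measurable M"
    and le: "\<And>x. h x ^ 3 \<le> a x * b x * c x"
  shows "(\<integral>\<^sup>+x. h x \<partial>M) ^ 3 \<le> (\<integral>\<^sup>+x. a x \<partial>M) * (\<integral>\<^sup>+x. b x \<partial>M) * (\<integral>\<^sup>+x. c x \<partial>M)"
proof -
  let ?A = "\<integral>\<^sup>+x. a x \<partial>M" and ?B = "\<integral>\<^sup>+x. b x \<partial>M" and ?C = "\<integral>\<^sup>+x. c x \<partial>M"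
  consider (zero) "?A = 0 \<or> ?B = 0 \<or> ?C = 0"
    | (top) "?A * ?B * ?C = top"
    | (pos) "?A \<noteq> 0" "?B \<noteq> 0" "?C \<noteq> 0" "?A \<noteq> top" "?B \<noteq> top" "?C \<noteq> top"
    by (auto simp: ennreal_mult_eq_top_iff)
  then show ?thesis
  proof cases
    case zero
    then have "AE x in M. a x * b x * c x = 0" by (auto simp: nn_integral_0_iff_AE)
    then have "AE x in M. h x = 0"
    proof eventually_elim
      case (elim x)
      then have "h x ^ 3 \<le> 0" using le[of x] by auto
      then show ?case by simp
    qed
    then have "(\<integral>\<^sup>+x. h x \<partial>M) = 0" by (simp add: nn_integral_0_iff_AE)
    then show ?thesis by simp
  next
    case top then show ?thesis by simp
  next
    case pos
    then obtain A B C where ABC: "?A = ennreal A" "?B = ennreal B" "?C = ennreal C" "A > 0" "B > 0" "C > 0"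
      by (cases ?A; cases ?B; cases ?C) (auto simp: less_le)
    \<comment> \<open>\<open>r\<close> is the bound to be reached. With the weights
      \<open>r / (3 * A)\<close>, \<open>r / (3 * B)\<close> and \<open>r / (3 * C)\<close> each of
      the three terms integrates to \<open>r / 3\<close>.\<close>
    define r where "r = root 3 (A * B * C)"
    have r: "r > 0" "r ^ 3 = A * B * C" using ABC by (auto simp: r_def)
    have "h x \<le> ennreal (r / (3 * A)) * a x + ennreal (r / (3 * B)) * b x + ennreal (r / (3 * C)) * c x" for x
    proof (cases "a x = top \<or> b x = top \<or> c x = top")
      case True
      then show ?thesis using ABC r by (auto simp: ennreal_mult_top)
    next
      case False
      then obtain u v w where uvw: "a x = ennreal u" "b x = ennreal v" "c x = ennreal w" "0 \<le> u" "0 \<le> v" "0 \<le> w"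
        by (cases "a x"; cases "b x"; cases "c x") auto
      have "h x ^ 3 \<le> ennreal (u * v * w)"
        using le[of x] uvw by (simp add: ennreal_mult)
      then have "h x ^ 3 \<noteq> top" by (auto simp: top_unique)
      then obtain t where t: "h x = ennreal t" "0 \<le> t"
        by (cases "h x") (auto simp: power3_eq_cube)
      have "t ^ 3 \<le> u * v * w"
        using \<open>h x ^ 3 \<le> ennreal (u * v * w)\<close> t uvw by (simp add: ennreal_power)
      also have "\<dots> = r ^ 3 * ((u / A) * (v / B) * (w / C))"
        using ABC by (simp add: r(2))
      also have "\<dots> \<le> r ^ 3 * ((u / A + v / B + w / C) / 3) ^ 3"
        using ABC uvw r by (intro mult_left_mono arith_geo_mean_3) auto
      also have "\<dots> = (r / (3 * A) * u + r / (3 * B) * v + r / (3 * C) * w) ^ 3"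
        unfolding power_mult_distrib[symmetric] using ABC by (simp add: field_simps)
      finally have "t ^ 3 \<le> (r / (3 * A) * u + r / (3 * B) * v + r / (3 * C) * w) ^ 3" .
      moreover have "0 \<le> r / (3 * A) * u + r / (3 * B) * v + r / (3 * C) * w"
        using ABC uvw r by auto
      ultimately have "t \<le> r / (3 * A) * u + r / (3 * B) * v + r / (3 * C) * w"
        using t by (simp only: power_mono_iff zero_less_numeral)
      then show ?thesis
        using t uvw r ABC by (simp add: ennreal_mult[symmetric] ennreal_plus[symmetric] del: ennreal_plus)
    qed
    then have "(\<integral>\<^sup>+x. h x \<partial>M)
        \<le> (\<integral>\<^sup>+x. ennreal (r / (3 * A)) * a x + ennreal (r / (3 * B)) * b x + ennreal (r / (3 * C)) * c x \<partial>M)"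
      by (intro nn_integral_mono)
    also have "\<dots> = ennreal (r / (3 * A)) * ?A + ennreal (r / (3 * B)) * ?B + ennreal (r / (3 * C)) * ?C"
      by (simp add: nn_integral_add nn_integral_cmult)
    also have "\<dots> = ennreal r"
      using ABC r by (simp add: ennreal_mult[symmetric] ennreal_plus[symmetric] del: ennreal_plus)
    finally have "(\<integral>\<^sup>+x. h x \<partial>M) ^ 3 \<le> ennreal r ^ 3" by (intro power_mono) auto
    also have "\<dots> = ?A * ?B * ?C"
      using ABC r by (simp add: ennreal_power ennreal_mult)
    finally show ?thesis .
  qed
qed

text \<open>Each factor omits one variable. When that variable is integrated, this factor is a
  constant and comes out, so exactly three factors are left for Hoelder. Four rounds, over
  \<open>w\<close>, \<open>z\<close>, \<open>y\<close> and \<open>x\<close>, release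
  \<open>d\<close>, \<open>c\<close>, \<open>b\<close> and \<open>a\<close> in turn.\<close>

lemma Loomis_Whitney_4:
  fixes h :: "'a \<Rightarrow> 'b \<Rightarrow> 'c \<Rightarrow> 'd \<Rightarrow> ennreal"
  assumes "sigma_finite_measure M1" "sigma_finite_measure M2"
    and "sigma_finite_measure M3" "sigma_finite_measure M4"
    and [measurable]: "(\<lambda>(x, y, z, w). h x y z w) \<in> borel_measurable (M1 \<Otimes>\<^sub>M M2 \<Otimes>\<^sub>M M3 \<Otimes>\<^sub>M M4)"
      "(\<lambda>(y, z, w). a y z w) \<in> borel_measurable (M2 \<Otimes>\<^sub>M M3 \<Otimes>\<^sub>M M4)"
      "(\<lambda>(x, z, w). b x z w) \<in> borel_measurable (M1 \<Otimes>\<^sub>M M3 \<Otimes>\<^sub>M M4)"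
      "(\<lambda>(x, y, w). c x y w) \<in> borel_measurable (M1 \<Otimes>\<^sub>M M2 \<Otimes>\<^sub>M M4)"
      "(\<lambda>(x, y, z). d x y z) \<in> borel_measurable (M1 \<Otimes>\<^sub>M M2 \<Otimes>\<^sub>M M3)"
    and sp[simp]: "space M1 = UNIV" "space M2 = UNIV" "space M3 = UNIV" "space M4 = UNIV"
    and le: "\<And>x y z w. h x y z w ^ 3 \<le> a y z w * b x z w * c x y w * d x y z"
  shows "(\<integral>\<^sup>+x. \<integral>\<^sup>+y. \<integral>\<^sup>+z. \<integral>\<^sup>+w. h x y z w \<partial>M4 \<partial>M3 \<partial>M2 \<partial>M1) ^ 3
    \<le> (\<integral>\<^sup>+y. \<integral>\<^sup>+z. \<integral>\<^sup>+w. a y z w \<partial>M4 \<partial>M3 \<partial>M2) * (\<integral>\<^sup>+x. \<integral>\<^sup>+z. \<integral>\<^sup>+w. b x z w \<partial>M4 \<partial>M3 \<partial>M1)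
      * (\<integral>\<^sup>+x. \<integral>\<^sup>+y. \<integral>\<^sup>+w. c x y w \<partial>M4 \<partial>M2 \<partial>M1) * (\<integral>\<^sup>+x. \<integral>\<^sup>+y. \<integral>\<^sup>+z. d x y z \<partial>M3 \<partial>M2 \<partial>M1)"
proof -
  interpret M1: sigma_finite_measure M1 by fact
  interpret M2: sigma_finite_measure M2 by fact
  interpret M3: sigma_finite_measure M3 by fact
  interpret M4: sigma_finite_measure M4 by fact
  \<comment> \<open>Measurability is restated for arbitrary measurable arguments, so that every
    section and every iterated integral occurring below is covered.\<close>
  have [measurable]: "(\<lambda>p. h (f1 p) (f2 p) (f3 p) (f4 p)) \<in> borel_measurable N"
    if [measurable]: "f1 \<in> measurable N M1" "f2 \<in> measurable N M2" "f3 \<in> measurable N M3" "f4 \<in> measurable N M4"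
    for f1 f2 f3 f4 and N :: "'e measure"
    using measurable_compose[OF _ assms(5), of "\<lambda>p. (f1 p, f2 p, f3 p, f4 p)" N] by simp
  have [measurable]: "(\<lambda>p. a (f2 p) (f3 p) (f4 p)) \<in> borel_measurable N"
    if [measurable]: "f2 \<in> measurable N M2" "f3 \<in> measurable N M3" "f4 \<in> measurable N M4"
    for f2 f3 f4 and N :: "'e measure"
    using measurable_compose[OF _ assms(6), of "\<lambda>p. (f2 p, f3 p, f4 p)" N] by simp
  have [measurable]: "(\<lambda>p. b (f1 p) (f3 p) (f4 p)) \<in> borel_measurable N"
    if [measurable]: "f1 \<in> measurable N M1" "f3 \<in> measurable N M3" "f4 \<in> measurable N M4"
    for f1 f3 f4 and N :: "'e measure"
    using measurable_compose[OF _ assms(7), of "\<lambda>p. (f1 p, f3 p, f4 p)" N] by simp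
  have [measurable]: "(\<lambda>p. c (f1 p) (f2 p) (f4 p)) \<in> borel_measurable N"
    if [measurable]: "f1 \<in> measurable N M1" "f2 \<in> measurable N M2" "f4 \<in> measurable N M4"
    for f1 f2 f4 and N :: "'e measure"
    using measurable_compose[OF _ assms(8), of "\<lambda>p. (f1 p, f2 p, f4 p)" N] by simp
  have [measurable]: "(\<lambda>p. d (f1 p) (f2 p) (f3 p)) \<in> borel_measurable N"
    if [measurable]: "f1 \<in> measurable N M1" "f2 \<in> measurable N M2" "f3 \<in> measurable N M3"
    for f1 f2 f3 and N :: "'e measure"
    using measurable_compose[OF _ assms(9), of "\<lambda>p. (f1 p, f2 p, f3 p)" N] by simp
  define A1 where "A1 y z = (\<integral>\<^sup>+w. a y z w \<partial>M4)" for y z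
  define B1 where "B1 x z = (\<integral>\<^sup>+w. b x z w \<partial>M4)" for x z
  define C1 where "C1 x y = (\<integral>\<^sup>+w. c x y w \<partial>M4)" for x y
  define D1 where "D1 x y = (\<integral>\<^sup>+z. d x y z \<partial>M3)" for x y
  have [measurable]: "(\<lambda>p. A1 (f2 p) (f3 p)) \<in> borel_measurable N"
    if [measurable]: "f2 \<in> measurable N M2" "f3 \<in> measurable N M3" for f2 f3 and N :: "'e measure"
    unfolding A1_def by measurable
  have [measurable]: "(\<lambda>p. B1 (f1 p) (f3 p)) \<in> borel_measurable N"
    if [measurable]: "f1 \<in> measurable N M1" "f3 \<in> measurable N M3" for f1 f3 and N :: "'e measure"
    unfolding B1_def by measurable
  have [measurable]: "(\<lambda>p. C1 (f1 p) (f2 p)) \<in> borel_measurable N"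
    if [measurable]: "f1 \<in> measurable N M1" "f2 \<in> measurable N M2" for f1 f2 and N :: "'e measure"
    unfolding C1_def by measurable
  have [measurable]: "(\<lambda>p. D1 (f1 p) (f2 p)) \<in> borel_measurable N"
    if [measurable]: "f1 \<in> measurable N M1" "f2 \<in> measurable N M2" for f1 f2 and N :: "'e measure"
    unfolding D1_def by measurable
  have [measurable]: "(\<lambda>_. x) \<in> measurable N M1" "(\<lambda>_. y) \<in> measurable N M2" "(\<lambda>_. z) \<in> measurable N M3"
    for x y z and N :: "'e measure"
    by auto
  have 1: "(\<integral>\<^sup>+w. h x y z w \<partial>M4) ^ 3 \<le> A1 y z * B1 x z * (C1 x y * d x y z)" for x y z
  proof -
    have "(\<integral>\<^sup>+w. h x y z w \<partial>M4) ^ 3 \<le> (\<integral>\<^sup>+w. a y z w \<partial>M4) * (\<integral>\<^sup>+w. b x z w \<partial>M4) * (\<integral>\<^sup>+w. c x y w * d x y z \<partial>M4)"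
      by (rule nn_integral_Holder_3) (use le in \<open>auto simp: mult.assoc\<close>)
    then show ?thesis by (simp add: A1_def B1_def C1_def nn_integral_multc)
  qed
  have 2: "(\<integral>\<^sup>+z. \<integral>\<^sup>+w. h x y z w \<partial>M4 \<partial>M3) ^ 3
      \<le> (\<integral>\<^sup>+z. A1 y z \<partial>M3) * (\<integral>\<^sup>+z. B1 x z \<partial>M3) * (C1 x y * D1 x y)" for x y
  proof -
    have "(\<integral>\<^sup>+z. \<integral>\<^sup>+w. h x y z w \<partial>M4 \<partial>M3) ^ 3
      \<le> (\<integral>\<^sup>+z. A1 y z \<partial>M3) * (\<integral>\<^sup>+z. B1 x z \<partial>M3) * (\<integral>\<^sup>+z. C1 x y * d x y z \<partial>M3)"
      by (rule nn_integral_Holder_3) (use 1 in auto)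
    then show ?thesis by (simp add: D1_def nn_integral_cmult)
  qed
  have 3: "(\<integral>\<^sup>+y. \<integral>\<^sup>+z. \<integral>\<^sup>+w. h x y z w \<partial>M4 \<partial>M3 \<partial>M2) ^ 3
      \<le> (\<integral>\<^sup>+y. \<integral>\<^sup>+z. A1 y z \<partial>M3 \<partial>M2) * ((\<integral>\<^sup>+z. B1 x z \<partial>M3) * (\<integral>\<^sup>+y. C1 x y \<partial>M2)) * (\<integral>\<^sup>+y. D1 x y \<partial>M2)" for x
  proof -
    have "(\<integral>\<^sup>+y. \<integral>\<^sup>+z. \<integral>\<^sup>+w. h x y z w \<partial>M4 \<partial>M3 \<partial>M2) ^ 3
      \<le> (\<integral>\<^sup>+y. \<integral>\<^sup>+z. A1 y z \<partial>M3 \<partial>M2) * (\<integral>\<^sup>+y. (\<integral>\<^sup>+z. B1 x z \<partial>M3) * C1 x y \<partial>M2) * (\<integral>\<^sup>+y. D1 x y \<partial>M2)"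
      by (rule nn_integral_Holder_3) (use 2 in \<open>auto simp: mult.assoc\<close>)
    then show ?thesis by (simp add: nn_integral_cmult)
  qed
  have "(\<integral>\<^sup>+x. \<integral>\<^sup>+y. \<integral>\<^sup>+z. \<integral>\<^sup>+w. h x y z w \<partial>M4 \<partial>M3 \<partial>M2 \<partial>M1) ^ 3
      \<le> (\<integral>\<^sup>+x. (\<integral>\<^sup>+y. \<integral>\<^sup>+z. A1 y z \<partial>M3 \<partial>M2) * (\<integral>\<^sup>+z. B1 x z \<partial>M3) \<partial>M1)
        * (\<integral>\<^sup>+x. \<integral>\<^sup>+y. C1 x y \<partial>M2 \<partial>M1) * (\<integral>\<^sup>+x. \<integral>\<^sup>+y. D1 x y \<partial>M2 \<partial>M1)"
    by (rule nn_integral_Holder_3) (use 3 in \<open>auto simp: mult.assoc\<close>)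
  then show ?thesis by (simp add: nn_integral_cmult A1_def B1_def C1_def D1_def)
qed


text \<open>An integral over a Euclidean space of dimension less than four is brought into the four-fold
  form by filling up with dummy variables that range over a space of total mass one.\<close>

definition unit_interval_measure :: "real measure" where
  "unit_interval_measure = density lborel (indicator {0..1})"

text \<open>A zero vector marks a dummy direction and may occur several times; genuine directions
  must be distinct so that each coordinate is integrated once.\<close>

definition is_frame :: "(real measure \<times> 'a::euclidean_space) list \<Rightarrow> bool" where
  "is_frame l \<longleftrightarrow> (\<forall>(N, e)\<in>set l. e \<in> Basis \<and> N = lborel \<or> e = 0 \<and> N = unit_interval_measure) \<and>
     distinct (filter (\<lambda>e. e \<noteq> 0) (map snd l))"

fun iterated_integral :: "(real measure \<times> 'a::euclidean_space) list \<Rightarrow> ('a \<Rightarrow> ennreal) \<Rightarrow> 'a \<Rightarrow> ennreal" where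
  "iterated_integral [] f p = f p"
| "iterated_integral ((N, e) # l) f p = (\<integral>\<^sup>+s. iterated_integral l f (p + s *\<^sub>R e) \<partial>N)"

lemma unit_interval_measure:
  "sets unit_interval_measure = sets borel" "space unit_interval_measure = UNIV"
  "emeasure unit_interval_measure UNIV = 1" "sigma_finite_measure unit_interval_measure"
proof -
  show s: "sets unit_interval_measure = sets borel" "space unit_interval_measure = UNIV"
    by (simp_all add: unit_interval_measure_def)
  show e: "emeasure unit_interval_measure UNIV = 1"
    by (simp add: unit_interval_measure_def emeasure_density)
  have "finite_measure unit_interval_measure" by (rule finite_measureI) (simp add: s e)
  then show "sigma_finite_measure unit_interval_measure" by (rule finite_measure.axioms)
qed

lemma is_frame_Cons:
  "is_frame ((N, e) # l) \<Longrightarrow> is_frame l \<and> sets N = sets borel \<and> space N = UNIV \<and> sigma_finite_measure N"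
  by (auto simp: is_frame_def unit_interval_measure lborel.sigma_finite_measure_axioms split: if_splits)

text \<open>The product measure is indexed by the set of nonzero directions, so the order of the
  list is forgotten: this packages all the Fubini exchanges needed later. A dummy direction leaves
  the integrand unchanged and contributes the total mass one.\<close>

lemma iterated_integral_eq_PiM:
  fixes f :: "'a::euclidean_space \<Rightarrow> ennreal"
  assumes [measurable]: "f \<in> borel_measurable borel" and "is_frame l"
  shows "iterated_integral l f p
    = (\<integral>\<^sup>+x. f (p + (\<Sum>b\<in>set (map snd l) - {0}. x b *\<^sub>R b)) \<partial>Pi\<^sub>M (set (map snd l) - {0}) (\<lambda>_. lborel))"
  using assms(2)
proof (induction l arbitrary: p)
  interpret product_sigma_finite "\<lambda>_ :: 'a. lborel :: real measure" ..
  case Nil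
  show ?case by (simp add: nn_integral_empty del: nn_integral_const)
next
  interpret product_sigma_finite "\<lambda>_ :: 'a. lborel :: real measure" ..
  case (Cons a l)
  obtain N and e :: 'a where a: "a = (N, e)" by force
  have l: "is_frame l" using is_frame_Cons Cons.prems a by blast
  let ?B = "set (map snd l) - {0}"
  show ?case
  proof (cases "e = 0")
    case True
    with Cons.prems a have N: "N = unit_interval_measure" by (auto simp: is_frame_def)
    have "set (map snd (a # l)) - {0} = ?B" using True a by auto
    then show ?thesis using Cons.IH[OF l, of p] by (simp add: a True N unit_interval_measure)
  next
    case False
    with Cons.prems a have N: "N = lborel" and e: "e \<notin> ?B" by (auto simp: is_frame_def)
    have B: "set (map snd (a # l)) - {0} = insert e ?B" using False a by auto
    have fin: "finite ?B" by simp
    have "(\<integral>\<^sup>+x. f (p + (\<Sum>b\<in>insert e ?B. x b *\<^sub>R b)) \<partial>Pi\<^sub>M (insert e ?B) (\<lambda>_. lborel))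
      = (\<integral>\<^sup>+s. \<integral>\<^sup>+x. f (p + (\<Sum>b\<in>insert e ?B. (x(e := s)) b *\<^sub>R b)) \<partial>Pi\<^sub>M ?B (\<lambda>_. lborel) \<partial>lborel)"
      by (rule product_nn_integral_insert_rev[OF fin e]) measurable
    also have "\<dots> = (\<integral>\<^sup>+s. \<integral>\<^sup>+x. f ((p + s *\<^sub>R e) + (\<Sum>b\<in>?B. x b *\<^sub>R b)) \<partial>Pi\<^sub>M ?B (\<lambda>_. lborel) \<partial>lborel)"
    proof -
      have "(\<Sum>b\<in>insert e ?B. (x(e := s)) b *\<^sub>R b) = s *\<^sub>R e + (\<Sum>b\<in>?B. x b *\<^sub>R b)" for x and s :: real
        unfolding sum.insert[OF fin e] using e by (intro arg_cong2[where f="(+)"] sum.cong) auto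
      then show ?thesis by (simp add: add.assoc)
    qed
    finally show ?thesis unfolding B using Cons.IH[OF l] by (simp add: a N)
  qed
qed

lemma iterated_integral_eq_lborel:
  fixes f :: "'a::euclidean_space \<Rightarrow> ennreal"
  assumes [measurable]: "f \<in> borel_measurable borel" and "is_frame l" "Basis \<subseteq> set (map snd l)"
  shows "iterated_integral l f 0 = (\<integral>\<^sup>+x. f x \<partial>lborel)"
proof -
  have B: "set (map snd l) - {0} = (Basis :: 'a set)"
    using assms(2,3) by (auto simp: is_frame_def nonzero_Basis)
  show ?thesis
    unfolding iterated_integral_eq_PiM[OF assms(1,2)] B
    by (subst lborel_eq, subst nn_integral_distr) auto
qed

text \<open>The integral of \<open>k1\<close> along a line in direction \<open>e1\<close> does not
  depend on the coordinate in that direction, so it is a factor omitting one variable; likewise for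
  the others. The cube of \<open>f^4\<close> is the product of four copies of \<open>f^3\<close>,
  one for each line bound. Reordering each frame so that its own direction is innermost turns the
  four factors into full integrals.\<close>

lemma Loomis_Whitney_frame:
  fixes f k1 k2 k3 k4 :: "'a::euclidean_space \<Rightarrow> ennreal"
  assumes [measurable]: "f \<in> borel_measurable borel" "k1 \<in> borel_measurable borel"
      "k2 \<in> borel_measurable borel" "k3 \<in> borel_measurable borel" "k4 \<in> borel_measurable borel"
    and fr: "is_frame [(M1, e1), (M2, e2), (M3, e3), (M4, e4)]" and B: "Basis \<subseteq> {e1, e2, e3, e4}"
    and k: "\<And>p x. f (p + x *\<^sub>R e1) ^ 3 \<le> (\<integral>\<^sup>+s. k1 (p + s *\<^sub>R e1) \<partial>M1)"
      "\<And>p x. f (p + x *\<^sub>R e2) ^ 3 \<le> (\<integral>\<^sup>+s. k2 (p + s *\<^sub>R e2) \<partial>M2)"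
      "\<And>p x. f (p + x *\<^sub>R e3) ^ 3 \<le> (\<integral>\<^sup>+s. k3 (p + s *\<^sub>R e3) \<partial>M3)"
      "\<And>p x. f (p + x *\<^sub>R e4) ^ 3 \<le> (\<integral>\<^sup>+s. k4 (p + s *\<^sub>R e4) \<partial>M4)"
  shows "(\<integral>\<^sup>+x. f x ^ 4 \<partial>lborel) ^ 3
    \<le> (\<integral>\<^sup>+x. k1 x \<partial>lborel) * (\<integral>\<^sup>+x. k2 x \<partial>lborel) * (\<integral>\<^sup>+x. k3 x \<partial>lborel) * (\<integral>\<^sup>+x. k4 x \<partial>lborel)"
proof -
  have fr': "is_frame [(M2, e2), (M3, e3), (M4, e4), (M1, e1)]"
    "is_frame [(M1, e1), (M3, e3), (M4, e4), (M2, e2)]"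
    "is_frame [(M1, e1), (M2, e2), (M4, e4), (M3, e3)]"
    using fr by (auto simp: is_frame_def split: if_splits)
  have M: "sets M1 = sets borel" "sets M2 = sets borel" "sets M3 = sets borel" "sets M4 = sets borel"
    "space M1 = UNIV" "space M2 = UNIV" "space M3 = UNIV" "space M4 = UNIV"
    "sigma_finite_measure M1" "sigma_finite_measure M2" "sigma_finite_measure M3" "sigma_finite_measure M4"
    using is_frame_Cons[OF fr] is_frame_Cons[OF fr'(1)] is_frame_Cons[OF fr'(1)[THEN is_frame_Cons, THEN conjunct1]]
      is_frame_Cons[OF fr'(1)[THEN is_frame_Cons, THEN conjunct1, THEN is_frame_Cons, THEN conjunct1]] by auto
  note [measurable_cong] = M(1-4)
  interpret M1: sigma_finite_measure M1 by fact
  interpret M2: sigma_finite_measure M2 by fact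
  interpret M3: sigma_finite_measure M3 by fact
  interpret M4: sigma_finite_measure M4 by fact
  have "(\<integral>\<^sup>+x. \<integral>\<^sup>+y. \<integral>\<^sup>+z. \<integral>\<^sup>+w. f (x *\<^sub>R e1 + y *\<^sub>R e2 + z *\<^sub>R e3 + w *\<^sub>R e4) ^ 4 \<partial>M4 \<partial>M3 \<partial>M2 \<partial>M1) ^ 3
    \<le> (\<integral>\<^sup>+y. \<integral>\<^sup>+z. \<integral>\<^sup>+w. \<integral>\<^sup>+s. k1 (y *\<^sub>R e2 + z *\<^sub>R e3 + w *\<^sub>R e4 + s *\<^sub>R e1) \<partial>M1 \<partial>M4 \<partial>M3 \<partial>M2)
    * (\<integral>\<^sup>+x. \<integral>\<^sup>+z. \<integral>\<^sup>+w. \<integral>\<^sup>+s. k2 (x *\<^sub>R e1 + z *\<^sub>R e3 + w *\<^sub>R e4 + s *\<^sub>R e2) \<partial>M2 \<partial>M4 \<partial>M3 \<partial>M1)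
    * (\<integral>\<^sup>+x. \<integral>\<^sup>+y. \<integral>\<^sup>+w. \<integral>\<^sup>+s. k3 (x *\<^sub>R e1 + y *\<^sub>R e2 + w *\<^sub>R e4 + s *\<^sub>R e3) \<partial>M3 \<partial>M4 \<partial>M2 \<partial>M1)
    * (\<integral>\<^sup>+x. \<integral>\<^sup>+y. \<integral>\<^sup>+z. \<integral>\<^sup>+s. k4 (x *\<^sub>R e1 + y *\<^sub>R e2 + z *\<^sub>R e3 + s *\<^sub>R e4) \<partial>M4 \<partial>M3 \<partial>M2 \<partial>M1)"
  proof (rule Loomis_Whitney_4)
    fix x y z w
    let ?p = "x *\<^sub>R e1 + y *\<^sub>R e2 + z *\<^sub>R e3 + w *\<^sub>R e4"
    have "(f ?p ^ 4) ^ 3 = f ?p ^ 3 * f ?p ^ 3 * f ?p ^ 3 * f ?p ^ 3"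
      by (simp add: power_mult[symmetric] power_add[symmetric])
    also have "\<dots> \<le> (\<integral>\<^sup>+s. k1 (y *\<^sub>R e2 + z *\<^sub>R e3 + w *\<^sub>R e4 + s *\<^sub>R e1) \<partial>M1)
      * (\<integral>\<^sup>+s. k2 (x *\<^sub>R e1 + z *\<^sub>R e3 + w *\<^sub>R e4 + s *\<^sub>R e2) \<partial>M2)
      * (\<integral>\<^sup>+s. k3 (x *\<^sub>R e1 + y *\<^sub>R e2 + w *\<^sub>R e4 + s *\<^sub>R e3) \<partial>M3)
      * (\<integral>\<^sup>+s. k4 (x *\<^sub>R e1 + y *\<^sub>R e2 + z *\<^sub>R e3 + s *\<^sub>R e4) \<partial>M4)"
      using k(1)[of "y *\<^sub>R e2 + z *\<^sub>R e3 + w *\<^sub>R e4" x] k(2)[of "x *\<^sub>R e1 + z *\<^sub>R e3 + w *\<^sub>R e4" y]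
        k(3)[of "x *\<^sub>R e1 + y *\<^sub>R e2 + w *\<^sub>R e4" z] k(4)[of "x *\<^sub>R e1 + y *\<^sub>R e2 + z *\<^sub>R e3" w]
      by (intro mult_mono) (simp_all add: ac_simps)
    finally show "(f ?p ^ 4) ^ 3 \<le> \<dots>" .
  qed (use M in \<open>simp_all\<close>)
  then have "iterated_integral [(M1, e1), (M2, e2), (M3, e3), (M4, e4)] (\<lambda>p. f p ^ 4) 0 ^ 3
      \<le> iterated_integral [(M2, e2), (M3, e3), (M4, e4), (M1, e1)] k1 0
      * iterated_integral [(M1, e1), (M3, e3), (M4, e4), (M2, e2)] k2 0
      * iterated_integral [(M1, e1), (M2, e2), (M4, e4), (M3, e3)] k3 0
      * iterated_integral [(M1, e1), (M2, e2), (M3, e3), (M4, e4)] k4 0"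
    by simp
  moreover have B': "Basis \<subseteq> set (map snd [(M1, e1), (M2, e2), (M3, e3), (M4, e4)])"
    "Basis \<subseteq> set (map snd [(M2, e2), (M3, e3), (M4, e4), (M1, e1)])"
    "Basis \<subseteq> set (map snd [(M1, e1), (M3, e3), (M4, e4), (M2, e2)])"
    "Basis \<subseteq> set (map snd [(M1, e1), (M2, e2), (M4, e4), (M3, e3)])"
    using B by auto
  have "(\<lambda>p. f p ^ 4) \<in> borel_measurable borel" by measurable
  note iterated_integral_eq_lborel[OF this fr B'(1)]
    iterated_integral_eq_lborel[OF assms(2) fr'(1) B'(2)] iterated_integral_eq_lborel[OF assms(3) fr'(2) B'(3)]
    iterated_integral_eq_lborel[OF assms(4) fr'(3) B'(4)] iterated_integral_eq_lborel[OF assms(5) fr B'(1)]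
  ultimately show ?thesis by (simp only:)
qed

lemma frame_exists:
  assumes "DIM('a::euclidean_space) \<le> 4"
  obtains M1 M2 M3 M4 and e1 e2 e3 e4 :: "'a::euclidean_space"
  where "is_frame [(M1, e1), (M2, e2), (M3, e3), (M4, e4)]" "Basis \<subseteq> {e1, e2, e3, e4}"
proof -
  obtain bs :: "'a list" where bs: "set bs = Basis" "distinct bs"
    using finite_distinct_list[OF finite_Basis] by blast
  have len: "length bs \<le> 4" using distinct_card[OF bs(2)] bs(1) assms by simp
  define l where "l = map (\<lambda>b. (lborel :: real measure, b)) bs @ replicate (4 - length bs) (unit_interval_measure, 0)"
  have snd_l: "map snd l = bs @ replicate (4 - length bs) 0" by (simp add: l_def comp_def)
  have "filter (\<lambda>e. e \<noteq> 0) bs = bs" using bs(1) nonzero_Basis by (auto simp: filter_id_conv)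
  then have "distinct (filter (\<lambda>e. e \<noteq> 0) (map snd l))"
    unfolding snd_l using bs(2) by simp
  moreover have "e \<in> Basis \<and> N = lborel \<or> e = 0 \<and> N = unit_interval_measure"
    if "(N, e) \<in> set l" for N e
    using that bs(1) unfolding l_def by auto
  ultimately have fr: "is_frame l" unfolding is_frame_def by blast
  have B: "Basis \<subseteq> set (map snd l)" unfolding snd_l using bs(1) by simp
  have "length l = 4" using len by (simp add: l_def)
  then obtain a b c d where "l = [a, b, c, d]"
    by (auto simp: eval_nat_numeral length_Suc_conv)
  then show ?thesis
    using fr B by (intro that[of "fst a" "snd a" "fst b" "snd b" "fst c" "snd c" "fst d" "snd d"]) auto
qed

section \<open>Test functions and the Sobolev inequality\<close>

lemma Ck_on_UNIV_differentiable: "\<forall>k. Ck_on k UNIV f \<Longrightarrow> f differentiable (at x)"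
  using Ck_on.simps(2)[of 0 UNIV f] by (auto simp: differentiable_on_def)

lemma partial_deriv_lincomb:
  assumes "f differentiable (at x)" "g differentiable (at x)"
  shows "partial_deriv i (\<lambda>x. a * f x + b * g x) x = a * partial_deriv i f x + b * partial_deriv i g x"
proof -
  have "((\<lambda>x. a * f x + b * g x) has_derivative
      (\<lambda>v. a * frechet_derivative f (at x) v + b * frechet_derivative g (at x) v)) (at x)"
    using assms by (intro has_derivative_add has_derivative_mult_right) (simp_all add: frechet_derivative_works)
  from frechet_derivative_at[OF this, symmetric] show ?thesis by (simp add: partial_deriv_def)
qed

lemma Ck_on_UNIV_lincomb:
  "Ck_on k UNIV f \<Longrightarrow> Ck_on k UNIV g \<Longrightarrow> Ck_on k UNIV (\<lambda>x. a * f x + b * g x)"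
proof (induction k arbitrary: f g)
  case 0
  then show ?case by (auto intro!: continuous_intros)
next
  case (Suc k)
  have d: "f differentiable (at x)" "g differentiable (at x)" for x
    using Suc.prems by (auto simp: differentiable_on_def)
  have "(\<lambda>x. a * f x + b * g x) differentiable_on UNIV"
    using Suc.prems by (auto intro!: differentiable_on_add differentiable_on_mult)
  moreover have "partial_deriv i (\<lambda>x. a * f x + b * g x) = (\<lambda>x. a * partial_deriv i f x + b * partial_deriv i g x)" for i
    by (intro ext partial_deriv_lincomb d)
  ultimately show ?case using Suc by auto
qed

lemma test_functionD:
  assumes "\<psi> \<in> test_functions \<Omega>"
  shows "\<psi> differentiable (at x)" "continuous_on UNIV \<psi>" "compact (closure {x. \<psi> x \<noteq> 0})"
    "closure {x. \<psi> x \<noteq> 0} \<subseteq> \<Omega>" "x \<notin> \<Omega> \<Longrightarrow> \<psi> x = 0"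
proof -
  show "\<psi> differentiable (at x)" using assms by (intro Ck_on_UNIV_differentiable) (simp add: test_functions_def)
  have "Ck_on 0 UNIV \<psi>" using assms unfolding test_functions_def by blast
  then show "continuous_on UNIV \<psi>" by simp
  show "compact (closure {x. \<psi> x \<noteq> 0})" "closure {x. \<psi> x \<noteq> 0} \<subseteq> \<Omega>"
    using assms by (auto simp: test_functions_def)
  then have "x \<in> \<Omega>" if "\<psi> x \<noteq> 0" for x
    using that closure_subset[of "{x. \<psi> x \<noteq> 0}"] by (meson mem_Collect_eq subsetD)
  then show "x \<notin> \<Omega> \<Longrightarrow> \<psi> x = 0" by blast
qed

lemma test_functions_lincomb:
  assumes "\<psi> \<in> test_functions \<Omega>" "\<zeta> \<in> test_functions \<Omega>"
  shows "(\<lambda>x. a * \<psi> x + b * \<zeta> x) \<in> test_functions \<Omega>"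
proof -
  let ?s = "\<lambda>f. closure {x. f x \<noteq> (0 :: real)}"
  have sub: "?s (\<lambda>x. a * \<psi> x + b * \<zeta> x) \<subseteq> ?s \<psi> \<union> ?s \<zeta>"
    unfolding closure_Un[symmetric] by (rule closure_mono) auto
  moreover have "compact (?s (\<lambda>x. a * \<psi> x + b * \<zeta> x))"
    using test_functionD(3)[OF assms(1)] test_functionD(3)[OF assms(2)]
      bounded_subset[OF _ sub] by (auto simp: compact_eq_bounded_closed)
  moreover have "Ck_on k UNIV (\<lambda>x. a * \<psi> x + b * \<zeta> x)" for k
    using assms by (intro Ck_on_UNIV_lincomb) (simp_all add: test_functions_def)
  ultimately show ?thesis
    using assms by (auto simp: test_functions_def)
qed

lemma test_functions_zero: "(\<lambda>_. 0) \<in> test_functions (\<Omega> :: (real^'n::finite) set)"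
proof -
  have "partial_deriv i (\<lambda>_ :: real^'n. 0) = (\<lambda>_. 0)" for i
    by (simp add: partial_deriv_def fun_eq_iff)
  then have "Ck_on k UNIV (\<lambda>_ :: real^'n. 0)" for k by (induction k) simp_all
  then show ?thesis by (simp add: test_functions_def)
qed

lemma test_functions_partial_deriv:
  assumes "\<psi> \<in> test_functions \<Omega>"
  shows "partial_deriv i \<psi> \<in> test_functions \<Omega>"
proof -
  let ?C = "closure {x. \<psi> x \<noteq> 0}"
  have "{x. partial_deriv i \<psi> x \<noteq> 0} \<subseteq> ?C"
  proof
    fix x assume x: "x \<in> {x. partial_deriv i \<psi> x \<noteq> 0}"
    show "x \<in> ?C"
    proof (rule ccontr)
      assume "x \<notin> ?C"
      have "(\<psi> has_derivative (\<lambda>_. 0)) (at x)"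
      proof (rule has_derivative_transform_within_open)
        show "((\<lambda>_. 0) has_derivative (\<lambda>_. 0)) (at x)" by simp
        show "open (- ?C)" "x \<in> - ?C" using \<open>x \<notin> ?C\<close> by auto
        show "0 = \<psi> y" if "y \<in> - ?C" for y using that closure_subset[of "{x. \<psi> x \<noteq> 0}"] by auto
      qed
      from frechet_derivative_at[OF this, symmetric] x show False by (simp add: partial_deriv_def)
    qed
  qed
  then have sub: "closure {x. partial_deriv i \<psi> x \<noteq> 0} \<subseteq> ?C" by (simp add: closure_minimal)
  moreover have "compact (closure {x. partial_deriv i \<psi> x \<noteq> 0})"
    using test_functionD(3)[OF assms] bounded_subset[OF _ sub] by (auto simp: compact_eq_bounded_closed)
  moreover have "Ck_on k UNIV (partial_deriv i \<psi>)" for k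
  proof -
    have "Ck_on (Suc k) UNIV \<psi>" using assms unfolding test_functions_def by blast
    then show ?thesis by simp
  qed
  ultimately show ?thesis using test_functionD(4)[OF assms] by (auto simp: test_functions_def)
qed

lemma test_function_bounded:
  assumes "\<psi> \<in> test_functions \<Omega>"
  shows "\<exists>B. \<forall>x. \<bar>\<psi> x\<bar> \<le> B"
proof -
  let ?C = "closure {x. \<psi> x \<noteq> 0}"
  have "compact (\<psi> ` ?C)"
    using test_functionD(2,3)[OF assms] by (intro compact_continuous_image) (auto intro: continuous_on_subset)
  then obtain B where B: "\<And>x. x \<in> ?C \<Longrightarrow> \<bar>\<psi> x\<bar> \<le> B"
    using compact_imp_bounded bounded_iff by (metis image_eqI real_norm_def)
  have "\<bar>\<psi> x\<bar> \<le> max B 0" for x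
    using B[of x] closure_subset[of "{x. \<psi> x \<noteq> 0}"] by (cases "\<psi> x = 0") auto
  then show ?thesis by blast
qed

lemma continuous_measurable_lebesgue_on:
  "continuous_on UNIV f \<Longrightarrow> f \<in> borel_measurable (lebesgue_on S)"
  for f :: "'a::euclidean_space \<Rightarrow> real"
  by (intro measurable_restrict_space1 measurable_completion) (simp add: borel_measurable_continuous_onI)

lemma nn_integral_lborel_vanishing:
  fixes f :: "real^'n \<Rightarrow> real"
  assumes "open \<Omega>" "\<And>x. x \<notin> \<Omega> \<Longrightarrow> f x = 0"
  shows "(\<integral>\<^sup>+x. ennreal (f x) \<partial>lborel) = (\<integral>\<^sup>+x. ennreal (f x) \<partial>lebesgue_on \<Omega>)"
proof -
  have "(\<integral>\<^sup>+x. ennreal (f x) \<partial>lebesgue_on \<Omega>) = (\<integral>\<^sup>+x. ennreal (f x) * indicator \<Omega> x \<partial>lebesgue)"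
    using assms(1) by (intro nn_integral_restrict_space) auto
  also have "\<dots> = (\<integral>\<^sup>+x. ennreal (f x) \<partial>lebesgue)"
    using assms(2) by (intro nn_integral_cong) (auto simp: indicator_def)
  finally show ?thesis by (simp add: nn_integral_completion)
qed

section \<open>The Gagliardo-Nirenberg estimate for test functions\<close>

text \<open>The fundamental theorem of calculus for the cube of \<open>\<psi>\<close> along a line,
  started at a point beyond the support. The power three is chosen so that the twelfth power needed
  for the L^4 norm splits into four such bounds.\<close>

lemma cube_le_nn_integral_derivative:
  fixes \<psi> :: "real^'n::finite \<Rightarrow> real"
  assumes \<psi>: "\<psi> \<in> test_functions \<Omega>"
  shows "ennreal \<bar>\<psi> (p + x *\<^sub>R axis i 1)\<bar> ^ 3
    \<le> (\<integral>\<^sup>+s. ennreal (3 * (\<psi> (p + s *\<^sub>R axis i 1))\<^sup>2 * \<bar>partial_deriv i \<psi> (p + s *\<^sub>R axis i 1)\<bar>) \<partial>lborel)"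
proof -
  define q where "q s = p + s *\<^sub>R axis i 1" for s :: real
  define g where "g s = \<psi> (q s) ^ 3" for s
  define g' where "g' s = 3 * (\<psi> (q s))\<^sup>2 * partial_deriv i \<psi> (q s)" for s
  have qd: "(q has_derivative (\<lambda>h. h *\<^sub>R axis i 1)) (at s)" for s
    unfolding q_def by (auto intro!: derivative_eq_intros)
  have "((\<lambda>s. \<psi> (q s)) has_real_derivative partial_deriv i \<psi> (q s)) (at s)" for s
  proof -
    have D: "(\<psi> has_derivative frechet_derivative \<psi> (at (q s))) (at (q s))"
      using test_functionD(1)[OF \<psi>] by (simp add: frechet_derivative_works)
    have "((\<lambda>s. \<psi> (q s)) has_derivative (\<lambda>h. frechet_derivative \<psi> (at (q s)) (h *\<^sub>R axis i 1))) (at s)"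
      using has_derivative_compose[OF qd D] .
    moreover have "frechet_derivative \<psi> (at (q s)) (h *\<^sub>R axis i 1) = partial_deriv i \<psi> (q s) * h" for h
      using linear_cmul[OF has_derivative_linear[OF D]] by (simp add: partial_deriv_def)
    ultimately show ?thesis by (simp only: has_field_derivative_def)
  qed
  then have g: "(g has_real_derivative g' s) (at s)" for s
    unfolding g_def g'_def by (auto intro!: derivative_eq_intros)
  have qc: "continuous_on UNIV q" unfolding q_def by (intro continuous_intros)
  have g'c: "continuous_on UNIV g'"
    unfolding g'_def
    by (intro continuous_intros continuous_on_compose2[OF test_functionD(2)[OF \<psi>] qc]
        continuous_on_compose2[OF test_functionD(2)[OF test_functions_partial_deriv[OF \<psi>]] qc]) auto
  obtain R where R: "\<And>y. \<psi> y \<noteq> 0 \<Longrightarrow> norm y \<le> R"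
    using compact_imp_bounded[OF test_functionD(3)[OF \<psi>]] closure_subset[of "{x. \<psi> x \<noteq> 0}"]
    by (auto simp: bounded_iff)
  \<comment> \<open>Far enough to the left that the point of the line has norm larger than
    \<open>R\<close>, where \<open>\<psi>\<close> vanishes; the minimum with \<open>x\<close> keeps
    the interval \<open>{L..x}\<close> well oriented.\<close>
  define L where "L = min x (- (\<bar>R\<bar> + norm p + 1))"
  have "norm (q L) \<ge> \<bar>L\<bar> - norm p"
    using norm_triangle_ineq2[of "L *\<^sub>R axis i (1::real)" "- p"] by (simp add: q_def norm_axis_1 add.commute)
  moreover have "\<bar>L\<bar> \<ge> \<bar>R\<bar> + norm p + 1" using norm_ge_zero[of p] unfolding L_def by linarith
  ultimately have "norm (q L) > R" by linarith
  then have "\<psi> (q L) = 0" using R[of "q L"] by force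
  then have gL: "g L = 0" by (simp add: g_def)
  have Lx: "L \<le> x" by (simp add: L_def)
  have F: "integrable lborel (\<lambda>s. indicator {L..x} s * g' s)" "(LBINT s. indicator {L..x} s * g' s) = g x - g L"
  proof -
    have c: "\<And>s. isCont g' s" using g'c by (simp add: continuous_on_eq_continuous_at)
    show "integrable lborel (\<lambda>s. indicator {L..x} s * g' s)"
      using borel_integrable_atLeastAtMost[of L x g'] c by (simp add: mult.commute)
    show "(LBINT s. indicator {L..x} s * g' s) = g x - g L"
      using integral_FTC_Icc_real[OF Lx g] c by (simp add: mult.commute)
  qed
  have "ennreal \<bar>\<psi> (q x)\<bar> ^ 3 = ennreal \<bar>g x\<bar>" by (simp add: g_def ennreal_power power_abs)
  also have "\<dots> \<le> (\<integral>\<^sup>+s. norm (indicator {L..x} s * g' s) \<partial>lborel)"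
    using integral_norm_bound_ennreal[OF F(1)] F(2) gL by simp
  also have "\<dots> \<le> (\<integral>\<^sup>+s. ennreal \<bar>g' s\<bar> \<partial>lborel)"
    by (intro nn_integral_mono ennreal_leI) (auto simp: indicator_def)
  finally show ?thesis by (simp add: g'_def q_def abs_mult)
qed

context dirichlet_domain
begin

lemma bounded_continuous_L2:
  assumes "continuous_on UNIV f" "\<And>x. \<bar>f x\<bar> \<le> B"
  shows "f \<in> L2 \<Omega>"
proof -
  interpret finite_measure M by (rule finite_measure_dom)
  have m: "f \<in> borel_measurable M" by (rule continuous_measurable_lebesgue_on[OF assms(1)])
  have "integrable M (\<lambda>x. (f x)\<^sup>2)"
  proof (rule integrable_const_bound[of _ "B\<^sup>2"])
    show "AE x in M. norm ((f x)\<^sup>2) \<le> B\<^sup>2"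
      using assms(2) by (intro AE_I2) (metis abs_ge_zero norm_power power2_abs power_mono real_norm_def)
  qed (use m in simp)
  then show ?thesis using m by (simp add: L2_def)
qed

lemma test_function_L2:
  assumes "\<psi> \<in> test_functions \<Omega>"
  shows "\<psi> \<in> L2 \<Omega>" "(\<lambda>x. (\<psi> x)\<^sup>2) \<in> L2 \<Omega>"
proof -
  obtain B where B: "\<And>x. \<bar>\<psi> x\<bar> \<le> B" using test_function_bounded[OF assms] by blast
  note c = test_functionD(2)[OF assms]
  show "\<psi> \<in> L2 \<Omega>" by (rule bounded_continuous_L2[OF c B])
  show "(\<lambda>x. (\<psi> x)\<^sup>2) \<in> L2 \<Omega>"
  proof (rule bounded_continuous_L2)
    show "continuous_on UNIV (\<lambda>x. (\<psi> x)\<^sup>2)" by (intro continuous_intros c)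
    show "\<bar>(\<psi> x)\<^sup>2\<bar> \<le> B\<^sup>2" for x
      using B[of x] by (metis abs_ge_zero abs_power2 power2_abs power_mono)
  qed
qed

text \<open>With \<open>P\<close> the integral of \<open>\<psi>\<^sup>4\<close> and \<open>R\<close> a bound for the norms of \<open>\<psi>\<close> and its gradient, the
  Loomis-Whitney inequality for \<open>\<psi>\<^sup>3\<close> gives \<open>P\<^sup>3 \<le> 81 (P\<^sup>1\<^sup>/\<^sup>2 R)\<^sup>4\<close>. A dummy direction contributes
  \<open>\<bar>\<psi>\<bar>\<^sup>3\<close> in place of a derivative.\<close>

lemma Sobolev_test_function:
  fixes R :: real
  assumes \<psi>: "\<psi> \<in> test_functions \<Omega>"
    and R: "L2_norm \<Omega> \<psi> \<le> R" "\<And>i. L2_norm \<Omega> (partial_deriv i \<psi>) \<le> R"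
  shows "(LINT x|M. (\<psi> x) ^ 4) \<le> 81 * R ^ 4"
proof -
  define P where "P = (LINT x|M. (\<psi> x) ^ 4)"
  note L2\<psi> = test_function_L2[OF \<psi>]
  have R0: "R \<ge> 0" using R(1) L2_norm_nonneg[of \<Omega> \<psi>] by linarith
  have P: "P = (L2_norm \<Omega> (\<lambda>x. (\<psi> x)\<^sup>2))\<^sup>2" "P \<ge> 0"
    by (simp_all add: P_def L2_norm_square_integral power_mult[symmetric])
  then have sqP: "L2_norm \<Omega> (\<lambda>x. (\<psi> x)\<^sup>2) = sqrt P" by (simp add: L2_norm_nonneg)
  have c\<psi>: "continuous_on UNIV \<psi>" by (rule test_functionD(2)[OF \<psi>])
  obtain M1 M2 M3 M4 and e1 e2 e3 e4 :: "real^'n" where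
    fr: "is_frame [(M1, e1), (M2, e2), (M3, e3), (M4, e4)]" "Basis \<subseteq> {e1, e2, e3, e4}"
    using frame_exists[where ?'a="real^'n"] dim by (metis DIM_cart DIM_real mult.right_neutral)
  define kk :: "real^'n \<Rightarrow> real^'n \<Rightarrow> real" where
    "kk e x = (if e = 0 then \<bar>\<psi> x\<bar> ^ 3 else 3 * (\<psi> x)\<^sup>2 * \<bar>frechet_derivative \<psi> (at x) e\<bar>)" for e x
  have kk: "(\<lambda>x. ennreal (kk e x)) \<in> borel_measurable borel \<and>
      (\<forall>p x. ennreal \<bar>\<psi> (p + x *\<^sub>R e)\<bar> ^ 3 \<le> (\<integral>\<^sup>+s. ennreal (kk e (p + s *\<^sub>R e)) \<partial>N)) \<and>
      (\<integral>\<^sup>+x. ennreal (kk e x) \<partial>lborel) \<le> ennreal (3 * sqrt P * R)"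
    if N: "e \<in> Basis \<and> N = lborel \<or> e = 0 \<and> N = unit_interval_measure" for N e
  proof -
    \<comment> \<open>Cauchy-Schwarz between the square of \<open>\<psi>\<close> and
      \<open>\<zeta>\<close>, for both kinds of direction at once: a dummy direction uses
      \<open>c = 1\<close> and \<open>\<zeta> = \<psi>\<close>, a genuine one uses
      \<open>c = 3\<close> and a partial derivative.\<close>
    have est: "(\<integral>\<^sup>+x. ennreal (c * (\<psi> x)\<^sup>2 * \<bar>\<zeta> x\<bar>) \<partial>lborel) \<le> ennreal (3 * sqrt P * R)"
      if \<zeta>: "\<zeta> \<in> test_functions \<Omega>" "L2_norm \<Omega> \<zeta> \<le> R" "0 \<le> c" "c \<le> 3" for \<zeta> c
    proof -
      have a: "(\<lambda>x. \<bar>\<zeta> x\<bar>) \<in> L2 \<Omega>"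
        using test_function_L2(1)[OF \<zeta>(1)] by (auto simp: L2_def intro: borel_measurable_abs)
      have i: "integrable M (\<lambda>x. c * ((\<psi> x)\<^sup>2 * \<bar>\<zeta> x\<bar>))"
        by (intro integrable_mult_right L2_mult_integrable L2\<psi> a)
      have "(\<integral>\<^sup>+x. ennreal (c * (\<psi> x)\<^sup>2 * \<bar>\<zeta> x\<bar>) \<partial>lborel) = (\<integral>\<^sup>+x. ennreal (c * ((\<psi> x)\<^sup>2 * \<bar>\<zeta> x\<bar>)) \<partial>M)"
        using test_functionD(5)[OF \<psi>] by (subst nn_integral_lborel_vanishing[OF open_dom]) (auto simp: mult.assoc)
      also have "\<dots> = ennreal (LINT x|M. c * ((\<psi> x)\<^sup>2 * \<bar>\<zeta> x\<bar>))"
        using \<zeta>(3) by (intro nn_integral_eq_integral i) auto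
      also have "(LINT x|M. c * ((\<psi> x)\<^sup>2 * \<bar>\<zeta> x\<bar>)) \<le> 3 * (sqrt P * R)"
      proof -
        have "L2_inner \<Omega> (\<lambda>x. (\<psi> x)\<^sup>2) (\<lambda>x. \<bar>\<zeta> x\<bar>) \<le> sqrt P * L2_norm \<Omega> (\<lambda>x. \<bar>\<zeta> x\<bar>)"
          using L2_Cauchy_Schwarz[OF L2\<psi>(2) a] sqP by simp
        also have "L2_norm \<Omega> (\<lambda>x. \<bar>\<zeta> x\<bar>) = L2_norm \<Omega> \<zeta>" by (simp add: L2_norm_def L2_inner_def)
        also have "sqrt P * L2_norm \<Omega> \<zeta> \<le> sqrt P * R" using \<zeta>(2) P(2) by (intro mult_left_mono) auto
        finally have "c * L2_inner \<Omega> (\<lambda>x. (\<psi> x)\<^sup>2) (\<lambda>x. \<bar>\<zeta> x\<bar>) \<le> c * (sqrt P * R)"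
          using \<zeta>(3) by (rule mult_left_mono)
        also have "\<dots> \<le> 3 * (sqrt P * R)" using \<zeta>(4) P(2) R0 by (intro mult_right_mono) auto
        finally show ?thesis by (simp add: L2_inner_def)
      qed
      finally show ?thesis by (simp add: ennreal_leI mult.assoc)
    qed
    show ?thesis
    proof (cases "e = 0")
      case True
      then have N: "N = unit_interval_measure" using that by auto
      have k: "kk e = (\<lambda>x. 1 * (\<psi> x)\<^sup>2 * \<bar>\<psi> x\<bar>)"
        by (simp add: kk_def True fun_eq_iff power2_eq_square power3_eq_cube)
      have "continuous_on UNIV (kk e)" unfolding k by (intro continuous_intros c\<psi>)
      then have "(\<lambda>x. ennreal (kk e x)) \<in> borel_measurable borel"
        by (intro measurable_compose[OF _ measurable_ennreal] borel_measurable_continuous_onI)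
      moreover have "ennreal \<bar>\<psi> p\<bar> ^ 3 \<le> ennreal (kk e p)" for p
        by (simp add: kk_def True ennreal_power)
      moreover have "(\<integral>\<^sup>+x. ennreal (kk e x) \<partial>lborel) \<le> ennreal (3 * sqrt P * R)"
        unfolding k by (rule est[OF \<psi> R(1)]) auto
      ultimately show ?thesis by (simp add: True N unit_interval_measure)
    next
      case False
      then have N: "N = lborel" and "e \<in> Basis" using that by auto
      then obtain i where i: "e = axis i 1" by (auto simp: Basis_vec_def)
      have k: "kk e = (\<lambda>x. 3 * (\<psi> x)\<^sup>2 * \<bar>partial_deriv i \<psi> x\<bar>)"
        using False by (simp add: kk_def fun_eq_iff partial_deriv_def i)
      note \<zeta> = test_functions_partial_deriv[OF \<psi>, of i]
      have "continuous_on UNIV (kk e)"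
        unfolding k by (intro continuous_intros c\<psi> test_functionD(2)[OF \<zeta>])
      then have "(\<lambda>x. ennreal (kk e x)) \<in> borel_measurable borel"
        by (intro measurable_compose[OF _ measurable_ennreal] borel_measurable_continuous_onI)
      moreover have "(\<integral>\<^sup>+x. ennreal (kk e x) \<partial>lborel) \<le> ennreal (3 * sqrt P * R)"
        unfolding k by (rule est[OF \<zeta> R(2)]) auto
      ultimately show ?thesis
        unfolding k N unfolding i using cube_le_nn_integral_derivative[OF \<psi>] by blast
    qed
  qed
  have fr': "e \<in> Basis \<and> N = lborel \<or> e = 0 \<and> N = unit_interval_measure"
    if "(N, e) \<in> {(M1, e1), (M2, e2), (M3, e3), (M4, e4)}" for N e
    using fr(1) that unfolding is_frame_def by auto
  note k = kk[OF fr'[of M1 e1]] kk[OF fr'[of M2 e2]] kk[OF fr'[of M3 e3]] kk[OF fr'[of M4 e4]]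
  let ?f = "\<lambda>x. ennreal \<bar>\<psi> x\<bar>"
  have fm: "?f \<in> borel_measurable borel"
    by (intro measurable_compose[OF _ measurable_ennreal] borel_measurable_continuous_onI continuous_intros c\<psi>)
  have "(\<integral>\<^sup>+x. ?f x ^ 4 \<partial>lborel) ^ 3
    \<le> (\<integral>\<^sup>+x. ennreal (kk e1 x) \<partial>lborel) * (\<integral>\<^sup>+x. ennreal (kk e2 x) \<partial>lborel)
      * (\<integral>\<^sup>+x. ennreal (kk e3 x) \<partial>lborel) * (\<integral>\<^sup>+x. ennreal (kk e4 x) \<partial>lborel)"
    using k by (intro Loomis_Whitney_frame[OF fm _ _ _ _ fr]) auto
  also have "\<dots> \<le> ennreal (3 * sqrt P * R) * ennreal (3 * sqrt P * R) * ennreal (3 * sqrt P * R) * ennreal (3 * sqrt P * R)"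
    using k by (intro mult_mono) auto
  also have "\<dots> = ennreal ((3 * sqrt P * R) ^ 4)"
    using P(2) R0 by (simp add: ennreal_mult[symmetric] power4_eq_xxxx mult.assoc)
  also have "(\<integral>\<^sup>+x. ?f x ^ 4 \<partial>lborel) = ennreal P"
  proof -
    have "(\<integral>\<^sup>+x. ?f x ^ 4 \<partial>lborel) = (\<integral>\<^sup>+x. ennreal ((\<psi> x) ^ 4) \<partial>lborel)"
      by (simp add: ennreal_power power_even_abs)
    also have "\<dots> = (\<integral>\<^sup>+x. ennreal ((\<psi> x) ^ 4) \<partial>M)"
      using test_functionD(5)[OF \<psi>] by (intro nn_integral_lborel_vanishing open_dom) auto
    also have "\<dots> = (\<integral>\<^sup>+x. ennreal (((\<psi> x)\<^sup>2)\<^sup>2) \<partial>M)" by (simp add: power_mult[symmetric])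
    also have "\<dots> = ennreal P" using nn_integral_L2_square[OF L2\<psi>(2)] P(1) by simp
    finally show ?thesis .
  qed
  finally have "P ^ 3 \<le> (3 * sqrt P * R) ^ 4"
    using P(2) R0 by (simp add: ennreal_power)
  also have "\<dots> = 81 * P\<^sup>2 * R ^ 4"
  proof -
    have "sqrt P ^ 4 = P\<^sup>2" using P(2) by (simp add: power4_eq_xxxx power2_eq_square)
    then show ?thesis by (simp add: power_mult_distrib)
  qed
  \<comment> \<open>\<open>P\<close> is finite because a test function is bounded, so its square can
    be cancelled. Other functions are reached only afterwards, by passing to limits in the resulting
    inequality.\<close>
  finally have "P\<^sup>2 * P \<le> P\<^sup>2 * (81 * R ^ 4)" by (simp add: power2_eq_square power3_eq_cube ac_simps)
  then have "P \<le> 81 * R ^ 4" using P(2) R0 by (cases "P = 0") auto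
  then show ?thesis by (simp add: P_def)
qed

end

section \<open>Weak gradients of functions of finite energy\<close>

lemma closed_subspace_sums:
  fixes f :: "nat \<Rightarrow> 'a::real_normed_vector"
  assumes S: "subspace S" "closed S" and a: "\<And>k. f k \<in> S" "f sums s"
  shows "s \<in> S"
proof -
  have "(\<Sum>k<n. f k) \<in> S" for n by (intro subspace_sum S(1) a(1))
  then show ?thesis by (rule closed_sequentially[OF S(2) _ a(2)[unfolded sums_def]])
qed

lemma subspace_closure:
  fixes S :: "'a::real_normed_vector set"
  assumes "subspace S"
  shows "subspace (closure S)"
  unfolding subspace_def
proof (intro conjI ballI allI)
  show "0 \<in> closure S" using subspace_0[OF assms] closure_subset by blast
next
  fix x y assume "x \<in> closure S" "y \<in> closure S"
  then obtain f g where "\<And>n. f n \<in> S" "f \<longlonglongrightarrow> x" "\<And>n. g n \<in> S" "g \<longlonglongrightarrow> y"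
    unfolding closure_sequential by blast
  then show "x + y \<in> closure S"
    unfolding closure_sequential
    by (intro exI[of _ "\<lambda>n. f n + g n"]) (auto intro: tendsto_add subspace_add assms)
next
  fix c :: real and x assume "x \<in> closure S"
  then obtain f where "\<And>n. f n \<in> S" "f \<longlonglongrightarrow> x" unfolding closure_sequential by blast
  then show "c *\<^sub>R x \<in> closure S"
    unfolding closure_sequential
    by (intro exI[of _ "\<lambda>n. c *\<^sub>R f n"]) (auto intro: tendsto_scaleR subspace_scale assms)
qed

context dirichlet_domain
begin

section \<open>Energy coordinates\<close>

abbreviation "D1 \<equiv> D_space \<Omega> \<theta> \<phi> 1"

definition dcoef :: "(real^'n \<Rightarrow> real) \<Rightarrow> l2" where
  "dcoef w = Abs_l2 (\<lambda>k. sqrt (\<theta> k) * nth_l2 (coef w) k)"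

lemma D1_iff: "w \<in> D1 \<longleftrightarrow> w \<in> L2 \<Omega> \<and> summable (\<lambda>k. (sqrt (\<theta> k) * nth_l2 (coef w) k)\<^sup>2)"
  using eigenvalue_pos by (auto simp: D_space_def nth_coef power_mult_distrib less_imp_le)

lemma D1_L2: "w \<in> D1 \<Longrightarrow> w \<in> L2 \<Omega>"
  by (simp add: D1_iff)

lemma nth_dcoef: "w \<in> D1 \<Longrightarrow> nth_l2 (dcoef w) k = sqrt (\<theta> k) * nth_l2 (coef w) k"
  by (simp add: dcoef_def D1_iff nth_l2_Abs)

lemma D_norm_eq: "w \<in> D1 \<Longrightarrow> D_norm \<Omega> \<theta> \<phi> 1 w = norm (dcoef w)"
  unfolding D_norm_def norm_l2_eq using eigenvalue_pos
  by (simp add: nth_dcoef nth_coef D1_L2 power_mult_distrib less_imp_le)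

lemma D1_lincomb:
  assumes "v \<in> D1" "w \<in> D1"
  shows "(\<lambda>x. a * v x + b * w x) \<in> D1" "dcoef (\<lambda>x. a * v x + b * w x) = a *\<^sub>R dcoef v + b *\<^sub>R dcoef w"
proof -
  have eq: "sqrt (\<theta> k) * nth_l2 (coef (\<lambda>x. a * v x + b * w x)) k = nth_l2 (a *\<^sub>R dcoef v + b *\<^sub>R dcoef w) k" for k
    using assms by (simp add: coef_lincomb D1_L2 nth_dcoef algebra_simps)
  show "(\<lambda>x. a * v x + b * w x) \<in> D1"
    unfolding D1_iff eq using assms by (simp add: L2_lincomb D1_L2 del: nth_l2_simps) (rule summable_nth_l2)
  then show "dcoef (\<lambda>x. a * v x + b * w x) = a *\<^sub>R dcoef v + b *\<^sub>R dcoef w"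
    by (intro l2_eqI) (simp only: nth_dcoef eq)
qed

lemma D1_diff:
  assumes "v \<in> D1" "w \<in> D1"
  shows "(\<lambda>x. v x - w x) \<in> D1" "dcoef (\<lambda>x. v x - w x) = dcoef v - dcoef w"
  using D1_lincomb[OF assms, of 1 "-1"] by simp_all

text \<open>The inclusion of the energy space into L^2, read in coordinates. Its boundedness, with
  constant \<open>1 / sqrt (\<theta> 0)\<close>, is the Poincare inequality.\<close>

definition emb :: "l2 \<Rightarrow> l2" where
  "emb = mult_l2 (\<lambda>k. 1 / sqrt (\<theta> k))"

definition dsynth :: "l2 \<Rightarrow> real^'n \<Rightarrow> real" where
  "dsynth a = synth (emb a)"

lemma emb_multiplier: "\<bar>1 / sqrt (\<theta> k)\<bar> \<le> 1 / sqrt (\<theta> 0)"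
  using eigenvalue_pos[of 0] eigenvalue_pos[of k] eigenvalue_mono[of k] by (simp add: frac_le)

lemma nth_emb: "nth_l2 (emb a) k = nth_l2 a k / sqrt (\<theta> k)"
  and norm_emb: "norm (emb a) \<le> 1 / sqrt (\<theta> 0) * norm a"
  and bounded_linear_emb: "bounded_linear emb"
  unfolding emb_def using mult_l2[OF emb_multiplier] by simp_all

lemma dsynth: "dsynth a \<in> D1" "dcoef (dsynth a) = a"
proof -
  have *: "sqrt (\<theta> k) * nth_l2 (coef (dsynth a)) k = nth_l2 a k" for k
    using eigenvalue_pos[of k] by (simp add: dsynth_def coef_synth nth_emb)
  show "dsynth a \<in> D1" by (simp add: D1_iff * summable_nth_l2) (simp add: dsynth_def synth_L2)
  then show "dcoef (dsynth a) = a" by (intro l2_eqI) (simp add: nth_dcoef *)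
qed

lemma emb_dcoef: "w \<in> D1 \<Longrightarrow> emb (dcoef w) = coef w"
proof (rule l2_eqI)
  fix k assume "w \<in> D1"
  then show "nth_l2 (emb (dcoef w)) k = nth_l2 (coef w) k"
    using eigenvalue_pos[of k] by (simp add: nth_emb nth_dcoef)
qed

lemma dcoef_eq_iff:
  assumes "v \<in> D1" "w \<in> D1"
  shows "dcoef v = dcoef w \<longleftrightarrow> (AE x in M. v x = w x)"
proof -
  have "dcoef v = dcoef w \<longleftrightarrow> coef v = coef w"
    using emb_dcoef assms by (metis dcoef_def)
  then show ?thesis using coef_eq_iff assms by (simp add: D1_L2)
qed

section \<open>The gradient in energy coordinates\<close>

definition gcoef :: "(real^'n \<Rightarrow> real^'n) \<Rightarrow> l2^'n" where
  "gcoef G = (\<chi> i. coef (\<lambda>x. G x $ i))"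

text \<open>Keeping a function and its gradient together as a pair lets both limits be taken along
  one sequence; the closure of this set takes over the role of \<open>H1_0\<close>.\<close>

definition test_graph :: "(l2 \<times> (l2^'n)) set" where
  "test_graph = (\<lambda>\<psi>. (coef \<psi>, gcoef (\<lambda>x. \<chi> i. partial_deriv i \<psi> x))) ` test_functions \<Omega>"

lemma gcoef_test: "gcoef (\<lambda>x. \<chi> i. partial_deriv i \<psi> x) = (\<chi> i. coef (partial_deriv i \<psi>))"
  by (simp add: gcoef_def)

lemma subspace_test_graph: "subspace test_graph"
proof -
  have pd: "partial_deriv i (\<lambda>x. a * \<psi> x + b * \<zeta> x) = (\<lambda>x. a * partial_deriv i \<psi> x + b * partial_deriv i \<zeta> x)"
    if "\<psi> \<in> test_functions \<Omega>" "\<zeta> \<in> test_functions \<Omega>" for \<psi> \<zeta> a b i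
    using that by (intro ext partial_deriv_lincomb) (auto dest: test_functionD(1))
  have comb: "a *\<^sub>R p + b *\<^sub>R q \<in> test_graph" if "p \<in> test_graph" "q \<in> test_graph" for p q a b
  proof -
    from that obtain \<psi> \<zeta> where t: "\<psi> \<in> test_functions \<Omega>" "\<zeta> \<in> test_functions \<Omega>"
      "p = (coef \<psi>, \<chi> i. coef (partial_deriv i \<psi>))" "q = (coef \<zeta>, \<chi> i. coef (partial_deriv i \<zeta>))"
      by (auto simp: test_graph_def gcoef_test)
    have "a *\<^sub>R p + b *\<^sub>R q = (coef (\<lambda>x. a * \<psi> x + b * \<zeta> x), \<chi> i. coef (partial_deriv i (\<lambda>x. a * \<psi> x + b * \<zeta> x)))"
      using t by (simp add: pd coef_lincomb test_function_L2 test_functions_partial_deriv vec_eq_iff)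
    then show ?thesis using test_functions_lincomb[OF t(1,2)] by (auto simp: test_graph_def gcoef_test)
  qed
  obtain p where "p \<in> test_graph" using test_functions_zero by (auto simp: test_graph_def)
  then have "0 \<in> test_graph" using comb[of p p 0 0] by simp
  then show ?thesis using comb[of _ _ 1 1] comb[of _ _ _ 0] by (auto simp: subspace_def)
qed

text \<open>The weak gradient is a choice, but \<open>H1_0\<close> demands convergence of the
  partial derivatives to this very representative, so membership in the closure is immediate once
  norms are read in coordinates.\<close>

lemma H1_0_in_closure:
  assumes w: "w \<in> H1_0 \<Omega>"
  shows "(coef w, gcoef (weak_grad \<Omega> w)) \<in> closure test_graph" "has_weak_grad \<Omega> w (weak_grad \<Omega> w)" "w \<in> L2 \<Omega>"
proof -
  show L: "w \<in> L2 \<Omega>" and wg: "has_weak_grad \<Omega> w (weak_grad \<Omega> w)"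
    using w someI_ex[of "has_weak_grad \<Omega> w"] unfolding weak_grad_def by (auto simp: H1_0_def H1_def)
  then have G: "(\<lambda>x. weak_grad \<Omega> w x $ i) \<in> L2 \<Omega>" for i by (simp add: has_weak_grad_def)
  obtain \<psi> where \<psi>: "\<And>n::nat. \<psi> n \<in> test_functions \<Omega>"
    "(\<lambda>n. L2_norm \<Omega> (\<lambda>x. \<psi> n x - w x)) \<longlonglongrightarrow> 0"
    "\<And>i. (\<lambda>n. L2_norm \<Omega> (\<lambda>x. partial_deriv i (\<psi> n) x - weak_grad \<Omega> w x $ i)) \<longlonglongrightarrow> 0"
    using w by (auto simp: H1_0_def)
  have lim: "(\<lambda>n. coef (f n)) \<longlonglongrightarrow> coef g"
    if "(\<lambda>n. L2_norm \<Omega> (\<lambda>x. f n x - g x)) \<longlonglongrightarrow> 0" "\<And>n. f n \<in> L2 \<Omega>" "g \<in> L2 \<Omega>" for f g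
  proof (rule LIM_zero_cancel[OF tendsto_norm_zero_cancel])
    have "L2_norm \<Omega> (\<lambda>x. f n x - g x) = norm (coef (f n) - coef g)" for n
      using that(2,3) norm_coef[OF L2_diff[OF that(2)[of n] that(3)]] by (simp add: coef_diff)
    then show "(\<lambda>n. norm (coef (f n) - coef g)) \<longlonglongrightarrow> 0" using that(1) by simp
  qed
  have "(\<lambda>n. (coef (\<psi> n), gcoef (\<lambda>x. \<chi> i. partial_deriv i (\<psi> n) x))) \<longlonglongrightarrow> (coef w, gcoef (weak_grad \<Omega> w))"
    unfolding gcoef_def vec_lambda_beta
    by (intro tendsto_Pair tendsto_vec_lambda lim \<psi> L G test_function_L2(1) test_functions_partial_deriv)
  moreover have "(coef (\<psi> n), gcoef (\<lambda>x. \<chi> i. partial_deriv i (\<psi> n) x)) \<in> test_graph" for n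
    using \<psi>(1) by (auto simp: test_graph_def)
  ultimately show "(coef w, gcoef (weak_grad \<Omega> w)) \<in> closure test_graph"
    unfolding closure_sequential
    by (intro exI[of _ "\<lambda>n. (coef (\<psi> n), gcoef (\<lambda>x. \<chi> i. partial_deriv i (\<psi> n) x))"]) auto
qed

lemma eigenfunction_H1_0: "\<phi> k \<in> H1_0 \<Omega>"
  using eigenfunction by (simp add: dirichlet_eigenfunction_def)

lemma coef_eigenfunction: "coef (\<phi> k) = unit_l2 k"
  by (rule l2_eqI) (simp add: nth_coef eigenfunction_L2 orthonormal)

text \<open>Each eigenfunction is a limit of test functions, so the test functions are dense in
  \<open>L\<^sup>2\<close> and weak gradients are unique; no mollification is needed.\<close>

lemma test_functions_dense: "closure (coef ` test_functions \<Omega>) = UNIV"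
proof -
  let ?T = "closure (coef ` test_functions \<Omega>)"
  have eq: "coef ` test_functions \<Omega> = fst ` test_graph" by (auto simp: test_graph_def image_image)
  have "linear (fst :: l2 \<times> (l2^'n) \<Rightarrow> l2)" by (rule linear_fst)
  then have "subspace (coef ` test_functions \<Omega>)"
    unfolding eq by (rule linear_subspace_image[OF _ subspace_test_graph])
  then have sub: "subspace ?T" by (rule subspace_closure)
  have "unit_l2 k \<in> ?T" for k
  proof -
    have "fst ` closure test_graph \<subseteq> ?T"
      unfolding eq by (rule image_closure_subset) (auto intro: continuous_intros simp: closure_subset)
    then show ?thesis using H1_0_in_closure(1)[OF eigenfunction_H1_0, of k] coef_eigenfunction by force
  qed
  then have "nth_l2 a k *\<^sub>R unit_l2 k \<in> ?T" for a k using subspace_scale[OF sub] by simp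
  from closed_subspace_sums[OF sub closed_closure this sums_unit_l2] have "a \<in> ?T" for a .
  then show ?thesis by blast
qed

lemma has_weak_grad_iff:
  assumes "w \<in> L2 \<Omega>"
  shows "has_weak_grad \<Omega> w G \<longleftrightarrow> (\<forall>i. (\<lambda>x. G x $ i) \<in> L2 \<Omega> \<and>
    (\<forall>\<psi>\<in>test_functions \<Omega>. inner (coef w) (coef (partial_deriv i \<psi>)) = - inner (gcoef G $ i) (coef \<psi>)))"
  using assms by (auto simp: has_weak_grad_def gcoef_def inner_coef test_function_L2 test_functions_partial_deriv)

text \<open>The difference of two weak gradients is orthogonal to all test functions, which are
  dense. Consequently the arbitrary choice in \<open>weak_grad\<close> becomes invisible in
  coordinates.\<close>

lemma weak_grad_unique:
  assumes "w \<in> L2 \<Omega>" "w' \<in> L2 \<Omega>" "coef w = coef w'" "has_weak_grad \<Omega> w G" "has_weak_grad \<Omega> w' G'"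
  shows "gcoef G = gcoef G'"
proof -
  have "gcoef G $ i - gcoef G' $ i = 0" for i
  proof -
    let ?d = "gcoef G $ i - gcoef G' $ i"
    have 0: "inner ?d (coef \<psi>) = 0" if "\<psi> \<in> test_functions \<Omega>" for \<psi>
      using assms that by (simp add: has_weak_grad_iff inner_diff_left)
    have "closure (coef ` test_functions \<Omega>) \<subseteq> {b. inner ?d b = 0}"
    proof (rule closure_minimal)
      show "closed {b. inner ?d b = 0}" by (intro closed_Collect_eq continuous_intros)
    qed (use 0 in auto)
    then have "?d \<in> {b. inner ?d b = 0}" unfolding test_functions_dense by (rule subsetD) (rule UNIV_I)
    then show ?thesis by simp
  qed
  then show ?thesis by (simp add: vec_eq_iff)
qed

definition ngrad :: "nat \<Rightarrow> l2^'n" where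
  "ngrad k = (1 / sqrt (\<theta> k)) *\<^sub>R gcoef (weak_grad \<Omega> (\<phi> k))"

text \<open>The weak eigenvalue equation for \<open>\<phi> j\<close>, tested with
  \<open>\<phi> k\<close>, says that the gradients have inner product \<open>\<theta> j\<close>
  times the L^2 inner product; the normalisation removes the eigenvalue.\<close>

lemma ngrad_orthonormal: "inner (ngrad j) (ngrad k) = (if j = k then 1 else 0)"
proof -
  let ?G = "\<lambda>k x. weak_grad \<Omega> (\<phi> k) x"
  have G: "(\<lambda>x. ?G k x $ i) \<in> L2 \<Omega>" for k i
    using H1_0_in_closure(2)[OF eigenfunction_H1_0] by (simp add: has_weak_grad_def)
  have "inner (gcoef (?G j)) (gcoef (?G k)) = (\<Sum>i\<in>UNIV. L2_inner \<Omega> (\<lambda>x. ?G j x $ i) (\<lambda>x. ?G k x $ i))"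
    by (simp add: inner_vec_def gcoef_def inner_coef G)
  also have "\<dots> = (LINT x|M. ?G j x \<bullet> ?G k x)"
    unfolding L2_inner_def inner_vec_def by (subst Bochner_Integration.integral_sum) (auto intro!: L2_mult_integrable G)
  also have "\<dots> = \<theta> j * (if j = k then 1 else 0)"
    using eigenfunction[of j] eigenfunction_H1_0[of k] orthonormal[of j k] by (simp add: dirichlet_eigenfunction_def)
  finally show ?thesis
    using eigenvalue_pos[of j] by (auto simp: ngrad_def real_sqrt_mult[symmetric] simp flip: power2_eq_square)
qed

text \<open>The unit vector \<open>unit_l2 k\<close> of energy coordinates stands for
  \<open>\<phi> k / sqrt (\<theta> k)\<close>, whose gradient is \<open>ngrad k\<close>.
  Orthonormality makes the linear extension by a series converge.\<close>

definition Grad :: "l2 \<Rightarrow> l2^'n" where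
  "Grad a = (\<Sum>k. nth_l2 a k *\<^sub>R ngrad k)"

lemma Grad_sums: "(\<lambda>k. nth_l2 a k *\<^sub>R ngrad k) sums Grad a"
  and norm_Grad: "norm (Grad a) \<le> norm a"
  using orthonormal_series[OF ngrad_orthonormal, of a] by (auto simp: Grad_def summable_sums)

lemma bounded_linear_Grad: "bounded_linear Grad"
proof (rule bounded_linear_intro)
  show "Grad (a + b) = Grad a + Grad b" for a b
    using sums_add[OF Grad_sums[of a] Grad_sums[of b]] Grad_sums[of "a + b"]
    by (simp add: scaleR_left_distrib sums_unique2)
  show "Grad (r *\<^sub>R a) = r *\<^sub>R Grad a" for r a
    using sums_scaleR_right[OF Grad_sums[of a], of r] Grad_sums[of "r *\<^sub>R a"] by (simp add: sums_unique2)
  show "norm (Grad a) \<le> norm a * 1" for a using norm_Grad by simp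
qed

lemma emb_sums: "(\<lambda>k. nth_l2 a k *\<^sub>R emb (unit_l2 k)) sums emb a"
  using bounded_linear.sums[OF bounded_linear_emb sums_unit_l2[of a]]
  by (simp add: linear_cmul[OF bounded_linear.linear[OF bounded_linear_emb]])

lemma emb_unit: "emb (unit_l2 k) = (1 / sqrt (\<theta> k)) *\<^sub>R coef (\<phi> k)"
  by (rule l2_eqI) (simp add: nth_emb coef_eigenfunction)

text \<open>The closure is a closed subspace containing the pair of each eigenfunction and its
  gradient, hence all convergent series of such pairs. Thus every element of the energy space is a
  limit of test functions together with their gradients.\<close>

lemma emb_Grad_in_closure: "(emb a, Grad a) \<in> closure test_graph"
proof -
  have sub: "subspace (closure test_graph)" by (rule subspace_closure[OF subspace_test_graph])
  have s: "(\<lambda>k. (nth_l2 a k *\<^sub>R emb (unit_l2 k), nth_l2 a k *\<^sub>R ngrad k)) sums (emb a, Grad a)"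
    using tendsto_Pair[OF emb_sums[unfolded sums_def] Grad_sums[unfolded sums_def]]
    by (simp add: sums_def sum_prod)
  have "(nth_l2 a k *\<^sub>R emb (unit_l2 k), nth_l2 a k *\<^sub>R ngrad k) \<in> closure test_graph" for k
  proof -
    have "(nth_l2 a k / sqrt (\<theta> k)) *\<^sub>R (coef (\<phi> k), gcoef (weak_grad \<Omega> (\<phi> k))) \<in> closure test_graph"
      by (intro subspace_scale sub H1_0_in_closure(1) eigenfunction_H1_0)
    then show ?thesis by (simp add: emb_unit ngrad_def)
  qed
  from closed_subspace_sums[OF sub closed_closure this s] show ?thesis .
qed

lemma Grad_weak:
  assumes "\<psi> \<in> test_functions \<Omega>"
  shows "inner (emb a) (coef (partial_deriv i \<psi>)) = - inner (Grad a $ i) (coef \<psi>)"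
proof -
  have "(\<lambda>k. inner (nth_l2 a k *\<^sub>R emb (unit_l2 k)) (coef (partial_deriv i \<psi>))) sums inner (emb a) (coef (partial_deriv i \<psi>))"
    by (rule bounded_linear.sums[OF bounded_linear_inner_left emb_sums])
  moreover have "(\<lambda>k. - inner ((nth_l2 a k *\<^sub>R ngrad k) $ i) (coef \<psi>)) sums - inner (Grad a $ i) (coef \<psi>)"
    by (intro sums_minus bounded_linear.sums[OF bounded_linear_inner_left]
        bounded_linear.sums[OF bounded_linear_vec_nth] Grad_sums)
  moreover have "inner (nth_l2 a k *\<^sub>R emb (unit_l2 k)) (coef (partial_deriv i \<psi>)) = - inner ((nth_l2 a k *\<^sub>R ngrad k) $ i) (coef \<psi>)" for k
  proof -
    have "inner (coef (\<phi> k)) (coef (partial_deriv i \<psi>)) = - inner (gcoef (weak_grad \<Omega> (\<phi> k)) $ i) (coef \<psi>)"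
      using H1_0_in_closure(2)[OF eigenfunction_H1_0, of k] assms by (simp add: has_weak_grad_iff eigenfunction_L2)
    then show ?thesis by (simp add: emb_unit ngrad_def)
  qed
  ultimately show ?thesis by (simp add: sums_unique2)
qed

text \<open>Synthesising the components of \<open>Grad\<close> exhibits one weak gradient, so the
  choice in \<open>weak_grad\<close> is legitimate; uniqueness then transfers the coordinates to the
  chosen one.\<close>

lemma weak_grad_D1:
  assumes w: "w \<in> D1"
  shows "(\<lambda>x. weak_grad \<Omega> w x $ i) \<in> L2 \<Omega>" "coef (\<lambda>x. weak_grad \<Omega> w x $ i) = Grad (dcoef w) $ i"
proof -
  define G where "G x = (\<chi> i. synth (Grad (dcoef w) $ i) x)" for x
  have gG: "gcoef G = Grad (dcoef w)" by (simp add: gcoef_def G_def coef_synth vec_eq_iff)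
  have G: "has_weak_grad \<Omega> w G"
    unfolding has_weak_grad_iff[OF D1_L2[OF w]] gG emb_dcoef[OF w, symmetric]
    using Grad_weak by (simp add: G_def synth_L2)
  then have wG: "has_weak_grad \<Omega> w (weak_grad \<Omega> w)"
    using someI[of "has_weak_grad \<Omega> w" G] by (simp add: weak_grad_def)
  have "gcoef (weak_grad \<Omega> w) = Grad (dcoef w)"
    using weak_grad_unique[OF D1_L2[OF w] D1_L2[OF w] refl wG G] gG by (rule trans)
  moreover have "\<forall>i. (\<lambda>x. weak_grad \<Omega> w x $ i) \<in> L2 \<Omega>"
    using wG by (simp add: has_weak_grad_def)
  ultimately show "(\<lambda>x. weak_grad \<Omega> w x $ i) \<in> L2 \<Omega>" "coef (\<lambda>x. weak_grad \<Omega> w x $ i) = Grad (dcoef w) $ i"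
    by (auto simp: gcoef_def vec_eq_iff)
qed

end

section \<open>The nonlinearity\<close>

context dirichlet_domain
begin

section \<open>The Sobolev inequality on the energy space\<close>

lemma L2_tendsto_AE_subseq:
  assumes f: "\<And>n. f n \<in> L2 \<Omega>" "g \<in> L2 \<Omega>" and lim: "(\<lambda>n. coef (f n)) \<longlonglongrightarrow> coef g"
  shows "\<exists>r::nat\<Rightarrow>nat. strict_mono r \<and> (AE x in M. (\<lambda>n. f (r n) x) \<longlonglongrightarrow> g x)"
proof -
  have D: "(\<lambda>x. f n x - g x) \<in> L2 \<Omega>" for n by (intro L2_diff f)
  have "(\<lambda>n. LINT x|M. norm (f n x - g x)) \<longlonglongrightarrow> 0"
  proof (rule Lim_null_comparison)
    have "(\<lambda>n. norm (coef (f n) - coef g) * sqrt (measure M \<Omega>)) \<longlonglongrightarrow> 0 * sqrt (measure M \<Omega>)"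
      by (intro tendsto_mult tendsto_const tendsto_norm_zero LIM_zero lim)
    then show "(\<lambda>n. norm (coef (f n) - coef g) * sqrt (measure M \<Omega>)) \<longlonglongrightarrow> 0" by simp
    have "(LINT x|M. norm (f n x - g x)) \<le> norm (coef (f n) - coef g) * sqrt (measure M \<Omega>)" for n
      using L2_integrable(2)[OF D[of n]] norm_coef[OF D[of n]] coef_diff[OF f(1)[of n] f(2)] by simp
    then show "\<forall>\<^sub>F n in sequentially. norm (LINT x|M. norm (f n x - g x)) \<le> norm (coef (f n) - coef g) * sqrt (measure M \<Omega>)"
      by simp
  qed
  from tendsto_L1_AE_subseq[OF L2_integrable(1)[OF D] this]
  obtain r where r: "strict_mono r" "AE x in M. (\<lambda>n. f (r n) x - g x) \<longlonglongrightarrow> 0" by blast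
  from r(2) have "AE x in M. (\<lambda>n. f (r n) x) \<longlonglongrightarrow> g x" by eventually_elim (rule LIM_zero_cancel)
  with r(1) show ?thesis by blast
qed

text \<open>The approximating test functions converge in L^2 only, so their fourth powers are
  controlled along an almost everywhere convergent subsequence and Fatou carries the bound over. The
  constant 9 is the square root of 81.\<close>

lemma Sobolev:
  assumes f: "f \<in> L2 \<Omega>" and cl: "(coef f, g) \<in> closure test_graph"
  shows "(\<lambda>x. (f x)\<^sup>2) \<in> L2 \<Omega>" "L2_norm \<Omega> (\<lambda>x. (f x)\<^sup>2) \<le> 9 * (norm (coef f, g))\<^sup>2"
proof -
  obtain X where X: "\<And>n. X n \<in> test_graph" "X \<longlonglongrightarrow> (coef f, g)"
    using cl unfolding closure_sequential by blast
  then obtain \<psi> where \<psi>: "\<And>n. \<psi> n \<in> test_functions \<Omega>"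
    "\<And>n. X n = (coef (\<psi> n), \<chi> i. coef (partial_deriv i (\<psi> n)))"
    unfolding test_graph_def gcoef_test image_iff by metis
  have b: "(LINT x|M. (\<psi> n x) ^ 4) \<le> 81 * norm (X n) ^ 4" for n
  proof (rule Sobolev_test_function[OF \<psi>(1)])
    have "L2_norm \<Omega> (\<psi> n) = norm (fst (X n))" by (simp add: \<psi>(2) norm_coef test_function_L2(1)[OF \<psi>(1)])
    then show "L2_norm \<Omega> (\<psi> n) \<le> norm (X n)"
      using norm_fst_le[of "fst (X n)" "snd (X n)"] by simp
    fix i
    have "L2_norm \<Omega> (partial_deriv i (\<psi> n)) = norm (snd (X n) $ i)"
      by (simp add: \<psi>(2) norm_coef test_function_L2(1)[OF test_functions_partial_deriv[OF \<psi>(1)]])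
    also have "\<dots> \<le> norm (snd (X n))" by (rule Finite_Cartesian_Product.norm_nth_le)
    also have "\<dots> \<le> norm (X n)" using norm_snd_le[of "snd (X n)" "fst (X n)"] by simp
    finally show "L2_norm \<Omega> (partial_deriv i (\<psi> n)) \<le> norm (X n)" .
  qed
  have "(\<lambda>n. coef (\<psi> n)) \<longlonglongrightarrow> coef f" using tendsto_fst[OF X(2)] by (simp add: \<psi>(2))
  from L2_tendsto_AE_subseq[OF test_function_L2(1)[OF \<psi>(1)] f this]
  obtain r where r: "strict_mono r" "AE x in M. (\<lambda>n. \<psi> (r n) x) \<longlonglongrightarrow> f x" by blast
  have l: "AE x in M. (\<lambda>n. \<psi> (r n) x ^ 4) \<longlonglongrightarrow> f x ^ 4"
    using r(2) by eventually_elim (intro tendsto_power)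
  have i: "integrable M (\<lambda>x. \<psi> (r n) x ^ 4)" for n
    using L2_square_integrable[OF test_function_L2(2)[OF \<psi>(1)[of "r n"]]] by (simp add: power_mult[symmetric])
  have m: "(\<lambda>x. f x ^ 4) \<in> borel_measurable M" using L2_measurable[OF f] by simp
  have lb: "(\<lambda>n. 81 * norm (X (r n)) ^ 4) \<longlonglongrightarrow> 81 * norm (coef f, g) ^ 4"
    using LIMSEQ_subseq_LIMSEQ[OF X(2) r(1)] by (intro tendsto_intros) (simp add: comp_def)
  note F = Fatou_real[where q'="\<lambda>n x. \<psi> (r n) x ^ 4", OF i _ l m b lb]
  show L: "(\<lambda>x. (f x)\<^sup>2) \<in> L2 \<Omega>"
    using F(1) L2_measurable[OF f] by (simp add: L2_def power_mult[symmetric])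
  have "(L2_norm \<Omega> (\<lambda>x. (f x)\<^sup>2))\<^sup>2 \<le> (9 * (norm (coef f, g))\<^sup>2)\<^sup>2"
    using F(2) by (simp add: L2_norm_square_integral power_mult[symmetric] power_mult_distrib)
  then show "L2_norm \<Omega> (\<lambda>x. (f x)\<^sup>2) \<le> 9 * (norm (coef f, g))\<^sup>2"
    by (rule power2_le_imp_le) simp
qed

text \<open>The 9 comes from the bound on the graph closure;
  \<open>1 / sqrt (\<theta> 0) + 1\<close> bounds the norm of a function paired with its gradient by
  its energy norm.\<close>

definition sob :: real where
  "sob = 9 * (1 / sqrt (\<theta> 0) + 1)\<^sup>2"

lemma sob_nonneg: "0 \<le> sob" by (simp add: sob_def)

lemma D1_square:
  assumes w: "w \<in> D1"
  shows "(\<lambda>x. (w x)\<^sup>2) \<in> L2 \<Omega>" "L2_norm \<Omega> (\<lambda>x. (w x)\<^sup>2) \<le> sob * (norm (dcoef w))\<^sup>2"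
proof -
  have cl: "(coef w, Grad (dcoef w)) \<in> closure test_graph"
    using emb_Grad_in_closure[of "dcoef w"] by (simp add: emb_dcoef[OF w])
  have "norm (coef w, Grad (dcoef w)) \<le> norm (coef w) + norm (Grad (dcoef w))"
    by (rule norm_Pair_le)
  also have "\<dots> \<le> (1 / sqrt (\<theta> 0) + 1) * norm (dcoef w)"
    using norm_emb[of "dcoef w"] norm_Grad[of "dcoef w"] by (simp add: emb_dcoef[OF w] distrib_right)
  finally have "(norm (coef w, Grad (dcoef w)))\<^sup>2 \<le> ((1 / sqrt (\<theta> 0) + 1) * norm (dcoef w))\<^sup>2"
    by (intro power_mono) auto
  then show "L2_norm \<Omega> (\<lambda>x. (w x)\<^sup>2) \<le> sob * (norm (dcoef w))\<^sup>2"
    using Sobolev(2)[OF D1_L2[OF w] cl] by (simp add: sob_def power_mult_distrib)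
  show "(\<lambda>x. (w x)\<^sup>2) \<in> L2 \<Omega>" by (rule Sobolev(1)[OF D1_L2[OF w] cl])
qed

lemma D1_mult:
  assumes v: "v \<in> D1" and w: "w \<in> D1"
  shows "(\<lambda>x. v x * w x) \<in> L2 \<Omega>" "L2_norm \<Omega> (\<lambda>x. v x * w x) \<le> sob * norm (dcoef v) * norm (dcoef w)"
proof -
  show L: "(\<lambda>x. v x * w x) \<in> L2 \<Omega>"
    using L2_mult_integrable[OF D1_square(1)[OF v] D1_square(1)[OF w]]
      L2_measurable[OF D1_L2[OF v]] L2_measurable[OF D1_L2[OF w]]
    by (simp add: L2_def power_mult_distrib)
  have "(L2_norm \<Omega> (\<lambda>x. v x * w x))\<^sup>2 = L2_inner \<Omega> (\<lambda>x. (v x)\<^sup>2) (\<lambda>x. (w x)\<^sup>2)"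
    by (simp add: L2_norm_square_integral L2_inner_def power_mult_distrib)
  also have "\<dots> \<le> L2_norm \<Omega> (\<lambda>x. (v x)\<^sup>2) * L2_norm \<Omega> (\<lambda>x. (w x)\<^sup>2)"
    using L2_Cauchy_Schwarz[OF D1_square(1)[OF v] D1_square(1)[OF w]] by simp
  also have "\<dots> \<le> (sob * (norm (dcoef v))\<^sup>2) * (sob * (norm (dcoef w))\<^sup>2)"
    by (intro mult_mono D1_square v w L2_norm_nonneg mult_nonneg_nonneg sob_nonneg) auto
  also have "\<dots> = (sob * norm (dcoef v) * norm (dcoef w))\<^sup>2"
    by (simp add: power2_eq_square)
  finally show "L2_norm \<Omega> (\<lambda>x. v x * w x) \<le> sob * norm (dcoef v) * norm (dcoef w)"
    by (rule power2_le_imp_le) (simp add: sob_nonneg)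
qed

text \<open>The square is taken on a chosen representative; \<open>sq_dcoef\<close> shows that the
  choice does not matter.\<close>

definition sq :: "l2 \<Rightarrow> l2" where
  "sq a = coef (\<lambda>x. (dsynth a x)\<^sup>2)"

lemma sq_dcoef:
  assumes w: "w \<in> D1"
  shows "coef (\<lambda>x. (w x)\<^sup>2) = sq (dcoef w)"
proof -
  have "AE x in M. dsynth (dcoef w) x = w x"
    using dcoef_eq_iff[OF dsynth(1) w] dsynth(2) by blast
  then have "AE x in M. (w x)\<^sup>2 = (dsynth (dcoef w) x)\<^sup>2" by eventually_elim simp
  then show ?thesis
    unfolding sq_def using coef_eq_iff[OF D1_square(1)[OF w] D1_square(1)[OF dsynth(1)]] by blast
qed

text \<open>The factorisation of a difference of squares into difference times sum, followed by the
  L^4 bound for both factors; this is what makes the quadratic term locally Lipschitz.\<close>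

lemma norm_sq_diff: "norm (sq a - sq b) \<le> sob * norm (a - b) * norm (a + b)"
proof -
  let ?d = "\<lambda>x. 1 * dsynth a x + (-1) * dsynth b x" and ?s = "\<lambda>x. 1 * dsynth a x + 1 * dsynth b x"
  have d: "?d \<in> D1" "dcoef ?d = a - b" and s: "?s \<in> D1" "dcoef ?s = a + b"
    using D1_lincomb[OF dsynth(1) dsynth(1), of 1 a "-1" b] D1_lincomb[OF dsynth(1) dsynth(1), of 1 a 1 b]
    by (simp_all only: dsynth(2)) simp_all
  have "sq a - sq b = coef (\<lambda>x. ?d x * ?s x)"
    unfolding sq_def coef_diff[OF D1_square(1)[OF dsynth(1)] D1_square(1)[OF dsynth(1)], symmetric]
    by (rule arg_cong[where f=coef]) (simp add: fun_eq_iff power2_eq_square algebra_simps)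
  then show ?thesis
    using D1_mult[OF d(1) s(1)] norm_coef[OF D1_mult(1)[OF d(1) s(1)]] unfolding d(2) s(2) by simp
qed

section \<open>The nonlinearity as a map on sequences\<close>

definition H_form :: "real^'n \<Rightarrow> l2 \<Rightarrow> l2 \<Rightarrow> real" where
  "H_form \<eta> a b = (\<Sum>i\<in>UNIV. \<eta> $ i * inner (Grad a $ i) (emb b)) - (\<Sum>i\<in>UNIV. inner (sq a) (Grad b $ i))"

lemma H_op_eq:
  assumes u: "u \<in> D1" and v: "v \<in> D1"
  shows "H_op \<Omega> \<eta> u v = H_form \<eta> (dcoef u) (dcoef v)"
proof -
  note gu = weak_grad_D1[OF u] and gv = weak_grad_D1[OF v]
  have "(LINT x|M. (\<eta> \<bullet> weak_grad \<Omega> u x) * v x) = (LINT x|M. (\<Sum>i\<in>UNIV. \<eta> $ i * (weak_grad \<Omega> u x $ i * v x)))"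
    by (simp add: inner_vec_def sum_distrib_right mult.assoc)
  also have "\<dots> = (\<Sum>i\<in>UNIV. \<eta> $ i * L2_inner \<Omega> (\<lambda>x. weak_grad \<Omega> u x $ i) v)"
    unfolding L2_inner_def
    by (subst Bochner_Integration.integral_sum) (auto intro!: integrable_mult_right L2_mult_integrable gu(1) D1_L2 v)
  also have "\<dots> = (\<Sum>i\<in>UNIV. \<eta> $ i * inner (Grad (dcoef u) $ i) (emb (dcoef v)))"
    by (simp add: inner_coef[symmetric] gu D1_L2 v emb_dcoef)
  finally have 1: "(LINT x|M. (\<eta> \<bullet> weak_grad \<Omega> u x) * v x)
      = (\<Sum>i\<in>UNIV. \<eta> $ i * inner (Grad (dcoef u) $ i) (emb (dcoef v)))" .
  have "(LINT x|M. flux u x \<bullet> weak_grad \<Omega> v x) = (LINT x|M. (\<Sum>i\<in>UNIV. (u x)\<^sup>2 * weak_grad \<Omega> v x $ i))"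
    by (simp add: inner_vec_def flux_def)
  also have "\<dots> = (\<Sum>i\<in>UNIV. L2_inner \<Omega> (\<lambda>x. (u x)\<^sup>2) (\<lambda>x. weak_grad \<Omega> v x $ i))"
    unfolding L2_inner_def
    by (subst Bochner_Integration.integral_sum) (auto intro!: L2_mult_integrable gv(1) D1_square u)
  also have "\<dots> = (\<Sum>i\<in>UNIV. inner (sq (dcoef u)) (Grad (dcoef v) $ i))"
    by (simp add: inner_coef[symmetric] gv D1_square u sq_dcoef)
  finally show ?thesis unfolding H_op_def H_form_def 1 by simp
qed

lemma bounded_linear_H_form: "bounded_linear (H_form \<eta> a)"
  unfolding H_form_def
  by (intro bounded_linear_sub bounded_linear_sum bounded_linear_const_mult
      bounded_linear_compose[OF bounded_linear_inner_right] bounded_linear_emb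
      bounded_linear_compose[OF bounded_linear_vec_nth] bounded_linear_Grad)

text \<open>Each coordinate direction contributes once, which explains the dimension in the
  constant. The transport term is linear and costs the Poincare constant; the flux term costs
  \<open>sob\<close> times the size of \<open>a + b\<close>.\<close>

lemma H_form_diff:
  "\<bar>H_form \<eta> a c - H_form \<eta> b c\<bar>
    \<le> real CARD('n) * (norm \<eta> / sqrt (\<theta> 0) + sob * norm (a + b)) * norm (a - b) * norm c"
proof -
  let ?G = "Grad (a - b)"
  have G: "Grad a - Grad b = ?G" by (simp add: linear_diff[OF bounded_linear.linear[OF bounded_linear_Grad]])
  have eq: "H_form \<eta> a c - H_form \<eta> b c
      = (\<Sum>i\<in>UNIV. \<eta> $ i * inner (?G $ i) (emb c) - inner (sq a - sq b) (Grad c $ i))"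
    unfolding H_form_def G[symmetric]
    by (simp add: sum_subtractf inner_diff_left right_diff_distrib)
  have tm: "\<bar>\<eta> $ i * inner (?G $ i) (emb c) - inner (sq a - sq b) (Grad c $ i)\<bar>
      \<le> (norm \<eta> / sqrt (\<theta> 0) + sob * norm (a + b)) * norm (a - b) * norm c" for i
  proof -
    have "\<bar>inner (?G $ i) (emb c)\<bar> \<le> norm (?G $ i) * norm (emb c)" by (rule Cauchy_Schwarz_ineq2)
    also have "\<dots> \<le> norm (a - b) * (1 / sqrt (\<theta> 0) * norm c)"
      by (intro mult_mono norm_emb order_trans[OF Finite_Cartesian_Product.norm_nth_le norm_Grad]) auto
    finally have 1: "\<bar>\<eta> $ i * inner (?G $ i) (emb c)\<bar> \<le> norm \<eta> * (norm (a - b) * (1 / sqrt (\<theta> 0) * norm c))"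
      unfolding abs_mult by (intro mult_mono component_le_norm_cart) auto
    have "\<bar>inner (sq a - sq b) (Grad c $ i)\<bar> \<le> norm (sq a - sq b) * norm (Grad c $ i)" by (rule Cauchy_Schwarz_ineq2)
    also have "\<dots> \<le> (sob * norm (a - b) * norm (a + b)) * norm c"
      by (intro mult_mono norm_sq_diff order_trans[OF Finite_Cartesian_Product.norm_nth_le norm_Grad]) (auto simp: sob_nonneg)
    finally show ?thesis using 1 by (simp add: algebra_simps)
  qed
  have "\<bar>H_form \<eta> a c - H_form \<eta> b c\<bar> \<le> (\<Sum>i\<in>(UNIV :: 'n set). (norm \<eta> / sqrt (\<theta> 0) + sob * norm (a + b)) * norm (a - b) * norm c)"
    unfolding eq by (rule order_trans[OF sum_abs sum_mono[OF tm]])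
  then show ?thesis by (simp add: mult.assoc)
qed

text \<open>The Riesz representative of \<open>H_form \<eta> a\<close>. With it the nonlinearity
  becomes a map of \<open>l2\<close> into itself.\<close>

definition H_vec :: "real^'n \<Rightarrow> l2 \<Rightarrow> l2" where
  "H_vec \<eta> a = Abs_l2 (\<lambda>k. H_form \<eta> a (unit_l2 k))"

lemma nth_H_vec: "nth_l2 (H_vec \<eta> a) k = H_form \<eta> a (unit_l2 k)"
proof -
  obtain C where "0 \<le> C" "\<And>b. norm (H_form \<eta> a b) \<le> norm b * C"
    using bounded_linear.nonneg_bounded[OF bounded_linear_H_form] by metis
  then have "summable (\<lambda>k. (H_form \<eta> a (unit_l2 k))\<^sup>2)"
    by (intro functional_l2(1)[OF bounded_linear_H_form]) (auto simp: mult.commute)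
  then show ?thesis by (simp add: H_vec_def nth_l2_Abs)
qed

lemma H_vec_Lipschitz:
  "norm (H_vec \<eta> a - H_vec \<eta> b) \<le> real CARD('n) * (norm \<eta> / sqrt (\<theta> 0) + sob * norm (a + b)) * norm (a - b)"
proof -
  have "H_vec \<eta> a - H_vec \<eta> b = Abs_l2 (\<lambda>k. H_form \<eta> a (unit_l2 k) - H_form \<eta> b (unit_l2 k))"
    using nth_l2_inverse[of "H_vec \<eta> a - H_vec \<eta> b"] by (simp add: nth_H_vec[symmetric] flip: nth_l2_simps)
  also have "norm \<dots> \<le> real CARD('n) * (norm \<eta> / sqrt (\<theta> 0) + sob * norm (a + b)) * norm (a - b)"
    using sob_nonneg eigenvalue_pos[of 0]
    by (intro functional_l2(2) bounded_linear_sub bounded_linear_H_form H_form_diff) auto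
  finally show ?thesis .
qed

lemma eigenfunction_D1: "\<phi> k \<in> D1" "dcoef (\<phi> k) = sqrt (\<theta> k) *\<^sub>R unit_l2 k"
proof -
  have *: "sqrt (\<theta> j) * nth_l2 (coef (\<phi> k)) j = nth_l2 (sqrt (\<theta> k) *\<^sub>R unit_l2 k) j" for j
    by (simp add: coef_eigenfunction)
  show "\<phi> k \<in> D1" unfolding D1_iff * using eigenfunction_L2 summable_nth_l2 by blast
  then show "dcoef (\<phi> k) = sqrt (\<theta> k) *\<^sub>R unit_l2 k" by (intro l2_eqI) (simp only: nth_dcoef *)
qed

text \<open>The eigenfunction is \<open>sqrt (\<theta> k)\<close> times a unit vector of the energy
  space, so one weight survives: the mark of a functional in the dual space.\<close>

lemma H_op_eigenfunction:
  assumes "u \<in> D1"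
  shows "H_op \<Omega> \<eta> u (\<phi> k) = sqrt (\<theta> k) * nth_l2 (H_vec \<eta> (dcoef u)) k"
  unfolding H_op_eq[OF assms eigenfunction_D1(1)] eigenfunction_D1(2) nth_H_vec
  by (simp add: linear_cmul[OF bounded_linear.linear[OF bounded_linear_H_form]])

lemma H_op_dual:
  assumes u: "u \<in> D1"
  shows "H_op \<Omega> \<eta> u \<in> D_dual \<Omega> \<theta> \<phi> 1"
proof -
  interpret bounded_linear "H_form \<eta> (dcoef u)" by (rule bounded_linear_H_form)
  obtain C where "\<And>b. norm (H_form \<eta> (dcoef u) b) \<le> norm b * C" using bounded by blast
  then have "\<forall>v\<in>D1. \<bar>H_op \<Omega> \<eta> u v\<bar> \<le> C * D_norm \<Omega> \<theta> \<phi> 1 v"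
    using u by (simp add: H_op_eq D_norm_eq mult.commute)
  then show ?thesis
    unfolding D_dual_def using u by (auto simp: H_op_eq D1_lincomb add scale)
qed

end

section \<open>Mittag-Leffler functions near the origin\<close>

text \<open>A positive minimum on \<open>{1..2}\<close> exists by compactness. The functional
  equation propagates it: stepping to the right beyond 2 multiplies by a number at least one, and
  stepping to the left of 1 divides by a number below one.\<close>

lemma Gamma_real_lower_bound: "\<exists>c>0. \<forall>x>0. c \<le> Gamma (x :: real)"
proof -
  have "continuous_on {1..2::real} Gamma"
    by (intro continuous_on_Gamma) (auto elim!: nonpos_Ints_cases)
  then obtain x0 :: real where x0: "x0 \<in> {1..2}" "\<And>x. x \<in> {1..2} \<Longrightarrow> Gamma x0 \<le> Gamma x"
    using continuous_attains_inf[of "{1..2::real}" Gamma] by auto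
  define c where "c = Gamma x0"
  have c: "c > 0" using x0(1) by (simp add: c_def Gamma_real_pos)
  have step: "Gamma (x + 1) = x * Gamma x" if "x > 0" for x :: real
    by (rule Gamma_plus1) (use that in \<open>auto elim!: nonpos_Ints_cases\<close>)
  have large: "c \<le> Gamma x" if "1 \<le> x" "x \<le> real n + 2" for x n
    using that
  proof (induction n arbitrary: x)
    case 0
    then show ?case using x0(2)[of x] by (simp add: c_def)
  next
    case (Suc n)
    show ?case
    proof (cases "x \<le> 2")
      case True
      then show ?thesis using x0(2)[of x] Suc.prems by (simp add: c_def)
    next
      case False
      then have "c \<le> Gamma (x - 1)" using Suc by auto
      also have "\<dots> \<le> (x - 1) * Gamma (x - 1)"
        using False Gamma_real_pos[of "x - 1"] by simp
      also have "\<dots> = Gamma x" using step[of "x - 1"] False by simp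
      finally show ?thesis .
    qed
  qed
  have "c \<le> Gamma x" if "x > 0" for x
  proof (cases "x \<ge> 1")
    case True
    obtain n where "x \<le> real n" using real_arch_simple by blast
    then show ?thesis using large[of x n] True by simp
  next
    case False
    have "c \<le> Gamma (x + 1)" using large[of "x + 1" 0] that False by simp
    also have "\<dots> \<le> 1 * Gamma x"
      unfolding step[OF that] using that False Gamma_real_pos[of x] by (intro mult_right_mono) auto
    finally show ?thesis by simp
  qed
  with c show ?thesis by blast
qed

text \<open>Reciprocals of Gamma values are bounded, so for arguments up to 1/2 a geometric series
  dominates. The differentiated geometric series does the same for differences and gives the
  Lipschitz bound.\<close>

lemma mittag_leffler_bounds:
  fixes \<alpha> \<zeta> :: real
  assumes "0 < \<alpha>" "0 < \<zeta>"
  shows "\<exists>B>0. (\<forall>z. \<bar>z\<bar> \<le> 1/2 \<longrightarrow> \<bar>mittag_leffler \<alpha> \<zeta> z\<bar> \<le> B) \<and>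
    (\<forall>z w. \<bar>z\<bar> \<le> 1/2 \<longrightarrow> \<bar>w\<bar> \<le> 1/2 \<longrightarrow> \<bar>mittag_leffler \<alpha> \<zeta> z - mittag_leffler \<alpha> \<zeta> w\<bar> \<le> B * \<bar>z - w\<bar>)"
proof -
  obtain c where c: "c > 0" "\<And>x :: real. x > 0 \<Longrightarrow> c \<le> Gamma x" using Gamma_real_lower_bound by blast
  define G where "G k = Gamma (\<alpha> * real k + \<zeta>)" for k :: nat
  have G: "c \<le> G k" for k
    unfolding G_def using assms by (intro c(2)) (simp add: add_nonneg_pos)
  then have Gpos: "0 < G k" for k using c(1) less_le_trans by blast
  have inv: "x / G k \<le> x / c" if "0 \<le> x" for x k
    using that G c(1) by (intro divide_left_mono mult_pos_pos Gpos)
  have half: "(\<lambda>k. (1/2::real) ^ k / c) sums (2 / c)"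
    using sums_divide[OF geometric_sums[of "1/2::real"], of c] by simp
  have t: "\<bar>z ^ k / G k\<bar> \<le> (1/2) ^ k / c" if "\<bar>z\<bar> \<le> 1/2" for z :: real and k
  proof -
    have "\<bar>z ^ k / G k\<bar> = \<bar>z\<bar> ^ k / G k" using Gpos[of k] by (simp add: power_abs)
    also have "\<dots> \<le> \<bar>z\<bar> ^ k / c" by (rule inv) simp
    also have "\<dots> \<le> (1/2) ^ k / c" using that c(1) by (intro divide_right_mono power_mono) auto
    finally show ?thesis .
  qed
  have s: "summable (\<lambda>k. z ^ k / G k)" if "\<bar>z\<bar> \<le> 1/2" for z
    by (rule summable_comparison_test'[OF sums_summable[OF half]]) (use t[OF that] in simp)
  have bound: "\<bar>mittag_leffler \<alpha> \<zeta> z\<bar> \<le> 2 / c" if "\<bar>z\<bar> \<le> 1/2" for z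
    unfolding mittag_leffler_def G_def[symmetric] sums_unique[OF half]
    using t[OF that] summable_norm_cancel
    by (intro order_trans[OF summable_rabs suminf_le] summable_comparison_test'[OF sums_summable[OF half]]
        sums_summable[OF half]) auto
  \<comment> \<open>The differentiated geometric series at 1/2 sums to 4; with the factor 2 from the
    doubling below this yields the constant \<open>8 / c\<close>.\<close>
  have quarter: "(\<lambda>k. 2 / c * (real (Suc k) * (1/2) ^ k) * d) sums (2 / c * 4 * d)" for d
    using geometric_deriv_sums[of "1/2::real"] by (intro sums_mult2 sums_mult) (simp add: power2_eq_square)
  have lip: "\<bar>mittag_leffler \<alpha> \<zeta> z - mittag_leffler \<alpha> \<zeta> w\<bar> \<le> 8 / c * \<bar>z - w\<bar>"
    if "\<bar>z\<bar> \<le> 1/2" "\<bar>w\<bar> \<le> 1/2" for z w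
  proof -
    have d: "\<bar>z ^ k / G k - w ^ k / G k\<bar> \<le> 2 / c * (real (Suc k) * (1/2) ^ k) * \<bar>z - w\<bar>" for k
    proof -
      \<comment> \<open>Doubling moves \<open>z\<close> and \<open>w\<close> into the closed unit
        ball, where the \<open>k\<close>-th power is Lipschitz with constant \<open>k\<close>; the
        factor \<open>(1/2) ^ k\<close> left over makes the series converge.\<close>
      have p: "\<bar>(2 * z) ^ k - (2 * w) ^ k\<bar> \<le> real k * \<bar>2 * z - 2 * w\<bar>"
        using norm_power_diff[of "2 * z" "2 * w" k] that by simp
      have "\<bar>z ^ k - w ^ k\<bar> = (1/2) ^ k * \<bar>(2 * z) ^ k - (2 * w) ^ k\<bar>"
        by (simp add: power_mult_distrib right_diff_distrib[symmetric] abs_mult power_divide)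
      also have "\<dots> \<le> (1/2) ^ k * (real k * \<bar>2 * z - 2 * w\<bar>)"
        by (intro mult_left_mono p) simp
      also have "\<dots> \<le> (1/2) ^ k * (real (Suc k) * \<bar>2 * z - 2 * w\<bar>)"
        by (intro mult_left_mono mult_right_mono) auto
      also have "\<bar>2 * z - 2 * w\<bar> = 2 * \<bar>z - w\<bar>"
        using abs_mult[of 2 "z - w"] by (simp add: right_diff_distrib)
      finally have q: "\<bar>z ^ k - w ^ k\<bar> \<le> (1/2) ^ k * (real (Suc k) * (2 * \<bar>z - w\<bar>))" .
      have "\<bar>z ^ k / G k - w ^ k / G k\<bar> = \<bar>z ^ k - w ^ k\<bar> / G k"
        using Gpos[of k] by (simp add: diff_divide_distrib[symmetric])
      also have "\<dots> \<le> \<bar>z ^ k - w ^ k\<bar> / c" by (rule inv) simp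
      also have "\<dots> \<le> ((1/2) ^ k * (real (Suc k) * (2 * \<bar>z - w\<bar>))) / c"
        using q c(1) by (intro divide_right_mono) auto
      finally show ?thesis by (simp add: field_simps)
    qed
    have "\<bar>mittag_leffler \<alpha> \<zeta> z - mittag_leffler \<alpha> \<zeta> w\<bar> = \<bar>\<Sum>k. z ^ k / G k - w ^ k / G k\<bar>"
      unfolding mittag_leffler_def G_def[symmetric] suminf_diff[OF s[OF that(1)] s[OF that(2)]] ..
    also have "\<dots> \<le> (\<Sum>k. 2 / c * (real (Suc k) * (1/2) ^ k) * \<bar>z - w\<bar>)"
    proof -
      note Q = sums_summable[OF quarter[of "\<bar>z - w\<bar>"]]
      have a: "summable (\<lambda>k. \<bar>z ^ k / G k - w ^ k / G k\<bar>)"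
        by (rule summable_comparison_test'[OF Q]) (use d in auto)
      show ?thesis
        by (rule order_trans[OF summable_rabs[OF a] suminf_le[OF d a Q]])
    qed
    also have "\<dots> = 2 / c * 4 * \<bar>z - w\<bar>" by (rule sums_unique[OF quarter, symmetric])
    finally show ?thesis by simp
  qed
  show ?thesis
  proof (intro exI[of _ "8 / c"] conjI allI impI)
    show "8 / c > 0" using c(1) by simp
    fix z :: real assume "\<bar>z\<bar> \<le> 1/2"
    from bound[OF this] have "\<bar>mittag_leffler \<alpha> \<zeta> z\<bar> \<le> 2 / c" .
    also have "2 / c \<le> 8 / c" using c(1) by (intro divide_right_mono) auto
    finally show "\<bar>mittag_leffler \<alpha> \<zeta> z\<bar> \<le> 8 / c" .
  qed (use lip in auto)
qed

text \<open>Strong continuity together with a uniform bound gives joint continuity: moving the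
  argument costs at most \<open>C\<close> times its displacement, and for a fixed argument only
  strong continuity is involved.\<close>

lemma continuous_on_bounded_linear_family:
  fixes K :: "real \<Rightarrow> 'b::real_normed_vector \<Rightarrow> 'c::real_normed_vector"
  assumes K: "\<And>s. s \<in> S \<Longrightarrow> bounded_linear (K s)" "\<And>s b. s \<in> S \<Longrightarrow> norm (K s b) \<le> C * norm b"
      "\<And>b. continuous_on S (\<lambda>s. K s b)"
    and p: "continuous_on A p" "p ` A \<subseteq> S" and q: "continuous_on A q"
  shows "continuous_on A (\<lambda>x. K (p x) (q x))"
  unfolding continuous_on_def
proof
  fix x assume x: "x \<in> A"
  have "((\<lambda>y. K (p y) (q y) - K (p y) (q x)) \<longlongrightarrow> 0) (at x within A)"
  proof (rule Lim_null_comparison)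
    show "\<forall>\<^sub>F y in at x within A. norm (K (p y) (q y) - K (p y) (q x)) \<le> C * norm (q y - q x)"
    proof (rule eventually_at_topological[THEN iffD2, OF exI[of _ UNIV]], safe)
      fix y assume "y \<in> A"
      then have s: "p y \<in> S" using p(2) by blast
      show "norm (K (p y) (q y) - K (p y) (q x)) \<le> C * norm (q y - q x)"
        using K(2)[OF s, of "q y - q x"] by (simp add: linear_diff[OF bounded_linear.linear[OF K(1)[OF s]]])
    qed auto
    have "((\<lambda>y. C * norm (q y - q x)) \<longlongrightarrow> C * norm (q x - q x)) (at x within A)"
      using q x by (intro tendsto_intros) (simp add: continuous_on_def)
    then show "((\<lambda>y. C * norm (q y - q x)) \<longlongrightarrow> 0) (at x within A)" by simp
  qed
  moreover have "((\<lambda>y. K (p y) (q x)) \<longlongrightarrow> K (p x) (q x)) (at x within A)"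
    using continuous_on_compose2[OF K(3) p, of "q x"] x by (simp add: continuous_on_def)
  ultimately have "((\<lambda>y. K (p y) (q y) - K (p y) (q x) + K (p y) (q x)) \<longlongrightarrow> 0 + K (p x) (q x)) (at x within A)"
    by (rule tendsto_add)
  then show "((\<lambda>y. K (p y) (q y)) \<longlongrightarrow> K (p x) (q x)) (at x within A)" by simp
qed

context dirichlet_domain
begin

section \<open>Diagonal Mittag-Leffler operators\<close>

definition ml_arg :: "real \<Rightarrow> real \<Rightarrow> nat \<Rightarrow> real" where
  "ml_arg \<alpha> t k = - \<theta> k * t powr \<alpha> / (1 + \<theta> k)"

text \<open>The ratio \<open>\<theta> k / (1 + \<theta> k)\<close> is below one, so the bounds are
  uniform in \<open>k\<close> and a single short time interval serves all modes.\<close>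

lemma ml_arg_bounds:
  shows "\<bar>ml_arg \<alpha> t k\<bar> \<le> t powr \<alpha>" "\<bar>ml_arg \<alpha> t k - ml_arg \<alpha> s k\<bar> \<le> \<bar>t powr \<alpha> - s powr \<alpha>\<bar>"
proof -
  have f: "\<bar>- \<theta> k * r / (1 + \<theta> k)\<bar> \<le> \<bar>r\<bar>" for r
  proof -
    have "\<bar>- \<theta> k * r / (1 + \<theta> k)\<bar> = \<theta> k / (1 + \<theta> k) * \<bar>r\<bar>"
      using eigenvalue_pos[of k] by (simp add: abs_mult)
    also have "\<dots> \<le> 1 * \<bar>r\<bar>" using eigenvalue_pos[of k] by (intro mult_right_mono) auto
    finally show ?thesis by simp
  qed
  show "\<bar>ml_arg \<alpha> t k\<bar> \<le> t powr \<alpha>" unfolding ml_arg_def using f[of "t powr \<alpha>"] by simp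
  have "ml_arg \<alpha> t k - ml_arg \<alpha> s k = - \<theta> k * (t powr \<alpha> - s powr \<alpha>) / (1 + \<theta> k)"
    by (simp add: ml_arg_def diff_divide_distrib right_diff_distrib)
  then show "\<bar>ml_arg \<alpha> t k - ml_arg \<alpha> s k\<bar> \<le> \<bar>t powr \<alpha> - s powr \<alpha>\<bar>" using f by simp
qed

text \<open>One family covers both solution operators: \<zeta> and \<open>m\<close> equal to 1 for
  \<open>S_op\<close>, and \<zeta> equal to \<alpha> with
  \<open>m k = \<theta> k / (1 + \<theta> k)\<close> for \<open>R_op\<close> without its singular
  factor.\<close>

definition ml_mult :: "real \<Rightarrow> real \<Rightarrow> (nat \<Rightarrow> real) \<Rightarrow> real \<Rightarrow> l2 \<Rightarrow> l2" where
  "ml_mult \<alpha> \<zeta> m t = mult_l2 (\<lambda>k. m k * mittag_leffler \<alpha> \<zeta> (ml_arg \<alpha> t k))"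

text \<open>The Lipschitz bound of the Mittag-Leffler function holds for all modes at once, so the
  operators depend continuously on \<open>t powr \<alpha>\<close>, and hence on \<open>t\<close> up
  to and including zero.\<close>

lemma ml_mult:
  assumes "0 < \<alpha>" "0 < \<zeta>" and m: "\<And>k. \<bar>m k\<bar> \<le> 1" and T: "T powr \<alpha> \<le> 1/2"
  obtains B where "B > 0"
    "\<And>t. t \<in> {0..T} \<Longrightarrow> bounded_linear (ml_mult \<alpha> \<zeta> m t)"
    "\<And>t a. t \<in> {0..T} \<Longrightarrow> norm (ml_mult \<alpha> \<zeta> m t a) \<le> B * norm a"
    "\<And>t a k. t \<in> {0..T} \<Longrightarrow> nth_l2 (ml_mult \<alpha> \<zeta> m t a) k = m k * mittag_leffler \<alpha> \<zeta> (ml_arg \<alpha> t k) * nth_l2 a k"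
    "\<And>a. continuous_on {0..T} (\<lambda>t. ml_mult \<alpha> \<zeta> m t a)"
proof -
  obtain B where B: "B > 0" "\<And>z. \<bar>z\<bar> \<le> 1/2 \<Longrightarrow> \<bar>mittag_leffler \<alpha> \<zeta> z\<bar> \<le> B"
    "\<And>z w. \<bar>z\<bar> \<le> 1/2 \<Longrightarrow> \<bar>w\<bar> \<le> 1/2 \<Longrightarrow> \<bar>mittag_leffler \<alpha> \<zeta> z - mittag_leffler \<alpha> \<zeta> w\<bar> \<le> B * \<bar>z - w\<bar>"
    using mittag_leffler_bounds[OF assms(1,2)] by blast
  let ?e = "\<lambda>t k. m k * mittag_leffler \<alpha> \<zeta> (ml_arg \<alpha> t k)"
  have arg: "\<bar>ml_arg \<alpha> t k\<bar> \<le> 1/2" if "t \<in> {0..T}" for t k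
  proof -
    have "t powr \<alpha> \<le> T powr \<alpha>" using that assms(1) by (intro powr_mono2) auto
    with ml_arg_bounds(1)[of \<alpha> t k] T show ?thesis by linarith
  qed
  have m1: "\<bar>m k * x\<bar> \<le> \<bar>x\<bar>" for k x
    using mult_right_mono[OF m[of k], of "\<bar>x\<bar>"] by (simp add: abs_mult)
  have e: "\<bar>?e t k\<bar> \<le> B" if "t \<in> {0..T}" for t k
    using order_trans[OF m1 B(2)[OF arg[OF that]]] .
  note M = mult_l2[OF e]
  show ?thesis
  proof (rule that[OF B(1)])
    show "bounded_linear (ml_mult \<alpha> \<zeta> m t)" if "t \<in> {0..T}" for t
      unfolding ml_mult_def by (rule M(3)[OF that])
    show "norm (ml_mult \<alpha> \<zeta> m t a) \<le> B * norm a" if "t \<in> {0..T}" for t a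
      unfolding ml_mult_def by (rule M(2)[OF that])
    show nth: "nth_l2 (ml_mult \<alpha> \<zeta> m t a) k = ?e t k * nth_l2 a k" if "t \<in> {0..T}" for t a k
      unfolding ml_mult_def by (rule M(1)[OF that])
    fix a
    have diff: "norm (ml_mult \<alpha> \<zeta> m s a - ml_mult \<alpha> \<zeta> m t a) \<le> B * \<bar>s powr \<alpha> - t powr \<alpha>\<bar> * norm a"
      if "s \<in> {0..T}" "t \<in> {0..T}" for s t
    proof -
      have d: "\<bar>?e s k - ?e t k\<bar> \<le> B * \<bar>s powr \<alpha> - t powr \<alpha>\<bar>" for k
      proof -
        have "\<bar>?e s k - ?e t k\<bar> \<le> \<bar>mittag_leffler \<alpha> \<zeta> (ml_arg \<alpha> s k) - mittag_leffler \<alpha> \<zeta> (ml_arg \<alpha> t k)\<bar>"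
          unfolding right_diff_distrib[symmetric] by (rule m1)
        also have "\<dots> \<le> B * \<bar>ml_arg \<alpha> s k - ml_arg \<alpha> t k\<bar>" by (intro B(3) arg that)
        also have "\<dots> \<le> B * \<bar>s powr \<alpha> - t powr \<alpha>\<bar>"
          using B(1) by (intro mult_left_mono ml_arg_bounds) auto
        finally show ?thesis .
      qed
      have "ml_mult \<alpha> \<zeta> m s a - ml_mult \<alpha> \<zeta> m t a = mult_l2 (\<lambda>k. ?e s k - ?e t k) a"
        by (rule l2_eqI) (simp add: nth[OF that(1)] nth[OF that(2)] mult_l2(1)[OF d] left_diff_distrib)
      then show ?thesis using mult_l2(2)[OF d] by simp
    qed
    show "continuous_on {0..T} (\<lambda>t. ml_mult \<alpha> \<zeta> m t a)"
      unfolding continuous_on_def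
    proof
      fix t assume t: "t \<in> {0..T}"
      have "((\<lambda>s. ml_mult \<alpha> \<zeta> m s a - ml_mult \<alpha> \<zeta> m t a) \<longlongrightarrow> 0) (at t within {0..T})"
      proof (rule Lim_null_comparison)
        show "\<forall>\<^sub>F s in at t within {0..T}. norm (ml_mult \<alpha> \<zeta> m s a - ml_mult \<alpha> \<zeta> m t a)
            \<le> B * \<bar>s powr \<alpha> - t powr \<alpha>\<bar> * norm a"
          unfolding eventually_at_filter using diff[OF _ t] by (intro always_eventually) auto
        have "continuous_on {0..T} (\<lambda>s. s powr \<alpha>)"
          using assms(1) by (intro continuous_on_powr') (auto intro: continuous_intros)
        then have l: "((\<lambda>s. s powr \<alpha>) \<longlongrightarrow> t powr \<alpha>) (at t within {0..T})"
          using t by (simp add: continuous_on_def)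
        have "((\<lambda>s. B * \<bar>s powr \<alpha> - t powr \<alpha>\<bar> * norm a) \<longlongrightarrow> B * \<bar>t powr \<alpha> - t powr \<alpha>\<bar> * norm a) (at t within {0..T})"
          by (intro tendsto_mult tendsto_rabs tendsto_diff tendsto_const l)
        then show "((\<lambda>s. B * \<bar>s powr \<alpha> - t powr \<alpha>\<bar> * norm a) \<longlongrightarrow> 0) (at t within {0..T})" by simp
      qed
      then show "((\<lambda>s. ml_mult \<alpha> \<zeta> m s a) \<longlongrightarrow> ml_mult \<alpha> \<zeta> m t a) (at t within {0..T})"
        by (rule LIM_zero_cancel)
    qed
  qed
qed

end

section \<open>Volterra equations with a weakly singular kernel\<close>

lemma powr_kernel_has_integral:
  fixes \<alpha> c :: real
  assumes "0 < \<alpha>" "0 \<le> c"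
  shows "has_bochner_integral lborel (\<lambda>s. indicator {0..c} s * s powr (\<alpha> - 1)) (c powr \<alpha> / \<alpha>)"
proof (rule has_bochner_integral_nn_integral)
  have "((\<lambda>s. s powr (\<alpha> - 1)) has_integral (c powr \<alpha> / \<alpha>)) {0..c}"
    using has_integral_powr_from_0[of "\<alpha> - 1" c] assms by simp
  from nn_integral_has_integral_lebesgue[OF _ this]
  show "(\<integral>\<^sup>+s. ennreal (indicator {0..c} s * s powr (\<alpha> - 1)) \<partial>lborel) = ennreal (c powr \<alpha> / \<alpha>)" by simp
qed (use assms in \<open>auto intro!: AE_I2\<close>)

lemma powr_kernel_reflected:
  fixes \<alpha> a t :: real
  assumes "0 < \<alpha>" "a \<le> t"
  shows "has_bochner_integral lborel (\<lambda>\<tau>. indicator {a..t} \<tau> * (t - \<tau>) powr (\<alpha> - 1)) ((t - a) powr \<alpha> / \<alpha>)"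
proof -
  have "has_bochner_integral lborel (\<lambda>s. indicator {0..t - a} s * s powr (\<alpha> - 1)) ((t - a) powr \<alpha> / \<alpha>)"
    using assms by (intro powr_kernel_has_integral) auto
  then have "has_bochner_integral lborel (\<lambda>\<tau>. indicator {0..t - a} (t + - 1 * \<tau>) * (t + - 1 * \<tau>) powr (\<alpha> - 1)) (((t - a) powr \<alpha> / \<alpha>) /\<^sub>R \<bar>- 1\<bar>)"
    by (subst (asm) lborel_has_bochner_integral_real_affine_iff[where c="- 1" and t=t]) simp_all
  moreover have "indicator {0..t - a} (t + - 1 * \<tau>) = (indicator {a..t} \<tau> :: real)" for \<tau>
    by (auto simp: indicator_def)
  ultimately show ?thesis by simp
qed

section \<open>Convolution with the singular kernel\<close>

locale singular_kernel =
  fixes K :: "real \<Rightarrow> 'b::{banach, second_countable_topology} \<Rightarrow> 'b" and \<alpha> C S :: real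
  assumes alpha: "0 < \<alpha>" and C_nonneg: "0 \<le> C"
    and K_linear: "s \<in> {0..S} \<Longrightarrow> bounded_linear (K s)"
    and K_bound: "s \<in> {0..S} \<Longrightarrow> norm (K s b) \<le> C * norm b"
    and K_continuous: "continuous_on {0..S} (\<lambda>s. K s b)"
begin

text \<open>Extended by zero to the whole line, so that one measure serves every \<open>t\<close>.
  At the singular point the power has the conventional value 0, as it has in
  \<open>R_op\<close>.\<close>

definition conv_integrand :: "(real \<Rightarrow> 'b) \<Rightarrow> real \<Rightarrow> real \<Rightarrow> 'b" where
  "conv_integrand h t \<tau> = indicator {0..t} \<tau> *\<^sub>R (t - \<tau>) powr (\<alpha> - 1) *\<^sub>R K (t - \<tau>) (h \<tau>)"

definition conv :: "(real \<Rightarrow> 'b) \<Rightarrow> real \<Rightarrow> 'b" where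
  "conv h t = integral\<^sup>L lborel (conv_integrand h t)"

lemma K_zero: "s \<in> {0..S} \<Longrightarrow> K s 0 = 0"
  using linear_0[OF bounded_linear.linear[OF K_linear]] .

text \<open>The parameter \<open>a\<close> records that \<open>h\<close> vanishes on
  \<open>{0..<a}\<close>. Existence uses \<open>a = 0\<close>; in the uniqueness proof
  \<open>a\<close> is the time up to which two solutions are known to agree, and only the length
  \<open>t - a\<close> enters the estimate.\<close>

lemma conv_integrand_bound:
  assumes "t \<in> {0..S}" "\<And>\<tau>. \<tau> \<in> {0..t} \<Longrightarrow> norm (h \<tau>) \<le> H" "\<And>\<tau>. \<tau> \<in> {0..<a} \<Longrightarrow> h \<tau> = 0"
  shows "norm (conv_integrand h t \<tau>) \<le> C * H * (indicator {a..t} \<tau> * (t - \<tau>) powr (\<alpha> - 1))"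
proof (cases "\<tau> \<in> {0..t}")
  case True
  then have s: "t - \<tau> \<in> {0..S}" using assms(1) by auto
  have H: "0 \<le> H" using order_trans[OF norm_ge_zero assms(2)[OF True]] .
  show ?thesis
  proof (cases "\<tau> < a")
    case True
    with \<open>\<tau> \<in> {0..t}\<close> have "h \<tau> = 0" by (intro assms(3)) auto
    then show ?thesis using C_nonneg H by (simp add: conv_integrand_def K_zero[OF s])
  next
    case False
    have "norm (K (t - \<tau>) (h \<tau>)) \<le> C * H"
      using K_bound[OF s, of "h \<tau>"] mult_left_mono[OF assms(2)[OF True] C_nonneg] by linarith
    then have "(t - \<tau>) powr (\<alpha> - 1) * norm (K (t - \<tau>) (h \<tau>)) \<le> (t - \<tau>) powr (\<alpha> - 1) * (C * H)"
      by (intro mult_left_mono) auto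
    then show ?thesis using True False by (simp add: conv_integrand_def mult.commute)
  qed
next
  case False
  show ?thesis
  proof (cases "t \<ge> 0")
    case True
    have "0 \<le> H" using order_trans[OF norm_ge_zero assms(2)[of 0]] True by simp
    then show ?thesis using False C_nonneg by (simp add: conv_integrand_def)
  qed (use assms(1) in auto)
qed

lemma compact_bound:
  fixes h :: "real \<Rightarrow> 'b"
  assumes "continuous_on {0..t} h"
  obtains H where "\<And>\<tau>. \<tau> \<in> {0..t} \<Longrightarrow> norm (h \<tau>) \<le> H"
proof -
  obtain H where "\<forall>x\<in>h ` {0..t}. norm x \<le> H"
    using compact_imp_bounded[OF compact_continuous_image[OF assms compact_Icc]] unfolding bounded_iff by blast
  then show ?thesis by (intro that[of H]) blast
qed

lemma conv_integrable:
  assumes t: "t \<in> {0..S}" and h: "continuous_on {0..t} h"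
  shows "integrable lborel (conv_integrand h t)"
proof -
  obtain H where H: "\<And>\<tau>. \<tau> \<in> {0..t} \<Longrightarrow> norm (h \<tau>) \<le> H" using compact_bound[OF h] by blast
  have "continuous_on {0..t} (\<lambda>\<tau>. K (t - \<tau>) (h \<tau>))"
    by (rule continuous_on_bounded_linear_family[OF K_linear K_bound K_continuous _ _ h])
      (use t in \<open>auto intro!: continuous_intros\<close>)
  then have [measurable]: "(\<lambda>\<tau>. indicator {0..t} \<tau> *\<^sub>R K (t - \<tau>) (h \<tau>)) \<in> borel_measurable borel"
    by (intro borel_measurable_continuous_on_indicator) auto
  have "(\<lambda>\<tau>. (t - \<tau>) powr (\<alpha> - 1) *\<^sub>R (indicator {0..t} \<tau> *\<^sub>R K (t - \<tau>) (h \<tau>))) \<in> borel_measurable lborel"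
    by measurable
  then have m: "conv_integrand h t \<in> borel_measurable lborel"
    by (simp add: conv_integrand_def[abs_def] mult.commute)
  have i: "integrable lborel (\<lambda>\<tau>. C * H * (indicator {0..t} \<tau> * (t - \<tau>) powr (\<alpha> - 1)))"
    using powr_kernel_reflected[OF alpha, of 0 t] t by (intro integrable_mult_right) (auto simp: has_bochner_integral_iff)
  show ?thesis
  proof (rule Bochner_Integration.integrable_bound[OF i m], intro AE_I2)
    fix \<tau>
    have "norm (conv_integrand h t \<tau>) \<le> C * H * (indicator {0..t} \<tau> * (t - \<tau>) powr (\<alpha> - 1))"
      by (rule conv_integrand_bound[OF t H]) auto
    then show "norm (conv_integrand h t \<tau>) \<le> norm (C * H * (indicator {0..t} \<tau> * (t - \<tau>) powr (\<alpha> - 1)))"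
      by simp
  qed
qed

lemma conv_bound:
  assumes t: "t \<in> {0..S}" and h: "continuous_on {0..t} h"
    and b: "\<And>\<tau>. \<tau> \<in> {0..t} \<Longrightarrow> norm (h \<tau>) \<le> H" "\<And>\<tau>. \<tau> \<in> {0..<a} \<Longrightarrow> h \<tau> = 0" and a: "a \<le> t"
  shows "norm (conv h t) \<le> C * H * ((t - a) powr \<alpha> / \<alpha>)"
proof -
  note k = powr_kernel_reflected[OF alpha a]
  have "norm (conv h t) \<le> (LBINT \<tau>. C * H * (indicator {a..t} \<tau> * (t - \<tau>) powr (\<alpha> - 1)))"
    unfolding conv_def
  proof (rule Bochner_Integration.integral_norm_bound_integral[OF conv_integrable[OF t h]])
    show "integrable lborel (\<lambda>\<tau>. C * H * (indicator {a..t} \<tau> * (t - \<tau>) powr (\<alpha> - 1)))"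
      using k by (intro integrable_mult_right) (auto simp: has_bochner_integral_iff)
    show "norm (conv_integrand h t \<tau>) \<le> C * H * (indicator {a..t} \<tau> * (t - \<tau>) powr (\<alpha> - 1))" for \<tau>
      by (rule conv_integrand_bound[OF t b])
  qed
  also have "\<dots> = C * H * ((t - a) powr \<alpha> / \<alpha>)"
    using k by (simp add: has_bochner_integral_iff)
  finally show ?thesis .
qed

lemma conv_diff:
  assumes t: "t \<in> {0..S}" and "continuous_on {0..t} h" "continuous_on {0..t} h'"
  shows "conv h t - conv h' t = conv (\<lambda>\<tau>. h \<tau> - h' \<tau>) t"
proof -
  have "conv_integrand (\<lambda>\<tau>. h \<tau> - h' \<tau>) t \<tau> = conv_integrand h t \<tau> - conv_integrand h' t \<tau>" for \<tau>
  proof (cases "\<tau> \<in> {0..t}")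
    case True
    then have s: "t - \<tau> \<in> {0..S}" using t by auto
    show ?thesis
      by (simp add: conv_integrand_def linear_diff[OF bounded_linear.linear[OF K_linear[OF s]]] scaleR_diff_right)
  qed (simp add: conv_integrand_def)
  then have "conv_integrand (\<lambda>\<tau>. h \<tau> - h' \<tau>) t = (\<lambda>\<tau>. conv_integrand h t \<tau> - conv_integrand h' t \<tau>)"
    by (rule ext)
  then show ?thesis
    unfolding conv_def using conv_integrable[OF t assms(2)] conv_integrable[OF t assms(3)] by simp
qed

text \<open>The substitution fixes the singularity at \<open>s = 0\<close>, so that an integrable
  majorant independent of \<open>t\<close> becomes available.\<close>

lemma conv_reflected:
  "conv h t = (LBINT s. indicator {0..t} s *\<^sub>R s powr (\<alpha> - 1) *\<^sub>R K s (h (t - s)))"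
proof -
  have "conv h t = (LBINT s. conv_integrand h t (t + - 1 * s))"
    unfolding conv_def by (subst lborel_integral_real_affine[where c="- 1" and t=t]) simp_all
  also have "\<dots> = (LBINT s. indicator {0..t} s *\<^sub>R s powr (\<alpha> - 1) *\<^sub>R K s (h (t - s)))"
    by (rule Bochner_Integration.integral_cong) (auto simp: conv_integrand_def indicator_def)
  finally show ?thesis .
qed

lemma conv_continuous:
  assumes T: "T \<le> S" and h: "continuous_on {0..T} h"
  shows "continuous_on {0..T} (conv h)"
proof (rule continuous_on_sequentiallyI)
  fix u :: "nat \<Rightarrow> real" and t
  assume u: "\<forall>n. u n \<in> {0..T}" and t: "t \<in> {0..T}" and lim: "u \<longlonglongrightarrow> t"
  define q where "q t s = indicator {0..t} s *\<^sub>R s powr (\<alpha> - 1) *\<^sub>R K s (h (t - s))" for t s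
  obtain H where H: "\<And>\<tau>. \<tau> \<in> {0..T} \<Longrightarrow> norm (h \<tau>) \<le> H" using compact_bound[OF h] by blast
  have H0: "0 \<le> H" using order_trans[OF norm_ge_zero H[OF t]] .
  have qm: "q r \<in> borel_measurable lborel" if r: "r \<in> {0..T}" for r
  proof -
    have "integrable lborel (\<lambda>s. conv_integrand h r (r + - 1 * s))"
      using r T by (intro lborel_integrable_real_affine conv_integrable continuous_on_subset[OF h]) auto
    moreover have "(\<lambda>s. conv_integrand h r (r + - 1 * s)) = q r"
      by (auto simp: fun_eq_iff q_def conv_integrand_def indicator_def)
    ultimately show ?thesis by auto
  qed
  have "(\<lambda>n. integral\<^sup>L lborel (q (u n))) \<longlonglongrightarrow> integral\<^sup>L lborel (q t)"
  proof (rule integral_dominated_convergence[where w="\<lambda>s. C * H * (indicator {0..T} s * s powr (\<alpha> - 1))"])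
    show "integrable lborel (\<lambda>s. C * H * (indicator {0..T} s * s powr (\<alpha> - 1)))"
      using powr_kernel_has_integral[OF alpha, of T] t by (intro integrable_mult_right) (auto simp: has_bochner_integral_iff)
    show "AE s in lborel. norm (q (u n) s) \<le> C * H * (indicator {0..T} s * s powr (\<alpha> - 1))" for n
    proof (intro AE_I2)
      fix s
      show "norm (q (u n) s) \<le> C * H * (indicator {0..T} s * s powr (\<alpha> - 1))"
      proof (cases "s \<in> {0..u n}")
        case True
        then have s: "s \<in> {0..T}" "u n - s \<in> {0..T}" "s \<in> {0..S}" using u[rule_format, of n] T by auto
        have "norm (K s (h (u n - s))) \<le> C * H"
          using K_bound[OF s(3), of "h (u n - s)"] mult_left_mono[OF H[OF s(2)] C_nonneg] by linarith
        then have "s powr (\<alpha> - 1) * norm (K s (h (u n - s))) \<le> s powr (\<alpha> - 1) * (C * H)"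
          by (intro mult_left_mono) auto
        then show ?thesis using True s by (simp add: q_def mult.commute)
      next
        case False
        then show ?thesis using H0 C_nonneg by (simp add: q_def)
      qed
    qed
    \<comment> \<open>At \<open>s = t\<close> the indicators of \<open>{0..u n}\<close> may
      oscillate with \<open>n\<close>; at every other point they are eventually constant.\<close>
    have "AE s in lborel. s \<noteq> t" by (rule AE_lborel_singleton)
    then show "AE s in lborel. (\<lambda>n. q (u n) s) \<longlonglongrightarrow> q t s"
    proof eventually_elim
      case (elim s)
      consider "s < 0" | "s > t" | "0 \<le> s" "s < t" using elim by linarith
      then show ?case
      proof cases
        case 1 then show ?thesis by (simp add: q_def)
      next
        case 2
        have "\<forall>\<^sub>F n in sequentially. u n < s" using lim 2 by (rule order_tendstoD(2))
        then have "\<forall>\<^sub>F n in sequentially. q (u n) s = q t s"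
          by eventually_elim (use 2 in \<open>simp add: q_def\<close>)
        then show ?thesis by (rule tendsto_eventually)
      next
        case 3
        then have sS: "s \<in> {0..S}" using t T by auto
        have ev: "\<forall>\<^sub>F n in sequentially. s < u n" using lim 3(2) by (rule order_tendstoD(1))
        have "(\<lambda>n. h (u n - s)) \<longlonglongrightarrow> h (t - s)"
        proof (rule continuous_on_tendsto_compose[OF h])
          show "(\<lambda>n. u n - s) \<longlonglongrightarrow> t - s" by (intro tendsto_intros lim)
          show "t - s \<in> {0..T}" using 3 t by auto
          show "\<forall>\<^sub>F n in sequentially. u n - s \<in> {0..T}"
            using ev
          proof eventually_elim
            case (elim n)
            then show ?case using u[rule_format, of n] 3 by simp
          qed
        qed
        then have "(\<lambda>n. s powr (\<alpha> - 1) *\<^sub>R K s (h (u n - s))) \<longlonglongrightarrow> s powr (\<alpha> - 1) *\<^sub>R K s (h (t - s))"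
          by (intro tendsto_scaleR tendsto_const bounded_linear.tendsto[OF K_linear[OF sS]])
        moreover have "q t s = s powr (\<alpha> - 1) *\<^sub>R K s (h (t - s))" using 3 by (simp add: q_def)
        moreover have "\<forall>\<^sub>F n in sequentially. q (u n) s = s powr (\<alpha> - 1) *\<^sub>R K s (h (u n - s))"
          using ev by eventually_elim (use 3 in \<open>simp add: q_def\<close>)
        ultimately show ?thesis by (simp add: tendsto_cong)
      qed
    qed
  qed (use qm t u in auto)
  then show "(\<lambda>n. conv h (u n)) \<longlonglongrightarrow> conv h t"
    unfolding conv_reflected q_def .
qed

section \<open>Existence and uniqueness for the Volterra equation\<close>

definition locally_Lipschitz :: "('b \<Rightarrow> 'b) \<Rightarrow> bool" where
  "locally_Lipschitz F \<longleftrightarrow> (\<forall>R. \<exists>L\<ge>0. \<forall>a b. norm a \<le> R \<longrightarrow> norm b \<le> R \<longrightarrow> norm (F a - F b) \<le> L * norm (a - b))"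

lemma locally_Lipschitz_continuous:
  assumes "locally_Lipschitz F"
  shows "continuous_on UNIV F"
  unfolding continuous_on_def
proof
  fix x :: 'b
  obtain L where L: "\<And>a b. norm a \<le> norm x + 1 \<Longrightarrow> norm b \<le> norm x + 1 \<Longrightarrow> norm (F a - F b) \<le> L * norm (a - b)"
    using assms unfolding locally_Lipschitz_def by meson
  have ev: "\<forall>\<^sub>F y in at x. norm (F y - F x) \<le> L * norm (y - x)"
    unfolding eventually_at
  proof (intro exI[of _ 1] conjI ballI impI)
    fix y assume "y \<noteq> x \<and> dist y x < 1"
    then have "norm y \<le> norm x + 1" using norm_triangle_ineq2[of y x] by (simp add: dist_norm)
    then show "norm (F y - F x) \<le> L * norm (y - x)" by (intro L) auto
  qed simp
  have "((\<lambda>y. L * norm (y - x)) \<longlongrightarrow> L * norm (x - x)) (at x)" by (intro tendsto_intros)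
  then have "((\<lambda>y. L * norm (y - x)) \<longlongrightarrow> 0) (at x)" by simp
  from Lim_null_comparison[OF ev this] show "(F \<longlongrightarrow> F x) (at x within UNIV)" by (rule LIM_zero_cancel)
qed

text \<open>The right end point of the interval solves
  \<open>D * (t powr \<alpha> / \<alpha>) = 1/2\<close>.\<close>

lemma short_time:
  assumes "0 \<le> c" "c \<le> D" "0 < D" and t: "t \<in> {0..(\<alpha> / (2 * D)) powr (1 / \<alpha>)}"
  shows "c * (t powr \<alpha> / \<alpha>) \<le> 1/2"
proof -
  have "t powr \<alpha> \<le> ((\<alpha> / (2 * D)) powr (1 / \<alpha>)) powr \<alpha>"
    using t alpha by (intro powr_mono2) auto
  also have "\<dots> = \<alpha> / (2 * D)" using alpha assms by (simp add: powr_powr)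
  finally have "t powr \<alpha> / \<alpha> \<le> 1 / (2 * D)" using alpha assms by (simp add: field_simps)
  then have "c * (t powr \<alpha> / \<alpha>) \<le> D * (1 / (2 * D))" using assms alpha by (intro mult_mono) auto
  then show ?thesis using assms(3) by simp
qed

text \<open>Banach's fixed point theorem on a ball of radius \<open>G + 1\<close>: the forcing term
  stays below \<open>G\<close>, and on a short interval the convolution contributes at most
  1/2.\<close>

lemma Volterra_exists:
  assumes S: "S > 0" and g: "continuous_on {0..S} g" and F: "locally_Lipschitz F"
  shows "\<exists>T. 0 < T \<and> T \<le> S \<and> (\<exists>u. continuous_on {0..T} u \<and> (\<forall>t\<in>{0..T}. u t = g t + conv (\<lambda>\<tau>. F (u \<tau>)) t))"
proof -
  obtain G where G: "\<And>t. t \<in> {0..S} \<Longrightarrow> norm (g t) \<le> G" using compact_bound[OF g] by blast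
  define R where "R = G + 1"
  have G0: "0 \<le> G" using order_trans[OF norm_ge_zero G[of 0]] S by simp
  obtain L where L: "L \<ge> 0" "\<And>a b. norm a \<le> R \<Longrightarrow> norm b \<le> R \<Longrightarrow> norm (F a - F b) \<le> L * norm (a - b)"
    using F unfolding locally_Lipschitz_def by meson
  define H where "H = L * R + norm (F 0)"
  have H: "norm (F a) \<le> H" if "norm a \<le> R" for a
  proof -
    have "norm (F a - F 0) \<le> L * norm a" using L(2)[of a 0] that G0 by (simp add: R_def)
    also have "\<dots> \<le> L * R" by (intro mult_left_mono that L)
    finally show ?thesis using norm_triangle_ineq2[of "F a" "F 0"] by (simp add: H_def)
  qed
  have H0: "0 \<le> H" using L(1) G0 by (simp add: H_def R_def)
  \<comment> \<open>One constant dominates both \<open>C * H\<close>, which keeps the ball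
    invariant, and \<open>C * L\<close>, which makes the map contract; the added one keeps it
    positive.\<close>
  define D where "D = C * H + C * L + 1"
  have D: "D > 0" "C * H \<le> D" "C * L \<le> D"
    using C_nonneg H0 L(1) by (auto simp: D_def intro: add_nonneg_pos)
  define T where "T = min S ((\<alpha> / (2 * D)) powr (1 / \<alpha>))"
  have T: "0 < T" "T \<le> S" using S alpha D(1) by (auto simp: T_def)
  have small: "c * (t powr \<alpha> / \<alpha>) \<le> 1/2" if "t \<in> {0..T}" and "0 \<le> c" "c \<le> D" for c t
    using that D(1) by (intro short_time) (auto simp: T_def)
  define \<Phi> where "\<Phi> u t = g t + conv (\<lambda>\<tau>. F (apply_bcontfun u \<tau>)) t" for u :: "real \<Rightarrow>\<^sub>C 'b" and t
  have Fc: "continuous_on {0..t} (\<lambda>\<tau>. F (apply_bcontfun u \<tau>))" for u t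
    using continuous_on_compose2[OF locally_Lipschitz_continuous[OF F] continuous_on_apply_bcontfun] by auto
  have \<Phi>c: "continuous_on {0..T} (\<Phi> u)" for u
    unfolding \<Phi>_def using T by (intro continuous_on_add conv_continuous Fc continuous_on_subset[OF g]) auto
  \<comment> \<open>Composing with the clamp onto \<open>{0..T}\<close> extends functions from the
    interval by constants, so that the iteration runs in the complete space of bounded continuous
    functions on the line.\<close>
  define E where "E u = Bcontfun (\<lambda>t. \<Phi> u (max 0 (min T t)))" for u
  define B where "B = PiC UNIV (\<lambda>_ :: real. cball (0 :: 'b) R)"
  have B: "u \<in> B \<longleftrightarrow> (\<forall>t. norm (apply_bcontfun u t) \<le> R)" for u
    by (simp add: B_def mem_PiC_iff Pi_def)
  have E: "apply_bcontfun (E u) t = \<Phi> u (max 0 (min T t))" for u t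
  proof -
    have "continuous_on UNIV (\<lambda>t. \<Phi> u (max 0 (min T t)))"
      using T by (intro continuous_on_compose2[OF \<Phi>c] continuous_intros) auto
    moreover have "bounded (\<Phi> u ` {0..T})" by (intro compact_imp_bounded compact_continuous_image \<Phi>c) auto
    then have "bounded (range (\<lambda>t. \<Phi> u (max 0 (min T t))))"
      using T by (rule_tac bounded_subset) auto
    ultimately have "(\<lambda>t. \<Phi> u (max 0 (min T t))) \<in> bcontfun" by (simp add: bcontfun_def)
    then show ?thesis by (simp add: E_def Bcontfun_inverse)
  qed
  have clamp: "max 0 (min T t) \<in> {0..T}" for t using T by auto
  have "\<exists>!u. u \<in> B \<and> E u = u"
  proof (rule Banach_fix)
    show "complete B" unfolding B_def by (intro complete_eq_closed[THEN iffD2] closed_PiC) auto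
    have "const_bcontfun 0 \<in> B" unfolding B using G0 by (simp add: R_def)
    then show "B \<noteq> {}" by blast
    show "(0::real) \<le> 1/2" "(1/2::real) < 1" by auto
    show "E ` B \<subseteq> B"
    proof (safe)
      fix u assume u: "u \<in> B"
      show "E u \<in> B"
        unfolding B E
      proof
        fix t0
        let ?t = "max 0 (min T t0)"
        have t: "?t \<in> {0..T}" "?t \<in> {0..S}" using clamp[of t0] T by auto
        have "norm (conv (\<lambda>\<tau>. F (apply_bcontfun u \<tau>)) ?t) \<le> C * H * ((?t - 0) powr \<alpha> / \<alpha>)"
          using u t by (intro conv_bound[OF t(2) Fc]) (auto simp: B intro: H)
        also have "\<dots> \<le> 1/2" using small[OF t(1), of "C * H"] C_nonneg H0 D by simp
        finally have "norm (conv (\<lambda>\<tau>. F (apply_bcontfun u \<tau>)) ?t) \<le> 1/2" .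
        then show "norm (\<Phi> u ?t) \<le> R"
          unfolding \<Phi>_def R_def
          using norm_triangle_ineq[of "g ?t" "conv (\<lambda>\<tau>. F (apply_bcontfun u \<tau>)) ?t"] G[OF t(2)] by linarith
      qed
    qed
    show "dist (E u) (E v) \<le> 1/2 * dist u v" if uv: "u \<in> B" "v \<in> B" for u v
    proof (rule dist_bound)
      fix t0
      let ?t = "max 0 (min T t0)"
      have t: "?t \<in> {0..T}" "?t \<in> {0..S}" using clamp[of t0] T by auto
      have "dist (E u t0) (E v t0) = norm (conv (\<lambda>\<tau>. F (u \<tau>)) ?t - conv (\<lambda>\<tau>. F (v \<tau>)) ?t)"
        by (simp add: E \<Phi>_def dist_norm)
      also have "\<dots> = norm (conv (\<lambda>\<tau>. F (u \<tau>) - F (v \<tau>)) ?t)"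
        by (subst conv_diff[OF t(2) Fc Fc]) simp
      also have "\<dots> \<le> C * (L * dist u v) * ((?t - 0) powr \<alpha> / \<alpha>)"
      proof (rule conv_bound[OF t(2)])
        show "continuous_on {0..?t} (\<lambda>\<tau>. F (u \<tau>) - F (v \<tau>))" by (intro continuous_on_diff Fc)
        fix \<tau>
        have "norm (F (u \<tau>) - F (v \<tau>)) \<le> L * norm (u \<tau> - v \<tau>)" using uv by (intro L(2)) (auto simp: B)
        also have "\<dots> \<le> L * dist u v"
          using dist_bounded[of u \<tau> v] by (intro mult_left_mono L(1)) (simp add: dist_norm)
        finally show "norm (F (u \<tau>) - F (v \<tau>)) \<le> L * dist u v" .
      qed (use t in auto)
      also have "\<dots> = (C * L * (?t powr \<alpha> / \<alpha>)) * dist u v" by simp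
      also have "\<dots> \<le> 1/2 * dist u v"
        using small[OF t(1), of "C * L"] C_nonneg L(1) D by (intro mult_right_mono) auto
      finally show "dist (E u t0) (E v t0) \<le> 1/2 * dist u v" .
    qed
  qed
  then obtain u where u: "E u = u" by blast
  have "apply_bcontfun u t = g t + conv (\<lambda>\<tau>. F (apply_bcontfun u \<tau>)) t" if "t \<in> {0..T}" for t
  proof -
    have "max 0 (min T t) = t" using that by auto
    then show ?thesis using E[of u t] unfolding u \<Phi>_def by simp
  qed
  then show ?thesis using T by (intro exI[of _ T] conjI exI[of _ "apply_bcontfun u"]) auto
qed

text \<open>Two arbitrary continuous solutions need not stay in the ball used for existence, so the
  Lipschitz constant is taken on a ball containing both. The step \<delta> depends only on this
  constant, and finitely many steps reach \<open>t\<close>; this replaces a singular Gronwall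
  inequality.\<close>

lemma Volterra_unique:
  assumes T: "T \<le> S" and F: "locally_Lipschitz F"
    and u: "continuous_on {0..T} u" "\<And>t. t \<in> {0..T} \<Longrightarrow> u t = g t + conv (\<lambda>\<tau>. F (u \<tau>)) t"
    and v: "continuous_on {0..T} v" "\<And>t. t \<in> {0..T} \<Longrightarrow> v t = g t + conv (\<lambda>\<tau>. F (v \<tau>)) t"
    and t: "t \<in> {0..T}"
  shows "u t = v t"
proof -
  obtain R1 where R1: "\<And>t. t \<in> {0..T} \<Longrightarrow> norm (u t) \<le> R1" using compact_bound[OF u(1)] by blast
  obtain R2 where R2: "\<And>t. t \<in> {0..T} \<Longrightarrow> norm (v t) \<le> R2" using compact_bound[OF v(1)] by blast
  obtain L where L: "L \<ge> 0" "\<And>a b. norm a \<le> max R1 R2 \<Longrightarrow> norm b \<le> max R1 R2 \<Longrightarrow> norm (F a - F b) \<le> L * norm (a - b)"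
    using F unfolding locally_Lipschitz_def by meson
  have L': "norm (F (u \<tau>) - F (v \<tau>)) \<le> L * norm (u \<tau> - v \<tau>)" if "\<tau> \<in> {0..T}" for \<tau>
    using R1[OF that] R2[OF that] by (intro L(2)) auto
  have Fc: "continuous_on {0..r} (\<lambda>\<tau>. F (u \<tau>))" "continuous_on {0..r} (\<lambda>\<tau>. F (v \<tau>))" if "r \<le> T" for r
    using that by (auto intro!: continuous_on_compose2[OF locally_Lipschitz_continuous[OF F]]
        continuous_on_subset[OF u(1)] continuous_on_subset[OF v(1)])
  define D where "D = C * L + 1"
  have D: "D > 0" "C * L \<le> D" using C_nonneg L(1) by (auto simp: D_def intro: add_nonneg_pos)
  define \<delta> where "\<delta> = (\<alpha> / (2 * D)) powr (1 / \<alpha>)"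
  have \<delta>: "\<delta> > 0" using alpha D by (simp add: \<delta>_def)
  have small: "C * L * (s powr \<alpha> / \<alpha>) \<le> 1/2" if "s \<in> {0..\<delta>}" for s
    using that C_nonneg L(1) D by (intro short_time) (auto simp: \<delta>_def)
  have eq: "u r = v r" if "r \<in> {0..T}" "r \<le> real n * \<delta>" for r n
    using that
  proof (induction n arbitrary: r)
    \<comment> \<open>Only \<open>r = 0\<close> is left, and there the convolution vanishes because
      its interval of integration has length zero.\<close>
    case 0
    then have "r = 0" by simp
    have "norm (conv (\<lambda>\<tau>. F (u \<tau>) - F (v \<tau>)) 0) \<le> C * norm (F (u 0) - F (v 0)) * ((0 - 0) powr \<alpha> / \<alpha>)"
      using 0 T by (intro conv_bound continuous_on_diff Fc) auto
    then have "conv (\<lambda>\<tau>. F (u \<tau>) - F (v \<tau>)) 0 = 0" by simp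
    then have "conv (\<lambda>\<tau>. F (u \<tau>)) 0 = conv (\<lambda>\<tau>. F (v \<tau>)) 0"
      using conv_diff[of 0 "\<lambda>\<tau>. F (u \<tau>)" "\<lambda>\<tau>. F (v \<tau>)"] Fc[of 0] 0 T by auto
    then show ?case using u(2)[of 0] v(2)[of 0] 0 \<open>r = 0\<close> by simp
  next
    case (Suc n)
    define b where "b = min T (real (Suc n) * \<delta>)"
    have "continuous_on {0..b} (\<lambda>t. norm (u t - v t))"
      by (intro continuous_intros continuous_on_subset[OF u(1)] continuous_on_subset[OF v(1)]) (auto simp: b_def)
    moreover have "r \<in> {0..b}" using Suc.prems by (auto simp: b_def)
    ultimately obtain t0 where t0: "t0 \<in> {0..b}" "\<And>t. t \<in> {0..b} \<Longrightarrow> norm (u t - v t) \<le> norm (u t0 - v t0)"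
      using continuous_attains_sup[of "{0..b}" "\<lambda>t. norm (u t - v t)"] by auto
    define m where "m = norm (u t0 - v t0)"
    \<comment> \<open>\<open>m\<close> is the maximal distance on \<open>{0..b}\<close>. If it is
      attained where the solutions already agree, it is zero. Otherwise the integrand vanishes
      before \<open>a\<close>, at most one step of length \<delta> remains, and the estimate reads
      \<open>m <= m / 2\<close>.\<close>
    have "m = 0"
    proof (cases "t0 \<le> real n * \<delta>")
      case True
      then show ?thesis using Suc.IH[of t0] t0(1) by (simp add: m_def b_def)
    next
      case False
      define a where "a = real n * \<delta>"
      have tT: "t0 \<in> {0..T}" "t0 \<in> {0..S}" "t0 \<le> T" using t0(1) T by (auto simp: b_def)
      have sd: "t0 - a \<in> {0..\<delta>}" using False t0(1) by (auto simp: a_def b_def algebra_simps)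
      have "u t0 - v t0 = conv (\<lambda>\<tau>. F (u \<tau>)) t0 - conv (\<lambda>\<tau>. F (v \<tau>)) t0"
        using u(2)[OF tT(1)] v(2)[OF tT(1)] by simp
      also have "\<dots> = conv (\<lambda>\<tau>. F (u \<tau>) - F (v \<tau>)) t0" by (rule conv_diff[OF tT(2) Fc(1)[OF tT(3)] Fc(2)[OF tT(3)]])
      finally have "m = norm (conv (\<lambda>\<tau>. F (u \<tau>) - F (v \<tau>)) t0)" by (simp add: m_def)
      also have "\<dots> \<le> C * (L * m) * ((t0 - a) powr \<alpha> / \<alpha>)"
      proof (rule conv_bound[OF tT(2)])
        show "continuous_on {0..t0} (\<lambda>\<tau>. F (u \<tau>) - F (v \<tau>))" by (intro continuous_on_diff Fc tT)
        show "norm (F (u \<tau>) - F (v \<tau>)) \<le> L * m" if "\<tau> \<in> {0..t0}" for \<tau>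
        proof -
          have "norm (F (u \<tau>) - F (v \<tau>)) \<le> L * norm (u \<tau> - v \<tau>)" using that tT by (intro L') auto
          also have "\<dots> \<le> L * m" unfolding m_def using that t0(1) by (intro mult_left_mono t0(2) L(1)) auto
          finally show ?thesis .
        qed
        show "F (u \<tau>) - F (v \<tau>) = 0" if "\<tau> \<in> {0..<a}" for \<tau>
          using Suc.IH[of \<tau>] that tT False by (simp add: a_def)
      qed (use False in \<open>simp add: a_def\<close>)
      also have "\<dots> = (C * L * ((t0 - a) powr \<alpha> / \<alpha>)) * m" by simp
      also have "\<dots> \<le> 1/2 * m" by (intro mult_right_mono small[OF sd]) (simp add: m_def)
      finally show ?thesis by (simp add: m_def)
    qed
    then show ?case using t0(2)[OF \<open>r \<in> {0..b}\<close>] by (simp add: m_def)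
  qed
  obtain n where "t \<le> real n * \<delta>" using ex_less_of_nat_mult[OF \<delta>, of t] less_imp_le by blast
  then show ?thesis using eq[OF t] by blast
qed

end

section \<open>Mild solutions\<close>

context dirichlet_domain
begin

abbreviation "N1 \<equiv> D_norm \<Omega> \<theta> \<phi> 1"

section \<open>Bochner integrals in the energy space\<close>

lemma D1_norm_diff: "v \<in> D1 \<Longrightarrow> w \<in> D1 \<Longrightarrow> N1 (\<lambda>x. v x - w x) = norm (dcoef v - dcoef w)"
  by (simp add: D_norm_eq D1_diff)

lemma D1_sum:
  assumes "finite W" "W \<subseteq> D1"
  shows "(\<lambda>x. \<Sum>w\<in>W. c w * w x) \<in> D1 \<and> dcoef (\<lambda>x. \<Sum>w\<in>W. c w * w x) = (\<Sum>w\<in>W. c w *\<^sub>R dcoef w)"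
  using assms
proof (induction W)
  case empty
  then show ?case using D1_lincomb[OF dsynth(1) dsynth(1), of 0 0 0 0] by simp
next
  case (insert v W)
  then show ?case using D1_lincomb[of v "\<lambda>x. \<Sum>w\<in>W. c w * w x" "c v" 1] by simp
qed

lemma simple_integral_dcoef:
  assumes "finite_measure N" and s: "simple_function N s" "s ` space N \<subseteq> D1"
  shows "simple_integral_fun N s \<in> D1" "integrable N (\<lambda>\<tau>. dcoef (s \<tau>))"
    "dcoef (simple_integral_fun N s) = (\<integral>\<tau>. dcoef (s \<tau>) \<partial>N)"
proof -
  interpret finite_measure N by fact
  have sb: "Bochner_Integration.simple_bochner_integrable N (\<lambda>\<tau>. dcoef (s \<tau>))"
    unfolding simple_bochner_integrable.simps using simple_function_compose1[OF s(1), of dcoef] by simp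
  have fin: "finite (s ` space N)" using s(1) by (simp add: simple_function_def)
  note sum = D1_sum[OF fin s(2), of "\<lambda>w. measure N (s -` {w} \<inter> space N)"]
  have eq: "simple_integral_fun N s = (\<lambda>x. \<Sum>w\<in>s ` space N. measure N (s -` {w} \<inter> space N) * w x)"
    by (simp add: simple_integral_fun_def fun_eq_iff)
  show "simple_integral_fun N s \<in> D1" unfolding eq using sum by blast
  show "integrable N (\<lambda>\<tau>. dcoef (s \<tau>))" by (rule integrableI_simple_bochner_integrable[OF sb])
  \<comment> \<open>\<open>dcoef\<close> identifies functions that agree almost everywhere, so
    distinct values of \<open>s\<close> may have the same image. The integral is therefore
    partitioned by the values of \<open>s\<close> themselves.\<close>
  have "(\<integral>\<tau>. dcoef (s \<tau>) \<partial>N) = (\<Sum>w\<in>s ` space N. measure N {\<tau> \<in> space N. s \<tau> = w} *\<^sub>R dcoef w)"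
    unfolding simple_bochner_integrable_eq_integral[OF sb, symmetric]
    by (rule simple_bochner_integral_partition[OF sb s(1)]) auto
  moreover have "{\<tau> \<in> space N. s \<tau> = w} = s -` {w} \<inter> space N" for w by auto
  ultimately show "dcoef (simple_integral_fun N s) = (\<integral>\<tau>. dcoef (s \<tau>) \<partial>N)"
    unfolding eq using sum by simp
qed

text \<open>In one direction, L^1 convergence of the simple functions fixes the limit of their
  integrals. In the other, simple approximants of the coordinates are synthesised into simple
  functions with values in the energy space.\<close>

lemma has_bochner_integral_in_D1_iff:
  assumes N: "finite_measure N" and f: "\<And>\<tau>. \<tau> \<in> space N \<Longrightarrow> f \<tau> \<in> D1"
    and int: "integrable N (\<lambda>\<tau>. dcoef (f \<tau>))"
  shows "has_bochner_integral_in D1 N1 N f I \<longleftrightarrow> I \<in> D1 \<and> dcoef I = (\<integral>\<tau>. dcoef (f \<tau>) \<partial>N)"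
proof
  assume "has_bochner_integral_in D1 N1 N f I"
  then obtain s where I: "I \<in> D1" and s: "\<And>i::nat. simple_function N (s i)" "\<And>i. s i ` space N \<subseteq> D1"
    and L1: "(\<lambda>i. \<integral>\<^sup>+\<tau>. ennreal (N1 (\<lambda>x. f \<tau> x - s i \<tau> x)) \<partial>N) \<longlonglongrightarrow> 0"
    and lim: "(\<lambda>i. N1 (\<lambda>x. simple_integral_fun N (s i) x - I x)) \<longlonglongrightarrow> 0"
    unfolding has_bochner_integral_in_def by blast
  note sid = simple_integral_dcoef[OF N s]
  have "(\<integral>\<^sup>+\<tau>. ennreal (N1 (\<lambda>x. f \<tau> x - s i \<tau> x)) \<partial>N) = (\<integral>\<^sup>+\<tau>. ennreal (norm (dcoef (s i \<tau>) - dcoef (f \<tau>))) \<partial>N)" for i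
    using s(2) f by (intro nn_integral_cong) (auto simp: D1_norm_diff norm_minus_commute image_subset_iff)
  with L1 have "(\<lambda>i. \<integral>\<^sup>+\<tau>. ennreal (norm (dcoef (s i \<tau>) - dcoef (f \<tau>))) \<partial>N) \<longlonglongrightarrow> 0" by simp
  from tendsto_L1_int[OF sid(2) int this]
  have "(\<lambda>i. dcoef (simple_integral_fun N (s i))) \<longlonglongrightarrow> (\<integral>\<tau>. dcoef (f \<tau>) \<partial>N)" by (simp add: sid(3))
  moreover have "(\<lambda>i. dcoef (simple_integral_fun N (s i))) \<longlonglongrightarrow> dcoef I"
    using lim by (intro LIM_zero_cancel[OF tendsto_norm_zero_cancel, of "\<lambda>i. dcoef (simple_integral_fun N (s i))"])
      (simp add: D1_norm_diff sid(1) I)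
  ultimately show "I \<in> D1 \<and> dcoef I = (\<integral>\<tau>. dcoef (f \<tau>) \<partial>N)" using I LIMSEQ_unique by blast
next
  interpret finite_measure N by (rule N)
  define q where "q \<tau> = dcoef (f \<tau>)" for \<tau>
  assume I: "I \<in> D1 \<and> dcoef I = (\<integral>\<tau>. dcoef (f \<tau>) \<partial>N)"
  have qm: "q \<in> borel_measurable N" using int by (simp add: q_def[abs_def])
  obtain p where p: "\<And>i. simple_function N (p i)" "\<And>\<tau>. \<tau> \<in> space N \<Longrightarrow> (\<lambda>i. p i \<tau>) \<longlonglongrightarrow> q \<tau>"
    "\<And>i \<tau>. \<tau> \<in> space N \<Longrightarrow> dist (p i \<tau>) 0 \<le> 2 * dist (q \<tau>) 0"
    using borel_measurable_implies_sequence_metric[OF qm, of 0] by metis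
  define s where "s i \<tau> = dsynth (p i \<tau>)" for i \<tau>
  have ss: "simple_function N (s i)" "s i ` space N \<subseteq> D1" for i
    unfolding s_def using simple_function_compose1[OF p(1)[of i], of dsynth] dsynth(1) by auto
  note sid = simple_integral_dcoef[OF N ss]
  have d: "N1 (\<lambda>x. f \<tau> x - s i \<tau> x) = norm (q \<tau> - p i \<tau>)" if "\<tau> \<in> space N" for i \<tau>
    using f[OF that] by (simp add: D1_norm_diff s_def dsynth q_def)
  have L1: "(\<lambda>i. \<integral>\<^sup>+\<tau>. ennreal (norm (q \<tau> - p i \<tau>)) \<partial>N) \<longlonglongrightarrow> 0"
  proof (rule nn_integral_dominated_convergence_norm)
    \<comment> \<open>Dominated convergence applies because the approximants are bounded by twice
      the norm of \<open>q\<close>.\<close>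
    show "p i \<in> borel_measurable N" for i by (rule borel_measurable_simple_function[OF p(1)])
    show "AE \<tau> in N. norm (p i \<tau>) \<le> 2 * norm (q \<tau>)" for i using p(3) by (intro AE_I2) simp
    show "(\<integral>\<^sup>+\<tau>. ennreal (2 * norm (q \<tau>)) \<partial>N) < \<infinity>"
    proof -
      have "integrable N (\<lambda>\<tau>. 2 * norm (q \<tau>))" using int by (simp add: q_def)
      then show ?thesis unfolding integrable_iff_bounded by simp
    qed
    show "AE \<tau> in N. (\<lambda>i. p i \<tau>) \<longlonglongrightarrow> q \<tau>" using p(2) by (intro AE_I2) simp
  qed (use qm in auto)
  have "(\<lambda>i. \<integral>\<^sup>+\<tau>. ennreal (norm (p i \<tau> - q \<tau>)) \<partial>N) \<longlonglongrightarrow> 0"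
    using L1 by (simp add: norm_minus_commute)
  moreover have "integrable N (p i)" for i using sid(2)[of i] by (simp add: s_def dsynth)
  ultimately have "(\<lambda>i. integral\<^sup>L N (p i)) \<longlonglongrightarrow> integral\<^sup>L N q"
    using int by (intro tendsto_L1_int) (auto simp: q_def)
  then have "(\<lambda>i. norm (integral\<^sup>L N (p i) - dcoef I)) \<longlonglongrightarrow> 0"
    using I by (intro tendsto_norm_zero LIM_zero) (simp add: q_def[abs_def])
  moreover have "N1 (\<lambda>x. simple_integral_fun N (s i) x - I x) = norm (integral\<^sup>L N (p i) - dcoef I)" for i
    using I sid(1)[of i] sid(3)[of i] by (simp add: D1_norm_diff) (simp add: s_def dsynth)
  ultimately have lim: "(\<lambda>i. N1 (\<lambda>x. simple_integral_fun N (s i) x - I x)) \<longlonglongrightarrow> 0" by simp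
  have "(\<integral>\<^sup>+\<tau>. ennreal (N1 (\<lambda>x. f \<tau> x - s i \<tau> x)) \<partial>N) = (\<integral>\<^sup>+\<tau>. ennreal (norm (q \<tau> - p i \<tau>)) \<partial>N)" for i
    by (intro nn_integral_cong) (simp add: d)
  with L1 have "(\<lambda>i. \<integral>\<^sup>+\<tau>. ennreal (N1 (\<lambda>x. f \<tau> x - s i \<tau> x)) \<partial>N) \<longlonglongrightarrow> 0" by simp
  moreover have "AE \<tau> in N. (\<lambda>i. N1 (\<lambda>x. f \<tau> x - s i \<tau> x)) \<longlonglongrightarrow> 0"
  proof (rule AE_I2)
    fix \<tau> assume \<tau>: "\<tau> \<in> space N"
    have "(\<lambda>i. norm (q \<tau> - p i \<tau>)) \<longlonglongrightarrow> norm (q \<tau> - q \<tau>)" by (intro tendsto_intros p(2) \<tau>)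
    then show "(\<lambda>i. N1 (\<lambda>x. f \<tau> x - s i \<tau> x)) \<longlonglongrightarrow> 0" by (simp add: d[OF \<tau>])
  qed
  moreover have "AE \<tau> in N. f \<tau> \<in> D1" using f by (intro AE_I2)
  moreover have "emeasure N {\<tau> \<in> space N. s i \<tau> \<noteq> (\<lambda>_. 0)} \<noteq> \<infinity>" for i by simp
  ultimately show "has_bochner_integral_in D1 N1 N f I"
    unfolding has_bochner_integral_in_def using I ss lim
    by (intro conjI exI[of _ s] allI) auto
qed

lemma C_in_D1_iff:
  "u \<in> C_in D1 N1 J \<longleftrightarrow> (\<forall>t\<in>J. u t \<in> D1) \<and> continuous_on J (\<lambda>t. dcoef (u t))"
proof -
  have "((\<lambda>s. N1 (\<lambda>x. u s x - u t x)) \<longlongrightarrow> 0) (at t within J) \<longleftrightarrow> ((\<lambda>s. dcoef (u s)) \<longlongrightarrow> dcoef (u t)) (at t within J)"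
    if u: "\<forall>t\<in>J. u t \<in> D1" and t: "t \<in> J" for t
  proof -
    have "((\<lambda>s. N1 (\<lambda>x. u s x - u t x)) \<longlongrightarrow> 0) (at t within J)
        \<longleftrightarrow> ((\<lambda>s. norm (dcoef (u s) - dcoef (u t))) \<longlongrightarrow> 0) (at t within J)"
      using u t by (intro tendsto_cong) (auto simp: eventually_at_filter D1_norm_diff)
    also have "\<dots> \<longleftrightarrow> ((\<lambda>s. dcoef (u s)) \<longlongrightarrow> dcoef (u t)) (at t within J)"
      unfolding tendsto_norm_zero_iff by (rule LIM_zero_iff)
    finally show ?thesis .
  qed
  then show ?thesis by (auto simp: C_in_def continuous_on_def)
qed

section \<open>The mild formulation in coordinates\<close>

definition kernel :: "real \<Rightarrow> real \<Rightarrow> l2 \<Rightarrow> l2" where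
  "kernel \<alpha> = ml_mult \<alpha> \<alpha> (\<lambda>k. \<theta> k / (1 + \<theta> k))"

lemma kernel_multiplier: "\<bar>\<theta> k / (1 + \<theta> k)\<bar> \<le> 1"
  using eigenvalue_pos[of k] by simp

lemma nth_ml_mult:
  assumes "0 < \<alpha>" "0 < \<zeta>" and "\<And>k. \<bar>m k\<bar> \<le> 1" and "T powr \<alpha> \<le> 1/2" and t: "t \<in> {0..T}"
  shows "nth_l2 (ml_mult \<alpha> \<zeta> m t a) k = m k * mittag_leffler \<alpha> \<zeta> (ml_arg \<alpha> t k) * nth_l2 a k"
  by (rule ml_mult[of \<alpha> \<zeta> m, OF assms(1-4)]) (simp only: t)

text \<open>An equality of functions, not merely almost everywhere: once the coefficient sequences
  agree, both sides are the same \<open>L2_series\<close> and hence the same chosen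
  representative.\<close>

lemma R_op_eq:
  assumes "0 < \<alpha>" "S powr \<alpha> \<le> 1/2" "s \<in> {0..S}" "u \<in> D1"
  shows "R_op \<Omega> \<theta> \<phi> \<alpha> s (H_op \<Omega> \<eta> u) = dsynth (s powr (\<alpha> - 1) *\<^sub>R kernel \<alpha> s (H_vec \<eta> (dcoef u)))"
proof -
  have k: "nth_l2 (kernel \<alpha> s a) k = \<theta> k / (1 + \<theta> k) * mittag_leffler \<alpha> \<alpha> (ml_arg \<alpha> s k) * nth_l2 a k" for a k
    unfolding kernel_def by (rule nth_ml_mult[OF assms(1,1) kernel_multiplier assms(2,3)])
  have "s powr (\<alpha> - 1) / (1 + \<theta> k) * mittag_leffler \<alpha> \<alpha> (- \<theta> k * s powr \<alpha> / (1 + \<theta> k)) * H_op \<Omega> \<eta> u (\<phi> k)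
      = nth_l2 (emb (s powr (\<alpha> - 1) *\<^sub>R kernel \<alpha> s (H_vec \<eta> (dcoef u)))) k" for k
  proof -
    have "\<theta> k / sqrt (\<theta> k) = sqrt (\<theta> k)" using eigenvalue_pos[of k] by (simp add: real_div_sqrt)
    then have "x / (1 + \<theta> k) * y * (sqrt (\<theta> k) * z) = x * (\<theta> k / (1 + \<theta> k) * y * z) / sqrt (\<theta> k)" for x y z
      by (metis (no_types, opaque_lifting) mult.commute mult.left_commute times_divide_eq_left times_divide_eq_right)
    then show ?thesis
      by (simp only: nth_emb nth_l2_simps k H_op_eigenfunction[OF assms(4)] ml_arg_def)
  qed
  then show ?thesis by (simp add: R_op_def dsynth_def synth_def)
qed

lemma S_op_eq:
  assumes "0 < \<alpha>" "S powr \<alpha> \<le> 1/2" "t \<in> {0..S}" "u \<in> D1"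
  shows "S_op \<Omega> \<theta> \<phi> \<alpha> t u = dsynth (ml_mult \<alpha> 1 (\<lambda>_. 1) t (dcoef u))"
proof -
  have k: "nth_l2 (ml_mult \<alpha> 1 (\<lambda>_. 1) t a) k = 1 * mittag_leffler \<alpha> 1 (ml_arg \<alpha> t k) * nth_l2 a k" for a k
    by (rule nth_ml_mult[OF assms(1) zero_less_one _ assms(2,3)]) simp
  have "mittag_leffler \<alpha> 1 (- \<theta> k * t powr \<alpha> / (1 + \<theta> k)) * L2_inner \<Omega> u (\<phi> k)
      = nth_l2 (emb (ml_mult \<alpha> 1 (\<lambda>_. 1) t (dcoef u))) k" for k
    using eigenvalue_pos[of k] by (simp add: nth_emb k nth_dcoef[OF assms(4)] nth_coef[OF D1_L2[OF assms(4)]] ml_arg_def)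
  then show ?thesis by (simp add: S_op_def dsynth_def synth_def)
qed

text \<open>The auxiliary function \<open>I\<close> is determined up to null sets by its energy
  coordinates, so the existential collapses, and almost everywhere equality in space becomes
  equality in \<open>l2\<close>. The condition that \<open>H_op\<close> is a functional holds for
  every element of the energy space.\<close>

lemma mild_solution_iff:
  assumes \<alpha>: "0 < \<alpha>" "S powr \<alpha> \<le> 1/2" and ker: "singular_kernel (kernel \<alpha>) \<alpha> C S" and T: "T \<le> S"
    and F: "continuous_on UNIV (H_vec \<eta>)" and u0: "u0 \<in> D1" and u: "u \<in> C_in D1 N1 {0..T}"
  shows "mild_solution \<Omega> \<theta> \<phi> \<alpha> \<eta> u0 T u \<longleftrightarrow>
    (\<forall>t\<in>{0..T}. dcoef (u t) = ml_mult \<alpha> 1 (\<lambda>_. 1) t (dcoef u0)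
      + singular_kernel.conv (kernel \<alpha>) \<alpha> (\<lambda>\<tau>. H_vec \<eta> (dcoef (u \<tau>))) t)"
  unfolding mild_solution_def
proof (intro ball_cong refl)
  interpret singular_kernel "kernel \<alpha>" \<alpha> C S by (rule ker)
  fix t assume t: "t \<in> {0..T}"
  let ?g = "ml_mult \<alpha> 1 (\<lambda>_. 1) t (dcoef u0)"
  let ?N = "lebesgue_on {0..t}"
  let ?f = "\<lambda>\<tau>. R_op \<Omega> \<theta> \<phi> \<alpha> (t - \<tau>) (H_op \<Omega> \<eta> (u \<tau>))"
  let ?h = "\<lambda>\<tau>. H_vec \<eta> (dcoef (u \<tau>))"
  have tS: "t \<in> {0..S}" using t T by auto
  have uD: "u \<tau> \<in> D1" if "\<tau> \<in> {0..T}" for \<tau> using u that by (auto simp: C_in_D1_iff)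
  have hc: "continuous_on {0..t} ?h"
    using u t by (intro continuous_on_compose2[OF F, of "{0..t}"]) (auto simp: C_in_D1_iff intro: continuous_on_subset)
  have f: "?f \<tau> = dsynth ((t - \<tau>) powr (\<alpha> - 1) *\<^sub>R kernel \<alpha> (t - \<tau>) (?h \<tau>))" if "\<tau> \<in> {0..t}" for \<tau>
    using that t T by (intro R_op_eq[OF \<alpha>] uD) auto
  have ind: "indicator {0..t} \<tau> *\<^sub>R dcoef (?f \<tau>) = conv_integrand ?h t \<tau>" for \<tau>
    by (cases "\<tau> \<in> {0..t}") (simp_all add: conv_integrand_def f dsynth)
  note ci = conv_integrable[OF tS hc]
  have cm: "conv_integrand ?h t \<in> borel_measurable lborel" using ci by auto
  \<comment> \<open>The integral over \<open>lebesgue_on {0..t}\<close> is turned into one over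
    \<open>lborel\<close> of the extension by zero; the completion does not change integrals of
    Borel functions.\<close>
  have set: "{0..t} \<inter> space lebesgue \<in> sets lebesgue" by simp
  have int: "integrable ?N (\<lambda>\<tau>. dcoef (?f \<tau>))"
    unfolding integrable_restrict_space[OF set] ind
    using ci integrable_completion[OF cm] by simp
  have val: "(\<integral>\<tau>. dcoef (?f \<tau>) \<partial>?N) = conv ?h t"
    unfolding integral_restrict_space[OF set] ind conv_def
    using integral_completion[OF cm] by simp
  have fin: "finite_measure ?N" by (rule finite_measure_lebesgue_on) simp
  have fD: "?f \<tau> \<in> D1" if "\<tau> \<in> space ?N" for \<tau> using that by (simp add: f dsynth)
  have B: "has_bochner_integral_in D1 N1 ?N ?f I \<longleftrightarrow> I \<in> D1 \<and> dcoef I = conv ?h t" for I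
    using has_bochner_integral_in_D1_iff[OF fin fD int] unfolding val .
  have S: "S_op \<Omega> \<theta> \<phi> \<alpha> t u0 = dsynth ?g" by (rule S_op_eq[OF \<alpha> tS u0])
  have eq: "(AE x in M. u t x = S_op \<Omega> \<theta> \<phi> \<alpha> t u0 x + I x) \<longleftrightarrow> dcoef (u t) = ?g + dcoef I" if I: "I \<in> D1" for I
    unfolding S using D1_lincomb[OF dsynth(1) I, of 1 ?g 1] dcoef_eq_iff[OF uD[OF t], of "\<lambda>x. dsynth ?g x + I x"]
    by (simp add: dsynth)
  show "(H_op \<Omega> \<eta> (u t) \<in> D_dual \<Omega> \<theta> \<phi> 1 \<and>
      (\<exists>I. has_bochner_integral_in D1 N1 ?N ?f I \<and> (AE x in M. u t x = S_op \<Omega> \<theta> \<phi> \<alpha> t u0 x + I x)))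
    \<longleftrightarrow> dcoef (u t) = ?g + conv ?h t"
  proof
    assume "H_op \<Omega> \<eta> (u t) \<in> D_dual \<Omega> \<theta> \<phi> 1 \<and>
      (\<exists>I. has_bochner_integral_in D1 N1 ?N ?f I \<and> (AE x in M. u t x = S_op \<Omega> \<theta> \<phi> \<alpha> t u0 x + I x))"
    then obtain I where "I \<in> D1" "dcoef I = conv ?h t" "AE x in M. u t x = S_op \<Omega> \<theta> \<phi> \<alpha> t u0 x + I x"
      unfolding B by blast
    then show "dcoef (u t) = ?g + conv ?h t" using eq[of I] by simp
  next
    assume "dcoef (u t) = ?g + conv ?h t"
    then have "AE x in M. u t x = S_op \<Omega> \<theta> \<phi> \<alpha> t u0 x + dsynth (conv ?h t) x"
      using eq[OF dsynth(1)] dsynth(2) by simp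
    moreover have "has_bochner_integral_in D1 N1 ?N ?f (dsynth (conv ?h t))"
      unfolding B using dsynth by blast
    ultimately show "H_op \<Omega> \<eta> (u t) \<in> D_dual \<Omega> \<theta> \<phi> 1 \<and>
      (\<exists>I. has_bochner_integral_in D1 N1 ?N ?f I \<and> (AE x in M. u t x = S_op \<Omega> \<theta> \<phi> \<alpha> t u0 x + I x))"
      using H_op_dual[OF uD[OF t]] by blast
  qed
qed

lemma H_vec_locally_Lipschitz:
  "\<exists>L\<ge>0. \<forall>a b. norm a \<le> R \<longrightarrow> norm b \<le> R \<longrightarrow> norm (H_vec \<eta> a - H_vec \<eta> b) \<le> L * norm (a - b)"
proof (intro exI[of _ "real CARD('n) * (norm \<eta> / sqrt (\<theta> 0) + sob * (2 * \<bar>R\<bar>))"] conjI allI impI)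
  show "0 \<le> real CARD('n) * (norm \<eta> / sqrt (\<theta> 0) + sob * (2 * \<bar>R\<bar>))"
    using sob_nonneg eigenvalue_pos[of 0] by simp
  fix a b :: l2 assume "norm a \<le> R" "norm b \<le> R"
  then have "norm (a + b) \<le> 2 * \<bar>R\<bar>" using norm_triangle_ineq[of a b] by linarith
  then have "real CARD('n) * (norm \<eta> / sqrt (\<theta> 0) + sob * norm (a + b)) * norm (a - b)
      \<le> real CARD('n) * (norm \<eta> / sqrt (\<theta> 0) + sob * (2 * \<bar>R\<bar>)) * norm (a - b)"
    by (intro mult_right_mono mult_left_mono add_left_mono sob_nonneg) auto
  with H_vec_Lipschitz[of \<eta> a b]
  show "norm (H_vec \<eta> a - H_vec \<eta> b) \<le> real CARD('n) * (norm \<eta> / sqrt (\<theta> 0) + sob * (2 * \<bar>R\<bar>)) * norm (a - b)"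
    by linarith
qed

lemma locally_unique_mild_solution:
  assumes \<alpha>: "0 < \<alpha>" and u0: "u0 \<in> D1"
  shows "\<exists>T>0. \<exists>u\<in>C_in D1 N1 {0..T}. mild_solution \<Omega> \<theta> \<phi> \<alpha> \<eta> u0 T u \<and>
    (\<forall>v\<in>C_in D1 N1 {0..T}. mild_solution \<Omega> \<theta> \<phi> \<alpha> \<eta> u0 T v \<longrightarrow> (\<forall>t\<in>{0..T}. AE x in M. v t x = u t x))"
proof -
  \<comment> \<open>At this horizon \<open>t powr \<alpha>\<close> reaches 1/2, the radius on which
    the Mittag-Leffler bounds are available.\<close>
  define S where "S = (1/2 :: real) powr (1 / \<alpha>)"
  have S: "S > 0" "S powr \<alpha> \<le> 1/2" using \<alpha> by (simp_all add: S_def powr_powr)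
  define g where "g t = ml_mult \<alpha> 1 (\<lambda>_. 1) t (dcoef u0)" for t
  have g: "continuous_on {0..S} g"
    unfolding g_def by (rule ml_mult[OF \<alpha> zero_less_one _ S(2), of "\<lambda>_. 1"]) auto
  obtain C where "C > 0" "\<And>t. t \<in> {0..S} \<Longrightarrow> bounded_linear (kernel \<alpha> t)"
    "\<And>t a. t \<in> {0..S} \<Longrightarrow> norm (kernel \<alpha> t a) \<le> C * norm a" "\<And>a. continuous_on {0..S} (\<lambda>t. kernel \<alpha> t a)"
    unfolding kernel_def
    by (rule ml_mult[where m="\<lambda>k. \<theta> k / (1 + \<theta> k)", OF \<alpha> \<alpha> kernel_multiplier S(2)]) blast
  then have ker: "singular_kernel (kernel \<alpha>) \<alpha> C S" using \<alpha> by (intro singular_kernel.intro) auto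
  interpret singular_kernel "kernel \<alpha>" \<alpha> C S by (rule ker)
  have F: "locally_Lipschitz (H_vec \<eta>)" unfolding locally_Lipschitz_def using H_vec_locally_Lipschitz by blast
  obtain T U where T: "0 < T" "T \<le> S" and U: "continuous_on {0..T} U"
    "\<And>t. t \<in> {0..T} \<Longrightarrow> U t = g t + conv (\<lambda>\<tau>. H_vec \<eta> (U \<tau>)) t"
    using Volterra_exists[OF S(1) g F] by blast
  note mild = mild_solution_iff[OF \<alpha> S(2) ker T(2) locally_Lipschitz_continuous[OF F] u0, folded g_def]
  define u where "u t = dsynth (U t)" for t
  have u: "u \<in> C_in D1 N1 {0..T}" using U(1) by (simp add: C_in_D1_iff u_def dsynth)
  show ?thesis
  proof (intro exI[of _ T] conjI bexI[OF _ u] ballI impI)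
    show "mild_solution \<Omega> \<theta> \<phi> \<alpha> \<eta> u0 T u"
      unfolding mild[OF u] using U(2) by (simp add: u_def dsynth)
    fix v t assume v: "v \<in> C_in D1 N1 {0..T}" "mild_solution \<Omega> \<theta> \<phi> \<alpha> \<eta> u0 T v" and t: "t \<in> {0..T}"
    have vc: "continuous_on {0..T} (\<lambda>t. dcoef (v t))" using v(1) unfolding C_in_D1_iff by blast
    have ve: "dcoef (v r) = g r + conv (\<lambda>\<tau>. H_vec \<eta> (dcoef (v \<tau>))) r" if "r \<in> {0..T}" for r
      using v(2) that unfolding mild[OF v(1)] by blast
    \<comment> \<open>The competitor ranges over the whole space of continuous functions, so the
      uniqueness lemma is used here rather than the uniqueness of the fixed point inside its
      ball.\<close>
    have "dcoef (v t) = U t" by (rule Volterra_unique[OF T(2) F vc ve U t])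
    then have "dcoef (v t) = dcoef (u t)" by (simp add: u_def dsynth)
    then show "AE x in M. v t x = u t x"
      using v(1) t dcoef_eq_iff[of "v t" "u t"] by (auto simp: C_in_D1_iff u_def dsynth)
  qed (rule T)
qed

end

theorem theorem3p5:
  fixes \<Omega> :: "(real^'n::finite) set"
    and \<eta> :: "real^'n"
    and \<alpha> :: real
    and \<theta> :: "nat \<Rightarrow> real"
    and \<phi> :: "nat \<Rightarrow> real^'n \<Rightarrow> real"
    and u0 :: "real^'n \<Rightarrow> real"
  assumes "0 < \<alpha>" and "\<alpha> < 1"
    and "CARD('n) \<in> {2, 3, 4}"
    and "open \<Omega>" and "connected \<Omega>" and "\<Omega> \<noteq> {}" and "bounded \<Omega>"
    and "Ck_boundary 2 \<Omega>"
    and "dirichlet_eigensystem \<Omega> \<theta> \<phi>"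
    and "u0 \<in> D_space \<Omega> \<theta> \<phi> 1"
  shows "\<exists>T>0. \<exists>u \<in> C_in (D_space \<Omega> \<theta> \<phi> 1) (D_norm \<Omega> \<theta> \<phi> 1) {0..T}.
           mild_solution \<Omega> \<theta> \<phi> \<alpha> \<eta> u0 T u \<and>
           (\<forall>v \<in> C_in (D_space \<Omega> \<theta> \<phi> 1) (D_norm \<Omega> \<theta> \<phi> 1) {0..T}.
              mild_solution \<Omega> \<theta> \<phi> \<alpha> \<eta> u0 T v \<longrightarrow>
              (\<forall>t\<in>{0..T}. AE x in lebesgue_on \<Omega>. v t x = u t x))"
proof -
  interpret dirichlet_domain \<Omega> \<theta> \<phi> using assms by unfold_locales auto
  show ?thesis using assms by (intro locally_unique_mild_solution)
qed

end
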